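(* Let $s>1$ be sufficiently large. Let $\rho_0\in H^s(\mathbb{T})\cap\mathcal{P}(\mathbb{T})$ with $\rho_0>0$, and let $u_0=U_0'\in H^s(\mathbb{T})$ for a real-valued function $U_0$ on $\mathbb{T}$. Let $V_0=\log\rho_0$, and for $\hbar>0$ and $\varepsilon>0$ small enough that $e^{V_0}-\varepsilon V_0''>0$ set $\psi^{\mathrm{in}}_{\varepsilon,\hbar}:=\sqrt{e^{V_0}-\varepsilon V_0''}\,e^{\frac{iU_0}{\hbar}}$, $R^{\mathrm{in}}_{\varepsilon,\hbar}:=|\psi^{\mathrm{in}}_{\varepsilon,\hbar}\rangle\langle\psi^{\mathrm{in}}_{\varepsilon,\hbar}|$ (the rank-one projection on $L^2(\mathbb{T})$), and $R^{\mathrm{in}}_{\varepsilon,\hbar,N}:=(R^{\mathrm{in}}_{\varepsilon,\hbar})^{\otimes N}$. Then there exists some $\Lambda>0$ such that the $N$-body modulated energy at time $0$ satisfies $$\mathcal{E}_{\varepsilon,\hbar,N}(0)\to0\qquad\text{as }\varepsilon+\hbar+\tfrac1N\to0,$$ provided that $\varepsilon=\varepsilon(N)$ is chosen such that $\frac{1}{\varepsilon^2N^\Lambda}\to0$ as $N\to\infty$.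
   Context: $\mathbb{T}$ is the unit-length torus and $\mathcal{P}(\mathbb{T})$ the probability measures on it. For $X_N=(x_1,\dots,x_N)\in\mathbb{T}^N$, $\mu_{X_N}:=\frac1N\sum_{j=1}^N\delta_{x_j}$, and $V_{\varepsilon,X_N}\in H^1(\mathbb{T})$ is the unique solution of $-\varepsilon V_{\varepsilon,X_N}''=\mu_{X_N}-m_{\varepsilon,X_N}$ with $m_{\varepsilon,X_N}:=e^{V_{\varepsilon,X_N}}$. $K(x)=\frac{x^2-|x|}{2}$ is the Green function of the Laplacian on $\mathbb{T}$ (so $-K''=\delta_0-1$). The density of $R^{\mathrm{in}}_{\varepsilon,\hbar,N}$, i.e. the diagonal of its integral kernel, is $\rho_{\varepsilon,\hbar,N}(0,X_N)=\prod_{j=1}^N|\psi^{\mathrm{in}}_{\varepsilon,\hbar}(x_j)|^2$. The modulated energy at time $0$, for the fluid data $(\rho_0,u_0)$ and the operator $R^{\mathrm{in}}_{\varepsilon,\hbar,N}$, is $$\begin{aligned}\mathcal{E}_{\varepsilon,\hbar,N}(0):=&\frac1{2N}\sum_{j=1}^N\mathrm{tr}\big((i\hbar\partial_{x_j}+u_0(x_j))^2R^{\mathrm{in}}_{\varepsilon,\hbar,N}\big)\\&+\frac1{2\varepsilon}\int_{\mathbb{T}^N}\int_{\mathbb{T}\times\mathbb{T}}K(x-y)(\mu_{X_N}-m_{\varepsilon,X_N})^{\otimes2}(dx\,dy)\,\rho_{\varepsilon,\hbar,N}(0,X_N)\,dX_N\\&+\int_{\mathbb{T}^N}\int_{\mathbb{T}}\Big(m_{\varepsilon,X_N}(x)\log\frac{m_{\varepsilon,X_N}(x)}{\rho_0(x)}-m_{\varepsilon,X_N}(x)+\rho_0(x)\Big)dx\,\rho_{\varepsilon,\hbar,N}(0,X_N)\,dX_N.\end{aligned}$$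 *)

theory Defs
  imports "HOL-Probability.Probability"
begin

text \<open>
  The unit torus is represented by \<open>[0,1)\<close>. Functions on the torus are 1-periodic functions on the
  real line, and \<open>X :: nat \<Rightarrow> real\<close>, restricted to the indices \<open>{..<N}\<close>, is an \<open>N\<close>-tuple of points;
  particles are numbered from \<open>0\<close>.
\<close>

definition torus :: "real measure" where
  "torus = restrict_space lborel {0..<1}"

definition torus_pow :: "nat \<Rightarrow> (nat \<Rightarrow> real) measure" where
  "torus_pow N = PiM {..<N} (\<lambda>_. torus)"

definition periodic :: "(real \<Rightarrow> 'a) \<Rightarrow> bool" where
  "periodic f \<longleftrightarrow> (\<forall>x. f (x + 1) = f x)"

definition smooth :: "(real \<Rightarrow> real) \<Rightarrow> bool" where
  "smooth f \<longleftrightarrow> (\<forall>n. (deriv ^^ n) f differentiable_on UNIV)"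

definition fourier_coeff :: "(real \<Rightarrow> real) \<Rightarrow> int \<Rightarrow> complex" where
  "fourier_coeff f k = (LINT x|torus. complex_of_real (f x) * cis (- (2 * pi * of_int k * x)))"

text \<open>
  The Sobolev space \<open>H\<^sup>s\<close> of the torus. It is used only for \<open>s \<ge> 1\<close>, where every class has a unique
  continuous representative; the predicate holds of that representative, so that pointwise
  values and classical derivatives are meaningful.
\<close>

definition sobolev :: "real \<Rightarrow> (real \<Rightarrow> real) \<Rightarrow> bool" where
  "sobolev s f \<longleftrightarrow> periodic f \<and> continuous_on UNIV f \<and>
     (\<lambda>k::int. (1 + (of_int k)\<^sup>2) powr s * (cmod (fourier_coeff f k))\<^sup>2) summable_on UNIV"

definition prob_density :: "(real \<Rightarrow> real) \<Rightarrow> bool" where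
  "prob_density f \<longleftrightarrow> periodic f \<and> (\<forall>x. 0 \<le> f x) \<and> integrable torus f \<and> (LINT x|torus. f x) = 1"

definition empirical :: "nat \<Rightarrow> (nat \<Rightarrow> real) \<Rightarrow> real measure" where
  "empirical N X = distr (uniform_count_measure {..<N}) torus X"

text \<open>
  \<open>V\<close> lies in \<open>H\<^sup>1\<close> and solves \<open>- \<epsilon> V'' = \<mu> - e\<^sup>V\<close> on the torus in the sense of distributions.
\<close>

definition poisson_solution :: "real \<Rightarrow> real measure \<Rightarrow> (real \<Rightarrow> real) \<Rightarrow> bool" where
  "poisson_solution \<epsilon> \<mu> V \<longleftrightarrow> sobolev 1 V \<and>
     (\<forall>\<phi>. smooth \<phi> \<and> periodic \<phi> \<longrightarrow>
        - \<epsilon> * (LINT x|torus. V x * deriv (deriv \<phi>) x)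
          = (LINT x|\<mu>. \<phi> x) - (LINT x|torus. exp (V x) * \<phi> x))"

definition potential :: "real \<Rightarrow> nat \<Rightarrow> (nat \<Rightarrow> real) \<Rightarrow> real \<Rightarrow> real" where
  "potential \<epsilon> N X = (THE V. poisson_solution \<epsilon> (empirical N X) V)"

definition mb_density :: "real \<Rightarrow> nat \<Rightarrow> (nat \<Rightarrow> real) \<Rightarrow> real \<Rightarrow> real" where
  "mb_density \<epsilon> N X x = exp (potential \<epsilon> N X x)"

text \<open>
  The function \<open>(x\<^sup>2 - \<bar>x\<bar>)/2\<close> takes the same value at \<open>x\<close> and \<open>x - 1\<close> for \<open>x \<in> [0,1]\<close>, so its
  1-periodic extension agrees with the formula on all of \<open>[-1,1]\<close>.
\<close>

definition green :: "real \<Rightarrow> real" where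
  "green x = ((frac x)\<^sup>2 - \<bar>frac x\<bar>) / 2"

lemma green_eq:
  assumes "\<bar>x\<bar> \<le> 1"
  shows "green x = (x\<^sup>2 - \<bar>x\<bar>) / 2"
proof -
  consider "x = 1" | "x = -1" | "0 \<le> x" "x < 1" | "-1 < x" "x < 0"
    using assms by linarith
  then show ?thesis
  proof cases
    case 3
    then have "frac x = x" by (simp add: frac_eq)
    then show ?thesis by (simp add: green_def)
  next
    case 4
    then have "frac x = x + 1" by (simp add: frac_unique_iff)
    then show ?thesis using 4 by (simp add: green_def power2_eq_square algebra_simps)
  next
    case 2
    have "frac (-1 :: real) = 0" by (simp add: frac_def)
    then show ?thesis by (simp only: green_def 2) simp
  qed (simp_all add: green_def)
qed

text \<open>The integral of \<open>f\<close> against \<open>(\<mu> - \<nu>) \<otimes> (\<mu> - \<nu>)\<close> for finite positive measures.\<close>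

definition diff_square_integral ::
  "real measure \<Rightarrow> real measure \<Rightarrow> (real \<Rightarrow> real \<Rightarrow> real) \<Rightarrow> real" where
  "diff_square_integral \<mu> \<nu> f =
     (LINT (x,y)|(\<mu> \<Otimes>\<^sub>M \<mu>). f x y) - (LINT (x,y)|(\<mu> \<Otimes>\<^sub>M \<nu>). f x y)
     - (LINT (x,y)|(\<nu> \<Otimes>\<^sub>M \<mu>). f x y) + (LINT (x,y)|(\<nu> \<Otimes>\<^sub>M \<nu>). f x y)"

type_synonym wave = "(nat \<Rightarrow> real) \<Rightarrow> complex"
type_synonym kernel = "(nat \<Rightarrow> real) \<Rightarrow> (nat \<Rightarrow> real) \<Rightarrow> complex"

definition inner_prod :: "nat \<Rightarrow> wave \<Rightarrow> wave \<Rightarrow> complex" where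
  "inner_prod N \<Phi> \<Psi> = (LINT X|torus_pow N. cnj (\<Phi> X) * \<Psi> X)"

definition fourier_mode :: "nat \<Rightarrow> (nat \<Rightarrow> int) \<Rightarrow> wave" where
  "fourier_mode N k X = (\<Prod>j<N. cis (2 * pi * of_int (k j) * X j))"

text \<open>
  The trace on \<open>L\<^sup>2\<close> of the \<open>N\<close>-dimensional torus, computed in the orthonormal Fourier basis; the trace of
  a trace-class operator does not depend on the basis.
\<close>

definition op_trace :: "nat \<Rightarrow> (wave \<Rightarrow> wave) \<Rightarrow> complex" where
  "op_trace N T = (\<Sum>\<^sub>\<infinity>k\<in>({..<N} \<rightarrow>\<^sub>E (UNIV :: int set)).
      inner_prod N (fourier_mode N k) (T (fourier_mode N k)))"

definition kernel_op :: "nat \<Rightarrow> kernel \<Rightarrow> wave \<Rightarrow> wave" where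
  "kernel_op N R \<Phi> X = (LINT Y|torus_pow N. R X Y * \<Phi> Y)"

definition kernel_density :: "kernel \<Rightarrow> (nat \<Rightarrow> real) \<Rightarrow> real" where
  "kernel_density R X = Re (R X X)"

definition ketbra :: "(real \<Rightarrow> complex) \<Rightarrow> real \<Rightarrow> real \<Rightarrow> complex" where
  "ketbra \<psi> x y = \<psi> x * cnj (\<psi> y)"

text \<open>The tensor power of an integral operator has the product of the kernels as its kernel.\<close>

definition tensor_pow :: "nat \<Rightarrow> (real \<Rightarrow> real \<Rightarrow> complex) \<Rightarrow> kernel" where
  "tensor_pow N r X Y = (\<Prod>j<N. r (X j) (Y j))"

lemma kernel_density_tensor_pow_ketbra:
  "kernel_density (tensor_pow N (ketbra \<psi>)) X = (\<Prod>j<N. (cmod (\<psi> (X j)))\<^sup>2)"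
proof -
  have "tensor_pow N (ketbra \<psi>) X X = complex_of_real (\<Prod>j<N. (cmod (\<psi> (X j)))\<^sup>2)"
    unfolding tensor_pow_def ketbra_def of_real_prod
    by (intro prod.cong refl) (rule complex_norm_square[symmetric])
  then show ?thesis by (simp only: kernel_density_def Re_complex_of_real)
qed

text \<open>The operator \<open>i h \<partial>\<^sub>j + u(x\<^sub>j)\<close> with \<open>h\<close> the reduced Planck constant.\<close>

definition momentum :: "real \<Rightarrow> (real \<Rightarrow> real) \<Rightarrow> nat \<Rightarrow> wave \<Rightarrow> wave" where
  "momentum h u j \<Phi> X =
     \<i> * complex_of_real h * vector_derivative (\<lambda>t. \<Phi> (X(j := t))) (at (X j))
     + complex_of_real (u (X j)) * \<Phi> X"

definition modulated_energy ::
  "(real \<Rightarrow> real) \<Rightarrow> (real \<Rightarrow> real) \<Rightarrow> real \<Rightarrow> real \<Rightarrow> nat \<Rightarrow> kernel \<Rightarrow> real" where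
  "modulated_energy \<rho>\<^sub>0 u\<^sub>0 \<epsilon> h N R =
     1 / (2 * real N) *
       (\<Sum>j<N. Re (op_trace N (momentum h u\<^sub>0 j \<circ> momentum h u\<^sub>0 j \<circ> kernel_op N R)))
     + 1 / (2 * \<epsilon>) *
       (LINT X|torus_pow N.
          diff_square_integral (empirical N X)
            (density torus (\<lambda>x. ennreal (mb_density \<epsilon> N X x))) (\<lambda>x y. green (x - y))
          * kernel_density R X)
     + (LINT X|torus_pow N.
          (LINT x|torus. mb_density \<epsilon> N X x * ln (mb_density \<epsilon> N X x / \<rho>\<^sub>0 x)
             - mb_density \<epsilon> N X x + \<rho>\<^sub>0 x)
          * kernel_density R X)"

definition init_density :: "(real \<Rightarrow> real) \<Rightarrow> real \<Rightarrow> real \<Rightarrow> real" where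
  "init_density V\<^sub>0 \<epsilon> x = exp (V\<^sub>0 x) - \<epsilon> * deriv (deriv V\<^sub>0) x"

definition init_wave ::
  "(real \<Rightarrow> real) \<Rightarrow> (real \<Rightarrow> real) \<Rightarrow> real \<Rightarrow> real \<Rightarrow> real \<Rightarrow> complex" where
  "init_wave V\<^sub>0 U\<^sub>0 \<epsilon> h x =
     complex_of_real (sqrt (init_density V\<^sub>0 \<epsilon> x)) * exp (\<i> * complex_of_real (U\<^sub>0 x / h))"

definition init_kernel ::
  "(real \<Rightarrow> real) \<Rightarrow> (real \<Rightarrow> real) \<Rightarrow> real \<Rightarrow> real \<Rightarrow> nat \<Rightarrow> kernel" where
  "init_kernel V\<^sub>0 U\<^sub>0 \<epsilon> h N = tensor_pow N (ketbra (init_wave V\<^sub>0 U\<^sub>0 \<epsilon> h))"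

end

theory Submission
  imports Defs
begin

text \<open>
  All three parts of the modulated energy are bounded explicitly, for small \<open>\<epsilon>\<close>, by a constant times
  \<open>h\<^sup>2 + 1/(\<epsilon> N) + \<epsilon>\<close> (theorem \<open>modulated_energy_bound\<close>). With \<open>\<Lambda> = 2\<close> the assumption
  on \<open>\<epsilon>\<close> says exactly that \<open>1/(\<epsilon> N)\<^sup>2 \<rightarrow> 0\<close>, so the bound tends to \<open>0\<close>.

  Kinetic part. The initial wave is \<open>\<psi> = a e\<^sup>i\<^sup>U\<^sup>/\<^sup>h\<close> with amplitude
  \<open>a = (\<rho>\<^sub>0 - \<epsilon> V\<^sub>0'')\<^sup>1\<^sup>/\<^sup>2\<close>. The velocity \<open>u\<^sub>0 = U'\<close> cancels the gradient of the phase, so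
  \<open>(i h d + u\<^sub>0)\<^sup>2 \<psi> = - h\<^sup>2 a'' e\<^sup>i\<^sup>U\<^sup>/\<^sup>h\<close>. The trace over the Fourier basis factorises over the
  particles, and Parseval's identity evaluates it to \<open>- h\<^sup>2 \<integral> a a''\<close> (\<open>trace_momentum_square\<close>).

  Potential part and entropy. Fix a configuration with empirical measure \<open>\<mu>\<close> and let
  \<open>m = e\<^sup>V\<close> solve \<open>- \<epsilon> V'' = \<mu> - m\<close>. The initial density \<open>\<rho> = \<rho>\<^sub>0 - \<epsilon> V\<^sub>0''\<close> is chosen so that
  \<open>- \<epsilon> V\<^sub>0'' = \<rho> - \<rho>\<^sub>0\<close> with \<open>\<rho>\<^sub>0 = exp V\<^sub>0\<close>, which is the same equation with \<open>\<rho>\<close> in place of \<open>\<mu>\<close>. Write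
  \<open>\<langle>\<alpha>, \<beta>\<rangle>\<close> for the integral of \<open>green (x - y)\<close> against \<open>\<alpha> \<otimes> \<beta>\<close>; it is positive semidefinite on
  measures of total mass zero. With \<open>\<sigma> = \<mu> - \<rho>\<close> and \<open>\<eta> = m - \<rho>\<^sub>0\<close>, subtracting the two equations and
  pairing with \<open>\<eta>\<close> gives

    \<open>J := \<integral> (m - \<rho>\<^sub>0) (V - V\<^sub>0) = \<langle>\<eta>, \<sigma> - \<eta>\<rangle> / \<epsilon> \<le> \<langle>\<sigma>, \<sigma>\<rangle> / (4 \<epsilon>)\<close>,

  and the relative entropy of \<open>m\<close> with respect to \<open>\<rho>\<^sub>0\<close> lies between \<open>0\<close> and \<open>J\<close>. Since \<open>J \<ge> 0\<close>, the
  interaction energy \<open>\<langle>\<mu> - m, \<mu> - m\<rangle>\<close> is at most \<open>2 \<langle>\<sigma>, \<sigma>\<rangle> + 2 \<langle>\<rho> - \<rho>\<^sub>0, \<rho> - \<rho>\<^sub>0\<rangle>\<close>, whose last term is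
  of order \<open>\<epsilon>\<^sup>2\<close> (\<open>energy_bounds\<close>). It remains to average \<open>\<langle>\<sigma>, \<sigma>\<rangle>\<close>: the particles are independent
  with density \<open>\<rho>\<close>, and \<open>\<langle>\<sigma>, \<sigma>\<rangle>\<close> is a squared \<open>L\<^sup>2\<close> distance between an empirical and an exact
  distribution function, so its mean is of order \<open>1/N\<close> (\<open>expected_step_distance\<close>).

  Two facts support this. The potential is defined by a unique choice, so existence and
  uniqueness of \<open>V\<close> have to be established for every configuration (\<open>potential_representation\<close>,
  \<open>poisson_solution_le\<close>). And data of Sobolev class \<open>s \<ge> 5\<close> are four times continuously
  differentiable (\<open>sobolev_imp_C4\<close>), as needed because \<open>a''\<close> contains the fourth derivative of \<open>V\<^sub>0\<close>.
\<close>

section \<open>Integration over the torus\<close>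

lemma space_torus [simp]: "space torus = {0..<1}"
  by (simp add: torus_def space_restrict_space)

lemma measurable_torus_borel: "f \<in> borel_measurable borel \<Longrightarrow> f \<in> borel_measurable torus"
  by (simp add: torus_def measurable_restrict_space1)

lemma continuous_measurable_torus [measurable]:
  "continuous_on UNIV f \<Longrightarrow> f \<in> borel_measurable torus"
  by (intro measurable_torus_borel borel_measurable_continuous_onI)

lemma prob_space_torus: "prob_space torus"
proof
  show "emeasure torus (space torus) = 1"
    by (simp add: torus_def emeasure_restrict_space)
qed

interpretation torus: prob_space torus
  by (rule prob_space_torus)

lemma measure_torus [simp]: "measure torus {0..<1} = 1"
  using torus.prob_space by simp

lemma integrable_torus_bounded:
  fixes f :: "real \<Rightarrow> 'a::{banach, second_countable_topology}"
  assumes "f \<in> borel_measurable torus" "\<And>x. 0 \<le> x \<Longrightarrow> x < 1 \<Longrightarrow> norm (f x) \<le> B"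
  shows "integrable torus f"
  by (rule torus.integrable_const_bound[of _ B]) (use assms in auto)

lemma continuous_bounded_unit:
  fixes f :: "real \<Rightarrow> 'a::real_normed_vector"
  assumes "continuous_on UNIV f"
  obtains B where "B > 0" "\<And>x. 0 \<le> x \<Longrightarrow> x \<le> 1 \<Longrightarrow> norm (f x) \<le> B"
proof -
  have "compact (f ` {0..1})"
    using assms by (intro compact_continuous_image) (auto intro: continuous_on_subset)
  then obtain B where "B > 0" "\<And>y. y \<in> f ` {0..1} \<Longrightarrow> norm y \<le> B"
    using compact_imp_bounded bounded_pos by metis
  then show thesis using that by auto
qed

lemma integrable_torus_continuous [intro]:
  fixes f :: "real \<Rightarrow> 'a::{banach, second_countable_topology}"
  assumes "continuous_on UNIV f"
  shows "integrable torus f"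
proof -
  obtain B where "\<And>x. 0 \<le> x \<Longrightarrow> x \<le> 1 \<Longrightarrow> norm (f x) \<le> B"
    using continuous_bounded_unit[OF assms] by blast
  then show ?thesis
    using assms by (intro integrable_torus_bounded[of f B]) (auto intro: continuous_measurable_torus)
qed

lemma integrable_torus_mult_bounded:
  fixes f g :: "real \<Rightarrow> real"
  assumes f: "continuous_on UNIV f" and g: "g \<in> borel_measurable torus" "\<And>x. 0 \<le> x \<Longrightarrow> x < 1 \<Longrightarrow> \<bar>g x\<bar> \<le> C"
  shows "integrable torus (\<lambda>x. f x * g x)"
proof -
  obtain B where B: "B > 0" "\<And>x. 0 \<le> x \<Longrightarrow> x \<le> 1 \<Longrightarrow> norm (f x) \<le> B"
    using continuous_bounded_unit[OF f] by blast
  show ?thesis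
  proof (rule integrable_torus_bounded)
    show "(\<lambda>x. f x * g x) \<in> borel_measurable torus"
      by (intro borel_measurable_times continuous_measurable_torus f g)
    show "norm (f x * g x) \<le> B * C" if "0 \<le> x" "x < 1" for x
      unfolding norm_mult using B g(2)[OF that] that by (intro mult_mono) auto
  qed
qed

lemma torus_FTC:
  fixes F f :: "real \<Rightarrow> real"
  assumes "\<And>x. (F has_real_derivative f x) (at x)" "continuous_on UNIV f"
  shows "(LINT x|torus. f x) = F 1 - F 0"
proof -
  have [measurable]: "f \<in> borel_measurable borel"
    using assms(2) by (rule borel_measurable_continuous_onI)
  have "(LINT x|torus. f x) = (LINT x|lborel. indicator {0..<1} x *\<^sub>R f x)"
    by (simp add: torus_def integral_restrict_space)
  also have "\<dots> = (LINT x|lborel. f x * indicator {0..1} x)"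
    by (rule integral_cong_AE)
      (use AE_lborel_singleton[of "1::real"] in \<open>auto simp: indicator_def elim!: eventually_mono\<close>)
  also have "\<dots> = F 1 - F 0"
    using assms by (intro integral_FTC_Icc_real) (auto simp: continuous_on_eq_continuous_at)
  finally show ?thesis .
qed

lemma continuous_antiderivative:
  fixes f :: "real \<Rightarrow> real"
  assumes "continuous_on UNIV f"
  obtains F where "\<And>x. (F has_real_derivative f x) (at x)"
proof -
  have "\<exists>F. \<forall>x::real. -\<infinity> < ereal x \<longrightarrow> ereal x < \<infinity> \<longrightarrow> (F has_vector_derivative f x) (at x)"
    by (rule einterval_antiderivative) (use assms in \<open>auto simp: continuous_on_eq_continuous_at\<close>)
  then show thesis
    using that by (auto simp: has_real_derivative_iff_has_vector_derivative)
qed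

lemma periodic_add_nat: "periodic f \<Longrightarrow> f (x + real n) = f x"
proof (induction n)
  case (Suc n)
  have "f (x + real (Suc n)) = f ((x + real n) + 1)"
    by (simp add: ac_simps)
  also have "\<dots> = f (x + real n)"
    using Suc.prems unfolding periodic_def by blast
  finally show ?case using Suc by simp
qed simp

lemma periodic_frac:
  assumes "periodic f"
  shows "f (frac x) = f x"
proof (cases "\<lfloor>x\<rfloor> \<ge> 0")
  case True
  then show ?thesis
    using periodic_add_nat[OF assms, of "frac x" "nat \<lfloor>x\<rfloor>"] by (simp add: frac_def)
next
  case False
  then show ?thesis
    using periodic_add_nat[OF assms, of "x" "nat (- \<lfloor>x\<rfloor>)"] by (simp add: frac_def)
qed

text \<open>
  With an antiderivative \<open>F\<close> of \<open>f\<close>, the function \<open>c \<mapsto> F (c + 1) - F c\<close> has derivative zero by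
  periodicity, so the integral over every interval of length one is the same.
\<close>

lemma
  fixes f :: "real \<Rightarrow> real"
  assumes cont: "continuous_on UNIV f" and per: "periodic f"
  shows torus_shift: "(LINT x|torus. f (x + c)) = (LINT x|torus. f x)"
    and torus_reflect: "(LINT x|torus. f (c - x)) = (LINT x|torus. f x)"
proof -
  obtain F where F: "\<And>x. (F has_real_derivative f x) (at x)"
    using continuous_antiderivative[OF cont] by blast
  have dF: "((\<lambda>x. F (g x)) has_real_derivative f (g x) * d) (at x)"
    if "(g has_real_derivative d) (at x)" for g d x
    using DERIV_chain2[OF F that] .
  have "((\<lambda>c. F (c + 1) - F c) has_real_derivative f (x + 1) - f x) (at x)" for x
    using F[of "x + 1"] by (intro DERIV_diff F) (simp add: DERIV_shift)
  then have const: "F (a + 1) - F a = F (b + 1) - F b" for a b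
    using per by (intro DERIV_isconst_all[of "\<lambda>c. F (c + 1) - F c"]) (simp add: periodic_def)
  have f: "(LINT x|torus. f x) = F 1 - F 0"
    using torus_FTC[OF F cont] .
  have "(LINT x|torus. f (x + c)) = F (1 + c) - F (0 + c)"
  proof (rule torus_FTC)
    show "((\<lambda>x. F (x + c)) has_real_derivative f (x + c)) (at x)" for x
      using F[of "x + c"] by (simp add: DERIV_shift)
    show "continuous_on UNIV (\<lambda>x. f (x + c))"
      by (rule continuous_on_compose2[OF cont]) (auto intro: continuous_intros)
  qed
  with f const[of c 0] show "(LINT x|torus. f (x + c)) = (LINT x|torus. f x)"
    by (simp add: add.commute)
  have "(LINT x|torus. f (c - x)) = - F (c - 1) - (- F (c - 0))"
  proof (rule torus_FTC)
    show "((\<lambda>x. - F (c - x)) has_real_derivative f (c - x)) (at x)" for x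
      using DERIV_minus[OF dF[OF DERIV_diff[OF DERIV_const[of c] DERIV_ident]]] by simp
    show "continuous_on UNIV (\<lambda>x. f (c - x))"
      by (rule continuous_on_compose2[OF cont]) (auto intro: continuous_intros)
  qed
  with f const[of "c - 1" 0] show "(LINT x|torus. f (c - x)) = (LINT x|torus. f x)"
    by simp
qed

lemma torus_integral_deriv_periodic:
  fixes F f :: "real \<Rightarrow> real"
  assumes "\<And>x. (F has_real_derivative f x) (at x)" "continuous_on UNIV f" "periodic F"
  shows "(LINT x|torus. f x) = 0"
  using torus_FTC[OF assms(1,2)] assms(3)[unfolded periodic_def, rule_format, of 0] by simp

lemma periodic_deriv:
  fixes F f :: "real \<Rightarrow> real"
  assumes "\<And>x. (F has_real_derivative f x) (at x)" "periodic F"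
  shows "periodic f"
  unfolding periodic_def
proof
  fix x
  have "((\<lambda>x. F (x + 1)) has_real_derivative f (x + 1)) (at x)"
    using assms(1)[of "x + 1"] by (simp add: DERIV_shift)
  then have "(F has_real_derivative f (x + 1)) (at x)"
    using assms(2) by (simp add: periodic_def)
  then show "f (x + 1) = f x"
    using assms(1) DERIV_unique by blast
qed

text \<open>
  An antiderivative of \<open>f\<^sup>2\<close> is monotone with equal values at \<open>0\<close> and \<open>1\<close>, hence constant in between.
\<close>

lemma torus_integral_square_zero:
  fixes f :: "real \<Rightarrow> real"
  assumes cont: "continuous_on UNIV f" and per: "periodic f"
    and zero: "(LINT x|torus. f x * f x) = 0"
  shows "f x = 0"
proof -
  have cont2: "continuous_on UNIV (\<lambda>x. f x * f x)"
    using cont by (intro continuous_intros)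
  have pos: "f x = 0" if x: "0 < x" "x < 1" for x
  proof -
    obtain F where F: "\<And>x. (F has_real_derivative f x * f x) (at x)"
      using continuous_antiderivative[OF cont2] by blast
    have mono: "F a \<le> F b" if "a \<le> b" for a b
      using F that by (intro DERIV_nonneg_imp_nondecreasing[of a b F]) (auto intro!: exI)
    have "F 1 = F 0"
      using torus_FTC[OF F cont2] zero by simp
    then have const: "F y = F 0" if "0 \<le> y" "y \<le> 1" for y
      using mono[of 0 y] mono[of y 1] that by simp
    have "\<forall>y. \<bar>x - y\<bar> < min x (1 - x) \<longrightarrow> F x = F y"
    proof (intro allI impI)
      fix y assume "\<bar>x - y\<bar> < min x (1 - x)"
      then have "0 \<le> y" "y \<le> 1" by auto
      then have "F y = F 0"
        by (rule const)
      moreover have "F x = F 0"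
        by (rule const) (use x in auto)
      ultimately show "F x = F y"
        by (rule trans[OF _ sym, rotated])
    qed
    then have "f x * f x = 0"
      using DERIV_local_const[OF F, of "min x (1 - x)" x] x by simp
    then show ?thesis by simp
  qed
  have "f x = 0" if "x \<in> {0..1}" for x
  proof (rule continuous_constant_on_closure[where S = "{0<..<1::real}" and f = f and a = 0 and x = x])
    show "continuous_on (closure {0<..<1::real}) f"
      by (rule continuous_on_subset[OF cont]) simp
    show "f y = 0" if "y \<in> {0<..<1}" for y
      using pos that by simp
    show "x \<in> closure {0<..<1::real}"
      using that by simp
  qed
  then have "f (frac x) = 0"
    using frac_lt_1[of x] by (simp add: less_imp_le)
  then show ?thesis
    by (simp add: periodic_frac[OF per])
qed

section \<open>Fourier coefficients determine a continuous function\<close>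

definition fcoeff :: "(real \<Rightarrow> complex) \<Rightarrow> int \<Rightarrow> complex" where
  "fcoeff f k = (LINT x|torus. f x * cis (- (2 * pi * of_int k * x)))"

lemma fourier_coeff_eq_fcoeff: "fourier_coeff f k = fcoeff (\<lambda>x. complex_of_real (f x)) k"
  by (simp add: fourier_coeff_def fcoeff_def)

lemma continuous_on_cis_mult [continuous_intros]:
  "continuous_on S (\<lambda>x. cis (c * x))" "continuous_on S (\<lambda>x. cis (- (c * x)))"
  unfolding cis_conv_exp by (intro continuous_intros)+

lemma continuous_real_polynomial_cis:
  assumes "real_polynomial_function p"
  shows "continuous_on UNIV (\<lambda>x. p (cis (2 * pi * x)))"
proof -
  have "continuous_on UNIV p"
    using assms continuous_on_polymonial_function real_polynomial_function_eq by blast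
  then show ?thesis
    by (rule continuous_on_compose2) (auto intro: continuous_intros)
qed

text \<open>
  Multiplication by \<open>cos (2 \<pi> x)\<close> or \<open>sin (2 \<pi> x)\<close> combines two shifted copies of the Fourier
  coefficients. Hence the functions with vanishing coefficients are stable under multiplication by the coordinates of
  the circle, and so by every polynomial in them. Quantifying over \<open>f\<close> makes the induction pass
  through products.
\<close>

lemma fcoeff_mult_trig_polynomial:
  fixes p :: "complex \<Rightarrow> real"
  assumes "real_polynomial_function p"
  shows "continuous_on UNIV f \<Longrightarrow> (\<And>k. fcoeff f k = 0) \<Longrightarrow>
    fcoeff (\<lambda>x. f x * complex_of_real (p (cis (2 * pi * x)))) k = 0"
  using assms
proof (induction arbitrary: f k rule: real_polynomial_function.induct)
  case (linear p)
  define a b where "a = complex_of_real (p 1)" and "b = complex_of_real (p \<i>)"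
  have cont: "continuous_on UNIV (\<lambda>x. f x * cis (- (2 * pi * of_int k * x)))" for k
    using linear.prems(1) by (intro continuous_intros)
  have p: "complex_of_real (p (cis (2 * pi * x)))
      = (a - \<i> * b) / 2 * cis (2 * pi * x) + (a + \<i> * b) / 2 * cis (- (2 * pi * x))" for x
  proof -
    have "p (cis t) = cos t * p 1 + sin t * p \<i>" for t
    proof -
      have "cis t = cos t *\<^sub>R 1 + sin t *\<^sub>R \<i>"
        by (simp add: complex_eq_iff)
      then have "p (cis t) = p (cos t *\<^sub>R 1 + sin t *\<^sub>R \<i>)" by simp
      also have "\<dots> = cos t * p 1 + sin t * p \<i>"
        using linear.hyps by (simp only: linear_simps real_scaleR_def)
      finally show ?thesis .
    qed
    then show ?thesis
      by (simp add: a_def b_def complex_eq_iff field_simps)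
  qed
  then have "f x * complex_of_real (p (cis (2 * pi * x))) * cis (- (2 * pi * of_int k * x))
     = (a - \<i> * b) / 2 * (f x * cis (- (2 * pi * of_int (k - 1) * x)))
     + (a + \<i> * b) / 2 * (f x * cis (- (2 * pi * of_int (k + 1) * x)))" for x
  proof -
    have 1: "cis (2 * pi * x) * cis (- (2 * pi * of_int k * x)) = cis (- (2 * pi * of_int (k - 1) * x))"
      "cis (- (2 * pi * x)) * cis (- (2 * pi * of_int k * x)) = cis (- (2 * pi * of_int (k + 1) * x))"
      by (simp_all add: cis_mult algebra_simps)
    have ring: "F * (\<alpha> * u + \<beta> * v) * w = \<alpha> * (F * (u * w)) + \<beta> * (F * (v * w))"
      for F u v w \<alpha> \<beta> :: complex
      by (simp add: algebra_simps)
    show ?thesis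
      by (simp only: p ring 1)
  qed
  then have "fcoeff (\<lambda>x. f x * complex_of_real (p (cis (2 * pi * x)))) k
     = (a - \<i> * b) / 2 * fcoeff f (k - 1) + (a + \<i> * b) / 2 * fcoeff f (k + 1)"
    unfolding fcoeff_def using cont
    by (simp only: Bochner_Integration.integral_add integral_mult_right_zero
        integrable_mult_right integrable_torus_continuous)
  then show ?case using linear.prems by simp
next
  case (const c)
  then show ?case
    by (simp add: fcoeff_def mult.commute[of _ "complex_of_real c"] mult.assoc)
next
  case (add p q)
  have int: "integrable torus (\<lambda>x. f x * complex_of_real (r (cis (2 * pi * x))) * cis (- (2 * pi * of_int k * x)))"
    if "real_polynomial_function r" for r
    using add.prems(1) continuous_real_polynomial_cis[OF that]
    by (intro integrable_torus_continuous continuous_intros)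
  have "f x * complex_of_real (p (cis (2 * pi * x)) + q (cis (2 * pi * x))) * cis (- (2 * pi * of_int k * x))
     = f x * complex_of_real (p (cis (2 * pi * x))) * cis (- (2 * pi * of_int k * x))
     + f x * complex_of_real (q (cis (2 * pi * x))) * cis (- (2 * pi * of_int k * x))" for x
    by (simp only: of_real_add distrib_left distrib_right)
  then show ?case
    using add.IH(1)[OF add.prems, of k] add.IH(2)[OF add.prems, of k]
      Bochner_Integration.integral_add[OF int[OF add.hyps(1)] int[OF add.hyps(2)]]
    by (simp only: fcoeff_def add_0_left)
next
  case (mult p q)
  have "continuous_on UNIV (\<lambda>x. p (cis (2 * pi * x)))"
    using mult.hyps(1) by (rule continuous_real_polynomial_cis)
  then have "continuous_on UNIV (\<lambda>x. f x * complex_of_real (p (cis (2 * pi * x))))"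
    using mult.prems by (intro continuous_intros)
  from mult.IH(2)[OF this mult.IH(1)[OF mult.prems], of k]
  show ?case by (simp add: mult.assoc)
qed

text \<open>
  A periodic function is a function on the unit circle, which is the quotient of \<open>[0,1]\<close> by
  \<open>x \<mapsto> cis (2 \<pi> x)\<close>; the Stone-Weierstrass theorem applies there.
\<close>

lemma approx_by_trig_polynomial:
  fixes f :: "real \<Rightarrow> real"
  assumes cont: "continuous_on UNIV f" and per: "periodic f" and "e > 0"
  obtains p where "real_polynomial_function p" "\<And>x. \<bar>f x - p (cis (2 * pi * x))\<bar> < e"
proof -
  let ?c = "\<lambda>x::real. cis (2 * pi * x)"
  define h where "h z = f (Arg2pi z / (2 * pi))" for z
  have hc: "h (?c x) = f x" for x
  proof -
    have "?c x = ?c (frac x)"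
      by (simp add: frac_def right_diff_distrib cis_divide[symmetric])
    also have "Arg2pi (?c (frac x)) = 2 * pi * frac x"
      using Arg2pi_unique[of 1 "2 * pi * frac x" "?c (frac x)"] frac_lt_1[of x]
      by (simp add: cis_conv_exp mult_ac)
    finally show ?thesis
      by (simp add: h_def periodic_frac[OF per])
  qed
  have surj: "?c ` {0..1} = sphere 0 1"
  proof (intro equalityI subsetI)
    fix z :: complex assume "z \<in> sphere 0 1"
    then have "exp (\<i> * of_real (Arg2pi z)) = z"
      by (simp add: complex_norm_eq_1_exp)
    then have "z = ?c (Arg2pi z / (2 * pi))"
      by (simp add: cis_conv_exp)
    then show "z \<in> ?c ` {0..1}"
      using Arg2pi[of z] by (intro image_eqI[of _ _ "Arg2pi z / (2 * pi)"]) auto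
  qed auto
  have "continuous_on (sphere 0 1) h"
    unfolding continuous_on_open_gen[of h "sphere 0 1" UNIV, simplified]
  proof (intro allI impI)
    fix U :: "real set" assume "open U"
    have "{0..1} \<inter> ?c -` (sphere 0 1 \<inter> h -` U) = {0..1} \<inter> f -` U"
      using surj by (auto simp: hc)
    moreover have "openin (top_of_set {0..1}) ({0..1} \<inter> f -` U)"
      using cont \<open>open U\<close> continuous_on_subset continuous_openin_preimage_gen by blast
    ultimately show "openin (top_of_set (sphere 0 1)) (sphere 0 1 \<inter> h -` U)"
      using Abstract_Topology_2.continuous_imp_quotient_map[OF _ surj, where U = "sphere 0 1 \<inter> h -` U"]
      by (simp add: continuous_intros)
  qed
  then obtain p where "real_polynomial_function p" and p: "\<And>z. z \<in> sphere 0 1 \<Longrightarrow> \<bar>h z - p z\<bar> < e"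
    using Stone_Weierstrass_real_polynomial_function[of "sphere 0 1" h e] \<open>e > 0\<close> by auto
  then show thesis
    using that[of p] p[of "?c _"] by (simp add: hc)
qed

text \<open>
  If all coefficients vanish, \<open>f\<close> is orthogonal to trigonometric polynomials, by approximation to all
  continuous periodic functions, and in particular to its own real and imaginary parts.
\<close>

theorem fcoeff_zero_imp_zero:
  assumes cont: "continuous_on UNIV f" and per: "periodic f" and zero: "\<And>k. fcoeff f k = 0"
  shows "f x = 0"
proof -
  have *: "(LINT x|torus. f x * complex_of_real (g x)) = 0"
    if g: "continuous_on UNIV g" "periodic g" for g
  proof -
    obtain B where B: "B > 0" "\<And>x. 0 \<le> x \<Longrightarrow> x \<le> 1 \<Longrightarrow> norm (f x) \<le> B"
      using continuous_bounded_unit[OF cont] by blast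
    have "norm (LINT x|torus. f x * complex_of_real (g x)) \<le> e" if "e > 0" for e
    proof -
      obtain p where p: "real_polynomial_function p" "\<And>x. \<bar>g x - p (cis (2 * pi * x))\<bar> < e / B"
        using approx_by_trig_polynomial[OF g, of "e / B"] \<open>e > 0\<close> B(1) by auto
      have pc: "continuous_on UNIV (\<lambda>x. p (cis (2 * pi * x)))"
        using p(1) by (rule continuous_real_polynomial_cis)
      have "(LINT x|torus. f x * complex_of_real (p (cis (2 * pi * x)))) = 0"
        using fcoeff_mult_trig_polynomial[OF p(1) cont zero, of 0] by (simp add: fcoeff_def)
      then have "(LINT x|torus. f x * complex_of_real (g x))
          = (LINT x|torus. f x * complex_of_real (g x) - f x * complex_of_real (p (cis (2 * pi * x))))"
        using cont g(1) pc
        by (subst Bochner_Integration.integral_diff)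
          (intro integrable_torus_continuous continuous_intros | assumption | simp)+
      also have "norm \<dots> \<le> (LINT x|torus. e)"
      proof (rule Bochner_Integration.integral_norm_bound_integral)
        show "integrable torus (\<lambda>x. f x * complex_of_real (g x) - f x * complex_of_real (p (cis (2 * pi * x))))"
          using cont g(1) pc by (intro integrable_torus_continuous continuous_intros)
        fix x assume x: "x \<in> space torus"
        have "norm (f x * complex_of_real (g x) - f x * complex_of_real (p (cis (2 * pi * x))))
            = norm (f x) * \<bar>g x - p (cis (2 * pi * x))\<bar>"
          by (simp add: right_diff_distrib[symmetric] norm_mult of_real_diff[symmetric]
              del: of_real_diff)
        also have "\<dots> \<le> B * (e / B)"
          using B x p(2)[of x] by (intro mult_mono) (auto simp: less_imp_le)
        finally show "norm (f x * complex_of_real (g x) - f x * complex_of_real (p (cis (2 * pi * x)))) \<le> e"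
          using B(1) by simp
      qed auto
      finally show ?thesis by simp
    qed
    then have "norm (LINT x|torus. f x * complex_of_real (g x)) \<le> 0"
      by (rule field_le_epsilon) simp
    then show ?thesis by simp
  qed
  have int: "integrable torus (\<lambda>x. f x * complex_of_real (g x))" if "continuous_on UNIV g" for g
    using cont that by (intro integrable_torus_continuous continuous_intros)
  have re: "continuous_on UNIV (\<lambda>x. Re (f x))" "periodic (\<lambda>x. Re (f x))"
    and im: "continuous_on UNIV (\<lambda>x. Im (f x))" "periodic (\<lambda>x. Im (f x))"
    using cont per by (auto intro!: continuous_intros simp: periodic_def)
  have "(LINT x|torus. Re (f x) * Re (f x)) = Re (LINT x|torus. f x * complex_of_real (Re (f x)))"
    using integral_Re[OF int[OF re(1)]] by simp
  then have "Re (f x) = 0"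
    using torus_integral_square_zero[OF re, of x] *[OF re] by simp
  moreover have "(LINT x|torus. Im (f x) * Im (f x)) = Im (LINT x|torus. f x * complex_of_real (Im (f x)))"
    using integral_Im[OF int[OF im(1)]] by simp
  then have "Im (f x) = 0"
    using torus_integral_square_zero[OF im, of x] *[OF im] by simp
  ultimately show ?thesis by (simp add: complex_eq_iff)
qed

section \<open>Absolutely convergent Fourier series\<close>

lemma torus_FTC_complex:
  fixes F f :: "real \<Rightarrow> complex"
  assumes F: "\<And>x. (F has_vector_derivative f x) (at x)" and f: "continuous_on UNIV f"
  shows "(LINT x|torus. f x) = F 1 - F 0"
proof -
  note int = integrable_torus_continuous[OF f]
  have "Re (LINT x|torus. f x) = Re (F 1) - Re (F 0)"
    unfolding integral_Re[OF int, symmetric]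
  proof (rule torus_FTC)
    show "((\<lambda>x. Re (F x)) has_real_derivative Re (f x)) (at x)" for x
      using has_field_derivative_Re[OF F] .
  qed (use f in \<open>intro continuous_intros\<close>)
  moreover have "Im (LINT x|torus. f x) = Im (F 1) - Im (F 0)"
    unfolding integral_Im[OF int, symmetric]
  proof (rule torus_FTC)
    show "((\<lambda>x. Im (F x)) has_real_derivative Im (f x)) (at x)" for x
      using has_field_derivative_Im[OF F] .
  qed (use f in \<open>intro continuous_intros\<close>)
  ultimately show ?thesis
    by (simp add: complex_eq_iff)
qed

lemma has_vector_derivative_cis_mult [derivative_intros]:
  "((\<lambda>x. cis (c * x)) has_vector_derivative \<i> * of_real c * cis (c * x)) (at x within S)"
proof -
  have "((\<lambda>x. exp (\<i> * (of_real c * complex_of_real x)))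
      has_vector_derivative exp (\<i> * (of_real c * complex_of_real x)) * (\<i> * of_real c)) (at x within S)"
    by (rule has_vector_derivative_real_field)
      (auto intro!: derivative_eq_intros)
  then show ?thesis
    by (simp add: cis_conv_exp mult_ac)
qed

lemma cis_two_pi_int [simp]: "cis (2 * pi * of_int k) = 1"
  using cis_multiple_2pi[of "of_int k"] by simp

lemma cis_minus_two_pi_int [simp]: "cis (- (2 * pi * of_int k)) = 1"
  using cis_two_pi_int[of "- k"] by simp

lemma periodic_cis: "periodic (\<lambda>x. cis (2 * pi * of_int k * x))"
  unfolding periodic_def by (simp add: distrib_left cis_mult[symmetric])

lemma integral_cis:
  "(LINT x|torus. cis (2 * pi * of_int k * x)) = (if k = 0 then 1 else 0)"
proof (cases "k = 0")
  case False
  define c where "c = 2 * pi * of_int k"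
  have c: "c \<noteq> 0" using False by (simp add: c_def)
  have "(LINT x|torus. \<i> * of_real c * cis (c * x)) = cis (c * 1) - cis (c * 0)"
    by (rule torus_FTC_complex) (auto intro!: has_vector_derivative_cis_mult continuous_intros)
  then have "\<i> * of_real c * (LINT x|torus. cis (c * x)) = 0"
    by (simp add: c_def)
  then show ?thesis
    using c False by (simp add: c_def)
qed simp

lemma norm_fcoeff_le:
  assumes "continuous_on UNIV f" "\<And>x. 0 \<le> x \<Longrightarrow> x < 1 \<Longrightarrow> norm (f x) \<le> B"
  shows "norm (fcoeff f k) \<le> B"
proof -
  have "norm (fcoeff f k) \<le> (LINT x|torus. B)"
    unfolding fcoeff_def
  proof (rule Bochner_Integration.integral_norm_bound_integral)
    show "integrable torus (\<lambda>x. f x * cis (- (2 * pi * of_int k * x)))"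
      using assms(1) by (intro integrable_torus_continuous continuous_intros)
  qed (use assms(2) in \<open>auto simp: norm_mult\<close>)
  then show ?thesis by simp
qed

lemma fcoeff_diff:
  assumes "continuous_on UNIV f" "continuous_on UNIV g"
  shows "fcoeff (\<lambda>x. f x - g x) k = fcoeff f k - fcoeff g k"
  unfolding fcoeff_def left_diff_distrib using assms
  by (intro Bochner_Integration.integral_diff integrable_torus_continuous continuous_intros)

text \<open>
  Series over the integers are enumerated along \<open>int_decode\<close>, which visits \<open>0, -1, 1, -2, 2, \<dots>\<close>. As
  the modulus grows linearly with the index, such series can be compared with \<open>\<Sum> 1/n\<^sup>2\<close>.
\<close>

lemma int_decode_growth: "real (n + 1) ^ 2 \<le> 8 * (1 + (real_of_int (int_decode n))\<^sup>2)"
proof -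
  have "int n + 1 \<le> 2 * \<bar>int_decode n\<bar> + 2"
    by (cases "even n") (auto simp: int_decode_def sum_decode_def elim!: evenE oddE)
  then have "real_of_int (int n + 1) \<le> real_of_int (2 * \<bar>int_decode n\<bar> + 2)"
    by (rule of_int_le_iff[THEN iffD2])
  then have "real (n + 1) \<le> 2 * (\<bar>real_of_int (int_decode n)\<bar> + 1)"
    by simp
  then have "real (n + 1) ^ 2 \<le> (2 * (\<bar>real_of_int (int_decode n)\<bar> + 1))\<^sup>2"
    by (intro power_mono) auto
  also have "\<dots> \<le> 8 * (1 + (real_of_int (int_decode n))\<^sup>2)"
    using sum_squares_bound[of "\<bar>real_of_int (int_decode n)\<bar>" 1]
    by (simp add: power2_eq_square algebra_simps)
  finally show ?thesis .
qed

lemma summable_int_decode_inverse_square: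
  "summable (\<lambda>n. 1 / (1 + (real_of_int (int_decode n))\<^sup>2))"
proof (rule summable_comparison_test')
  have "summable (\<lambda>n. inverse (real n ^ 2))"
    using inverse_power_summable[of 2, where 'a = real] by simp
  then have "summable (\<lambda>n. inverse (real (n + 1) ^ 2))"
    by (rule summable_ignore_initial_segment)
  then show "summable (\<lambda>n. 8 * inverse (real (n + 1) ^ 2))"
    by (rule summable_mult)
  fix n :: nat
  have "0 < 1 + (real_of_int (int_decode n))\<^sup>2"
    by (simp add: add_pos_nonneg)
  then show "norm (1 / (1 + (real_of_int (int_decode n))\<^sup>2)) \<le> 8 * inverse (real (n + 1) ^ 2)"
    using int_decode_growth[of n] by (simp add: field_simps)
qed

lemma summable_on_int_iff:
  fixes f :: "int \<Rightarrow> real"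
  assumes "\<And>k. f k \<ge> 0"
  shows "f summable_on UNIV \<longleftrightarrow> summable (\<lambda>n. f (int_decode n))"
  using summable_on_reindex_bij_betw[OF bij_int_decode, of f]
    summable_on_UNIV_nonneg_real_iff[of "\<lambda>n. f (int_decode n)"] assms by simp

lemma summable_mult_cis:
  assumes "summable (\<lambda>n. norm (c n))"
  shows "summable (\<lambda>n. c n * cis (t n))"
  by (rule summable_norm_cancel) (use assms in \<open>simp add: norm_mult\<close>)

lemma
  fixes c :: "nat \<Rightarrow> complex" and d :: "nat \<Rightarrow> int"
  assumes c: "summable (\<lambda>n. norm (c n))"
  shows continuous_trig_series: "continuous_on UNIV (\<lambda>x. \<Sum>n. c n * cis (2 * pi * d n * x))"
    and integral_trig_series: "continuous_on UNIV g \<Longrightarrow>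
      (\<lambda>n. c n * (LINT x|torus. cis (2 * pi * d n * x) * g x))
        sums (LINT x|torus. (\<Sum>n. c n * cis (2 * pi * d n * x)) * g x)"
proof -
  have "uniform_limit UNIV (\<lambda>N x. \<Sum>n<N. c n * cis (2 * pi * d n * x))
      (\<lambda>x. \<Sum>n. c n * cis (2 * pi * d n * x)) sequentially"
    by (rule Weierstrass_m_test[OF _ c]) (simp add: norm_mult)
  then show "continuous_on UNIV (\<lambda>x. \<Sum>n. c n * cis (2 * pi * d n * x))"
    by (rule uniform_limit_theorem[rotated]) (auto intro!: always_eventually continuous_intros)
  assume g: "continuous_on UNIV g"
  have cont: "continuous_on UNIV (\<lambda>x. c n * cis (2 * pi * d n * x) * g x)" for n
    using g by (intro continuous_intros)
  have "(\<lambda>n. LINT x|torus. c n * cis (2 * pi * d n * x) * g x)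
        sums (LINT x|torus. (\<Sum>n. c n * cis (2 * pi * d n * x) * g x))"
  proof (rule sums_integral)
    show "integrable torus (\<lambda>x. c n * cis (2 * pi * d n * x) * g x)" for n
      using cont by (rule integrable_torus_continuous)
    show "AE x in torus. summable (\<lambda>n. norm (c n * cis (2 * pi * d n * x) * g x))"
      using c by (intro always_eventually allI) (simp add: norm_mult summable_mult2)
    show "summable (\<lambda>n. LINT x|torus. norm (c n * cis (2 * pi * d n * x) * g x))"
      using c by (simp add: norm_mult mult.assoc summable_mult2)
  qed
  moreover have "(\<Sum>n. c n * cis (2 * pi * d n * x) * g x) = (\<Sum>n. c n * cis (2 * pi * d n * x)) * g x" for x
    using summable_mult_cis[OF c] by (rule suminf_mult2[symmetric])
  ultimately show "(\<lambda>n. c n * (LINT x|torus. cis (2 * pi * d n * x) * g x))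
        sums (LINT x|torus. (\<Sum>n. c n * cis (2 * pi * d n * x)) * g x)"
    by (simp add: mult.assoc)
qed

text \<open>
  The series converges uniformly to a continuous function with the same coefficients as \<open>f\<close>, which
  must be \<open>f\<close> by uniqueness.
\<close>

theorem fourier_series_eq:
  assumes cont: "continuous_on UNIV f" and per: "periodic f"
    and summ: "summable (\<lambda>n. norm (fcoeff f (int_decode n)))"
  shows "f x = (\<Sum>n. fcoeff f (int_decode n) * cis (2 * pi * int_decode n * x))"
proof -
  define S where "S x = (\<Sum>n. fcoeff f (int_decode n) * cis (2 * pi * int_decode n * x))" for x
  have S: "continuous_on UNIV S"
    unfolding S_def using continuous_trig_series[OF summ] .
  have perS: "periodic S"
    using periodic_cis unfolding S_def periodic_def by simp
  have "fcoeff S k = fcoeff f k" for k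
  proof -
    have "cis (2 * pi * of_int j * x) * cis (- (2 * pi * of_int k * x)) = cis (2 * pi * of_int (j - k) * x)" for j x
      by (simp add: cis_mult algebra_simps)
    then have "(LINT x|torus. cis (2 * pi * of_int j * x) * cis (- (2 * pi * of_int k * x)))
      = (if j = k then 1 else 0)" for j
      using integral_cis[of "j - k"] by simp
    moreover have "continuous_on UNIV (\<lambda>x. cis (- (2 * pi * of_int k * x)))"
      by (intro continuous_intros)
    ultimately have "(\<lambda>n. fcoeff f (int_decode n) * (if int_decode n = k then 1 else 0)) sums fcoeff S k"
      using integral_trig_series[OF summ, of "\<lambda>x. cis (- (2 * pi * of_int k * x))" int_decode]
      by (simp add: fcoeff_def S_def)
    moreover have "fcoeff f (int_decode n) * (if int_decode n = k then 1 else 0)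
        = (if n = int_encode k then fcoeff f (int_decode n) else 0)" for n
      by auto
    ultimately have "(\<lambda>n. if n = int_encode k then fcoeff f (int_decode n) else 0) sums fcoeff S k"
      by simp
    moreover have "(\<lambda>n. if n = int_encode k then fcoeff f (int_decode n) else 0) sums fcoeff f k"
      using sums_single[of "int_encode k" "\<lambda>n. fcoeff f (int_decode n)"] by simp
    ultimately show ?thesis
      by (rule sums_unique2)
  qed
  then have "fcoeff (\<lambda>x. f x - S x) k = 0" for k
    by (simp add: fcoeff_diff cont S)
  moreover have "continuous_on UNIV (\<lambda>x. f x - S x)"
    using cont S by (intro continuous_intros)
  moreover have "periodic (\<lambda>x. f x - S x)"
    using per perS by (simp add: periodic_def)
  ultimately have "f x - S x = 0"
    using fcoeff_zero_imp_zero by blast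
  then show ?thesis by (simp add: S_def)
qed

lemma vector_derivative_imp_continuous_on:
  assumes "\<And>x. (g has_vector_derivative g' x) (at x)"
  shows "continuous_on UNIV g"
  using assms by (intro continuous_at_imp_continuous_on) (auto intro: has_vector_derivative_continuous)

text \<open>
  With \<open>e x = cis (- a x)\<close> for \<open>a = 2 \<pi> k\<close>, the periodic function \<open>g' e + i a g e\<close> has derivative
  \<open>g'' e + a\<^sup>2 g e\<close>, whose integral is therefore zero.
\<close>

lemma fcoeff_second_derivative:
  assumes g: "\<And>x. (g has_vector_derivative g' x) (at x)" "\<And>x. (g' has_vector_derivative g'' x) (at x)"
    and cont: "continuous_on UNIV g''" and per: "periodic g" "periodic g'"
  shows "fcoeff g'' k = - (complex_of_real (2 * pi * of_int k))\<^sup>2 * fcoeff g k"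
proof -
  define a where "a = 2 * pi * of_int k"
  define e where "e x = cis (- (a * x))" for x
  have cg: "continuous_on UNIV g"
    using g(1) by (rule vector_derivative_imp_continuous_on)
  have ce: "continuous_on UNIV e"
    unfolding e_def by (intro continuous_intros)
  have de: "(e has_vector_derivative - (\<i> * of_real a * e x)) (at x)" for x
    unfolding e_def using has_vector_derivative_cis_mult[of "- a" x UNIV] by simp
  have "((\<lambda>x. g' x * e x + \<i> * of_real a * (g x * e x)) has_vector_derivative
      g'' x * e x + of_real a ^ 2 * (g x * e x)) (at x)" for x
  proof -
    have "((\<lambda>x. g' x * e x) has_vector_derivative g' x * - (\<i> * of_real a * e x) + g'' x * e x) (at x)"
      by (rule has_vector_derivative_mult[OF g(2) de])
    moreover have "((\<lambda>x. \<i> * of_real a * (g x * e x)) has_vector_derivative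
        \<i> * of_real a * (g x * - (\<i> * of_real a * e x) + g' x * e x)) (at x)"
      by (rule has_vector_derivative_mult_right[OF has_vector_derivative_mult[OF g(1) de]])
    ultimately have "((\<lambda>x. g' x * e x + \<i> * of_real a * (g x * e x)) has_vector_derivative
      g' x * - (\<i> * of_real a * e x) + g'' x * e x + \<i> * of_real a * (g x * - (\<i> * of_real a * e x) + g' x * e x)) (at x)"
      by (rule has_vector_derivative_add)
    moreover have "g' x * - (\<i> * of_real a * e x) + g'' x * e x + \<i> * of_real a * (g x * - (\<i> * of_real a * e x) + g' x * e x)
       = g'' x * e x + of_real a ^ 2 * (g x * e x)"
      by (simp add: algebra_simps power2_eq_square)
    ultimately show ?thesis by (simp only:)
  qed
  then have "(LINT x|torus. g'' x * e x + of_real a ^ 2 * (g x * e x))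
      = (g' 1 * e 1 + \<i> * of_real a * (g 1 * e 1)) - (g' 0 * e 0 + \<i> * of_real a * (g 0 * e 0))"
    using cont cg ce by (intro torus_FTC_complex continuous_intros)
  also have "\<dots> = 0"
    using per[unfolded periodic_def, THEN spec, of 0] by (simp add: e_def a_def)
  finally have "(LINT x|torus. g'' x * e x) + (LINT x|torus. of_real a ^ 2 * (g x * e x)) = 0"
    using cont cg ce
    by (subst (asm) Bochner_Integration.integral_add) (auto intro!: integrable_torus_continuous continuous_intros)
  then show ?thesis
    unfolding fcoeff_def by (simp add: e_def a_def eq_neg_iff_add_eq_0)
qed

lemma summable_fcoeff_C2:
  assumes g: "\<And>x. (g has_vector_derivative g' x) (at x)" "\<And>x. (g' has_vector_derivative g'' x) (at x)"
    and cont: "continuous_on UNIV g''" and per: "periodic g" "periodic g'"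
  shows "summable (\<lambda>n. norm (fcoeff g (int_decode n)))"
proof -
  have cg: "continuous_on UNIV g"
    using g(1) by (rule vector_derivative_imp_continuous_on)
  obtain B where B: "B > 0" "\<And>x. 0 \<le> x \<Longrightarrow> x \<le> 1 \<Longrightarrow> norm (g x) \<le> B"
    using continuous_bounded_unit[OF cg] by blast
  obtain C where C: "C > 0" "\<And>x. 0 \<le> x \<Longrightarrow> x \<le> 1 \<Longrightarrow> norm (g'' x) \<le> C"
    using continuous_bounded_unit[OF cont] by blast
  have bound: "norm (fcoeff g k) \<le> (B + C) * (1 / (1 + (real_of_int k)\<^sup>2))" for k
  proof -
    have "(2 * pi)\<^sup>2 * (of_int k)\<^sup>2 * norm (fcoeff g k) = norm (fcoeff g'' k)"
      unfolding fcoeff_second_derivative[OF g cont per]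
      by (simp add: norm_mult norm_power power_mult_distrib)
    also have "\<dots> \<le> C"
      using C by (intro norm_fcoeff_le[OF cont]) auto
    finally have 1: "(2 * pi)\<^sup>2 * ((of_int k)\<^sup>2 * norm (fcoeff g k)) \<le> C"
      by (simp add: mult.assoc)
    have "1 \<le> 2 * pi"
      using pi_ge_two by linarith
    then have "1 \<le> (2 * pi)\<^sup>2"
      by (rule one_le_power)
    then have "1 * ((of_int k)\<^sup>2 * norm (fcoeff g k)) \<le> (2 * pi)\<^sup>2 * ((of_int k)\<^sup>2 * norm (fcoeff g k))"
      by (intro mult_right_mono) auto
    with 1 have "(of_int k)\<^sup>2 * norm (fcoeff g k) \<le> C"
      by simp
    moreover have "norm (fcoeff g k) \<le> B"
      using B by (intro norm_fcoeff_le[OF cg]) auto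
    ultimately have "(1 + (real_of_int k)\<^sup>2) * norm (fcoeff g k) \<le> B + C"
      by (simp add: distrib_right)
    moreover have "0 < 1 + (real_of_int k)\<^sup>2"
      by (simp add: add_pos_nonneg)
    ultimately show ?thesis
      by (simp add: field_simps)
  qed
  show ?thesis
    by (rule summable_comparison_test'[OF summable_mult[OF summable_int_decode_inverse_square, of "B + C"], of 0])
      (simp only: real_norm_def abs_norm_cancel, rule bound)
qed

text \<open>
  The Fourier series of \<open>g\<close> converges absolutely and can be integrated term by term against \<open>f\<close>.
\<close>

theorem parseval_C2:
  assumes f: "continuous_on UNIV f"
    and g: "\<And>x. (g has_vector_derivative g' x) (at x)" "\<And>x. (g' has_vector_derivative g'' x) (at x)"
    and cont: "continuous_on UNIV g''" and per: "periodic g" "periodic g'"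
  shows "(\<lambda>k. norm (fcoeff f k * cnj (fcoeff g k))) summable_on UNIV"
    and "((\<lambda>k. fcoeff f k * cnj (fcoeff g k)) has_sum (LINT x|torus. f x * cnj (g x))) UNIV"
proof -
  note summ = summable_fcoeff_C2[OF g cont per]
  have cg: "continuous_on UNIV g"
    using g(1) by (rule vector_derivative_imp_continuous_on)
  obtain B where B: "B > 0" "\<And>x. 0 \<le> x \<Longrightarrow> x \<le> 1 \<Longrightarrow> norm (f x) \<le> B"
    using continuous_bounded_unit[OF f] by blast
  have fB: "norm (fcoeff f k) \<le> B" for k
    using B by (intro norm_fcoeff_le[OF f]) auto
  have abs: "summable (\<lambda>n. norm (fcoeff f (int_decode n) * cnj (fcoeff g (int_decode n))))"
  proof (rule summable_comparison_test'[OF summable_mult[OF summ, of B], of 0])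
    show "norm (norm (fcoeff f (int_decode n) * cnj (fcoeff g (int_decode n)))) \<le> B * norm (fcoeff g (int_decode n))" for n
      using mult_right_mono[OF fB, of "norm (fcoeff g (int_decode n))"] by (simp add: norm_mult)
  qed
  then show "(\<lambda>k. norm (fcoeff f k * cnj (fcoeff g k))) summable_on UNIV"
    by (subst summable_on_int_iff) auto
  have gs: "cnj (g x) = (\<Sum>n. cnj (fcoeff g (int_decode n)) * cis (2 * pi * of_int (- int_decode n) * x))" for x
  proof -
    have "summable (\<lambda>n. fcoeff g (int_decode n) * cis (2 * pi * int_decode n * x))"
      using summ by (rule summable_mult_cis)
    then have "(\<lambda>n. cnj (fcoeff g (int_decode n) * cis (2 * pi * int_decode n * x))) sums cnj (g x)"
      unfolding fourier_series_eq[OF cg per(1) summ, of x] sums_cnj by (rule summable_sums)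
    then have "(\<lambda>n. cnj (fcoeff g (int_decode n)) * cis (2 * pi * of_int (- int_decode n) * x)) sums cnj (g x)"
      by (simp add: cis_cnj)
    then show ?thesis
      by (rule sums_unique)
  qed
  have "(\<lambda>n. cnj (fcoeff g (int_decode n)) * (LINT x|torus. cis (2 * pi * of_int (- int_decode n) * x) * f x))
      sums (LINT x|torus. cnj (g x) * f x)"
    unfolding gs using summ by (intro integral_trig_series f) simp
  then have "(\<lambda>n. fcoeff f (int_decode n) * cnj (fcoeff g (int_decode n))) sums (LINT x|torus. f x * cnj (g x))"
    by (simp add: fcoeff_def mult.commute)
  from norm_summable_imp_has_sum[OF abs this]
  show "((\<lambda>k. fcoeff f k * cnj (fcoeff g k)) has_sum (LINT x|torus. f x * cnj (g x))) UNIV"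
    using has_sum_reindex_bij_betw[OF bij_int_decode, of "\<lambda>k. fcoeff f k * cnj (fcoeff g k)"] by simp
qed

section \<open>Sobolev regularity\<close>

lemma norm_Re_mult_cis_le: "norm (Re (z * cis t)) \<le> norm z"
proof -
  have "norm (Re (z * cis t)) \<le> norm (z * cis t)"
    unfolding real_norm_def by (rule abs_Re_le_cmod)
  then show ?thesis
    by (simp only: norm_mult norm_cis mult_1_right)
qed

lemma trig_series_has_derivative:
  fixes c :: "nat \<Rightarrow> complex" and d :: "nat \<Rightarrow> int"
  assumes c: "summable (\<lambda>n. norm (c n))" and c': "summable (\<lambda>n. norm (\<i> * of_real (2 * pi * d n) * c n))"
  shows "((\<lambda>x. \<Sum>n. Re (c n * cis (2 * pi * d n * x))) has_real_derivative
           (\<Sum>n. Re ((\<i> * of_real (2 * pi * d n) * c n) * cis (2 * pi * d n * x)))) (at x)"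
proof (rule has_field_derivative_series'(2)[where S = UNIV and ?x0.0 = 0
      and f = "\<lambda>n x. Re (c n * cis (2 * pi * d n * x))"
      and f' = "\<lambda>n x. Re ((\<i> * of_real (2 * pi * d n) * c n) * cis (2 * pi * d n * x))"])
  show "((\<lambda>x. Re (c n * cis (2 * pi * d n * x))) has_real_derivative
      Re ((\<i> * of_real (2 * pi * d n) * c n) * cis (2 * pi * d n * x))) (at x within UNIV)" for n x
  proof (rule has_field_derivative_Re)
    show "((\<lambda>x. c n * cis (2 * pi * d n * x)) has_vector_derivative
        (\<i> * of_real (2 * pi * d n) * c n) * cis (2 * pi * d n * x)) (at x within UNIV)"
      using has_vector_derivative_mult_right[OF has_vector_derivative_cis_mult[of "2 * pi * d n" x UNIV], of "c n"]
      by (simp only: mult.assoc mult.left_commute[of "c n"])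
  qed
  show "uniformly_convergent_on UNIV (\<lambda>n x. \<Sum>i<n. Re (\<i> * of_real (2 * pi * d i) * c i * cis (2 * pi * d i * x)))"
    by (rule Weierstrass_m_test'[where M = "\<lambda>n. norm (\<i> * of_real (2 * pi * d n) * c n)"])
      (rule norm_Re_mult_cis_le, rule c')
  show "summable (\<lambda>n. Re (c n * cis (2 * pi * d n * 0)))"
    by (rule summable_comparison_test'[OF c, of 0]) (rule norm_Re_mult_cis_le)
qed auto

text \<open>
  With \<open>A = 1 + k\<^sup>2\<close> the arithmetic-geometric inequality gives \<open>2 A\<^sup>2 \<bar>c\<bar> \<le> A\<^sup>5 \<bar>c\<bar>\<^sup>2 + 1/A\<close>. So the fifth Sobolev
  norm makes \<open>\<Sum> \<bar>k\<bar>\<^sup>4 \<bar>c\<^sub>k\<bar>\<close> finite, and the Fourier series may be differentiated four times.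
\<close>

lemma sobolev_imp_C4:
  assumes "sobolev s f" "s \<ge> 5"
  obtains f1 f2 f3 f4 where "\<And>x. (f has_real_derivative f1 x) (at x)"
    "\<And>x. (f1 has_real_derivative f2 x) (at x)" "\<And>x. (f2 has_real_derivative f3 x) (at x)"
    "\<And>x. (f3 has_real_derivative f4 x) (at x)" "continuous_on UNIV f4"
proof -
  define c where "c n = fcoeff (\<lambda>x. complex_of_real (f x)) (int_decode n)" for n
  define A where "A n = 1 + (real_of_int (int_decode n))\<^sup>2" for n
  have per: "periodic f" and cont: "continuous_on UNIV f"
    and "(\<lambda>k::int. (1 + (of_int k)\<^sup>2) powr s * (cmod (fourier_coeff f k))\<^sup>2) summable_on UNIV"
    using assms(1) by (auto simp: sobolev_def)
  then have summ: "summable (\<lambda>n. A n powr s * (cmod (c n))\<^sup>2)"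
    by (subst (asm) summable_on_int_iff) (auto simp: A_def c_def fourier_coeff_eq_fcoeff)
  have A: "1 \<le> A n" for n by (simp add: A_def)
  have A2: "summable (\<lambda>n. A n ^ 2 * cmod (c n))"
  proof (rule summable_comparison_test'[of _ 0])
    show "summable (\<lambda>n. A n powr s * (cmod (c n))\<^sup>2 + 1 / A n)"
      using summ summable_int_decode_inverse_square by (intro summable_add) (simp_all add: A_def)
    fix n
    have "A n ^ 5 \<le> A n powr s"
      using powr_mono[of 5 s "A n"] assms(2) A[of n] by (simp add: powr_numeral)
    then have 1: "A n ^ 5 * (cmod (c n))\<^sup>2 \<le> A n powr s * (cmod (c n))\<^sup>2"
      by (intro mult_right_mono) auto
    have "0 \<le> (A n ^ 3 * cmod (c n) - 1)\<^sup>2 / A n"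
      using A[of n] by simp
    also have "\<dots> = A n ^ 5 * (cmod (c n))\<^sup>2 - 2 * (A n ^ 2 * cmod (c n)) + 1 / A n"
      using A[of n] by (simp add: field_simps power2_eq_square eval_nat_numeral)
    finally have "2 * (A n ^ 2 * cmod (c n)) \<le> A n powr s * (cmod (c n))\<^sup>2 + 1 / A n"
      using 1 by simp
    moreover have "0 \<le> A n ^ 2 * cmod (c n)" by simp
    ultimately have "A n ^ 2 * cmod (c n) \<le> A n powr s * (cmod (c n))\<^sup>2 + 1 / A n"
      by linarith
    then show "norm (A n ^ 2 * cmod (c n)) \<le> A n powr s * (cmod (c n))\<^sup>2 + 1 / A n"
      by simp
  qed
  define C where "C j n = (\<i> * of_real (2 * pi * int_decode n)) ^ j * c n" for j n
  have C: "summable (\<lambda>n. norm (C j n))" if "j \<le> 4" for j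
  proof (rule summable_comparison_test'[of _ 0])
    show "summable (\<lambda>n. (2 * pi) ^ j * (A n ^ 2 * cmod (c n)))"
      using A2 by (rule summable_mult)
    fix n
    define x where "x = \<bar>real_of_int (int_decode n)\<bar>"
    have "x ^ j \<le> A n ^ 2"
    proof (cases "x \<le> 1")
      case True
      then have "x ^ j \<le> 1" by (simp add: x_def power_le_one)
      also have "1 \<le> A n ^ 2" using A by simp
      finally show ?thesis .
    next
      case False
      then have "x ^ j \<le> x ^ 4" using that by (intro power_increasing) auto
      also have "x ^ 4 = (x ^ 2) ^ 2" by simp
      also have "\<dots> \<le> A n ^ 2" by (intro power_mono) (auto simp: A_def x_def)
      finally show ?thesis .
    qed
    then have "(2 * pi) ^ j * (x ^ j * cmod (c n)) \<le> (2 * pi) ^ j * (A n ^ 2 * cmod (c n))"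
      by (intro mult_left_mono mult_right_mono) auto
    then show "norm (norm (C j n)) \<le> (2 * pi) ^ j * (A n ^ 2 * cmod (c n))"
      by (simp add: C_def x_def norm_mult norm_power power_mult_distrib mult_ac)
  qed
  define G where "G j x = (\<Sum>n. Re (C j n * cis (2 * pi * int_decode n * x)))" for j x
  have deriv: "(G j has_real_derivative G (Suc j) x) (at x)" if "j < 4" for j x
  proof -
    have CS: "C (Suc j) n = \<i> * of_real (2 * pi * int_decode n) * C j n" for n
      by (simp add: C_def)
    show ?thesis
      unfolding G_def CS
      using C[of j] C[of "Suc j"] that by (intro trig_series_has_derivative) (simp_all only: CS)
  qed
  have sre: "G j x = Re (\<Sum>n. C j n * cis (2 * pi * int_decode n * x))" if "j \<le> 4" for j x
    unfolding G_def using C[OF that]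
    by (intro Re_suminf[symmetric] summable_mult_cis)
  have "f x = G 0 x" for x
  proof -
    have "complex_of_real (f x) = (\<Sum>n. C 0 n * cis (2 * pi * int_decode n * x))"
      using fourier_series_eq[of "\<lambda>x. complex_of_real (f x)" x] C[of 0] per cont
      by (simp add: c_def C_def periodic_def continuous_on_of_real)
    then show ?thesis
      by (metis Re_complex_of_real sre zero_le)
  qed
  then have "f = G 0" by auto
  moreover have "continuous_on UNIV (G 4)"
  proof -
    have "continuous_on UNIV (\<lambda>x. Re (\<Sum>n. C 4 n * cis (2 * pi * int_decode n * x)))"
      using C[of 4] by (intro continuous_intros continuous_trig_series) simp
    then show ?thesis by (simp add: sre)
  qed
  ultimately show thesis
    using that[of "G 1" "G 2" "G 3" "G 4"] deriv[of 0] deriv[of 1] deriv[of 2] deriv[of 3]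
    by (simp add: eval_nat_numeral)
qed

section \<open>The Green function\<close>

lemma periodic_green: "periodic green"
  by (simp add: periodic_def green_def frac_1_eq)

lemma green_shift_int: "green (x + of_int n) = green x"
  by (simp add: green_def frac_def)

lemma green_unit: "0 \<le> x \<Longrightarrow> x \<le> 1 \<Longrightarrow> green x = (x\<^sup>2 - x) / 2"
  using green_eq[of x] by simp

lemma green_minus: "green (- x) = green x"
proof -
  have x: "green x = green (frac x)"
    using green_shift_int[of "frac x" "\<lfloor>x\<rfloor>"] by (simp add: frac_def)
  have "- x = - frac x + of_int (- \<lfloor>x\<rfloor>)"
    by (simp add: frac_def)
  then have "green (- x) = green (- frac x)"
    by (metis green_shift_int)
  also have "\<dots> = green (frac x)"
    using frac_lt_1[of x] by (simp add: green_eq)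
  finally show ?thesis using x by simp
qed

lemma green_commute: "green (x - y) = green (y - x)"
  using green_minus[of "x - y"] by simp

lemma green_bounds: "-1/8 \<le> green x" "green x \<le> 0"
proof -
  have "0 \<le> (frac x - 1/2)\<^sup>2" by simp
  then show "-1/8 \<le> green x"
    by (simp add: green_def power2_eq_square algebra_simps)
  show "green x \<le> 0"
    using frac_lt_1[of x] frac_ge_0[of x] mult_left_le[of "frac x" "frac x"]
    by (simp add: green_def power2_eq_square)
qed

lemma continuous_green: "continuous_on S green"
proof -
  have "isCont green x" for x
  proof -
    define n where "n = \<lfloor>x\<rfloor>"
    have "isCont (\<lambda>y. ((y - of_int n)\<^sup>2 - \<bar>y - of_int n\<bar>) / 2) x"
      by (intro continuous_intros) auto
    moreover have ev: "eventually (\<lambda>y. ((y - of_int n)\<^sup>2 - \<bar>y - of_int n\<bar>) / 2 = green y) (nhds x)"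
    proof (rule eventually_nhds_in_open[of "{of_int n - 1<..<of_int n + 1}", THEN eventually_mono])
      show "x \<in> {of_int n - 1<..<of_int n + 1}"
        using floor_correct[of x] by (simp add: n_def) linarith
      fix y assume "y \<in> {of_int n - 1<..<real_of_int n + 1}"
      then have "green (y - of_int n) = ((y - of_int n)\<^sup>2 - \<bar>y - of_int n\<bar>) / 2"
        by (intro green_eq) auto
      then show "((y - of_int n)\<^sup>2 - \<bar>y - of_int n\<bar>) / 2 = green y"
        using green_shift_int[of "y - of_int n" n] by simp
    qed simp
    ultimately show ?thesis
      using isCont_cong[OF ev] by blast
  qed
  then show ?thesis
    by (simp add: continuous_at_imp_continuous_on)
qed

lemma continuous_green_diff [continuous_intros]:
  assumes "continuous_on S f"
  shows "continuous_on S (\<lambda>x. green (f x))"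
  using continuous_on_compose2[OF continuous_green assms, of UNIV] by simp

lemma DERIV_imp_continuous_on:
  fixes f :: "real \<Rightarrow> real"
  assumes "\<And>x. (f has_real_derivative f' x) (at x)"
  shows "continuous_on S f"
  using assms by (meson DERIV_isCont continuous_at_imp_continuous_on)

text \<open>
  This is the equation \<open>green'' = 1 - \<delta>\<^sub>0\<close> in weak form. After a translation by \<open>y\<close> the Green function is
  the polynomial \<open>(t\<^sup>2 - t)/2\<close> on the period \<open>[0,1]\<close>; integrating by parts twice, the boundary terms come
  from the jump of its derivative at the ends.
\<close>

lemma green_second_derivative:
  assumes \<phi>: "\<And>x. (\<phi> has_real_derivative \<phi>1 x) (at x)" "\<And>x. (\<phi>1 has_real_derivative \<phi>2 x) (at x)"
    and cont: "continuous_on UNIV \<phi>2" and per: "periodic \<phi>"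
  shows "(LINT x|torus. green (x - y) * \<phi>2 x) = (LINT x|torus. \<phi> x) - \<phi> y"
proof -
  have per1: "periodic \<phi>1" and per2: "periodic \<phi>2"
    using periodic_deriv \<phi> per by blast+
  have c: "continuous_on UNIV \<phi>" "continuous_on UNIV \<phi>1"
    using \<phi> DERIV_imp_continuous_on by blast+
  have cs: "continuous_on UNIV (\<lambda>t. \<phi>2 (t + y))" "continuous_on UNIV (\<lambda>t. \<phi> (t + y))"
    by (intro continuous_on_compose2[OF cont] continuous_on_compose2[OF c(1)] continuous_intros; simp)+
  have "(LINT x|torus. green (x - y) * \<phi>2 x) = (LINT x|torus. green ((x + y) - y) * \<phi>2 (x + y))"
  proof (rule torus_shift[symmetric])
    show "continuous_on UNIV (\<lambda>x. green (x - y) * \<phi>2 x)"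
      using cont by (intro continuous_intros)
    have "green (x + 1 - y) = green (x - y)" for x
      using green_shift_int[of "x - y" 1] by (simp add: algebra_simps)
    then show "periodic (\<lambda>x. green (x - y) * \<phi>2 x)"
      using per2 by (simp add: periodic_def)
  qed
  also have "\<dots> = (LINT t|torus. (t\<^sup>2 - t) / 2 * \<phi>2 (t + y))"
    by (rule Bochner_Integration.integral_cong) (auto simp: green_unit)
  also have "\<dots> = (LINT t|torus. ((t\<^sup>2 - t) / 2 * \<phi>2 (t + y) - \<phi> (t + y)) + \<phi> (t + y))"
    by simp
  also have "\<dots> = (LINT t|torus. (t\<^sup>2 - t) / 2 * \<phi>2 (t + y) - \<phi> (t + y)) + (LINT t|torus. \<phi> (t + y))"
    using cs by (intro Bochner_Integration.integral_add integrable_torus_continuous continuous_intros) auto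
  also have "(LINT t|torus. (t\<^sup>2 - t) / 2 * \<phi>2 (t + y) - \<phi> (t + y))
     = ((1\<^sup>2 - 1) / 2 * \<phi>1 (1 + y) - (1 - 1/2) * \<phi> (1 + y))
     - ((0\<^sup>2 - 0) / 2 * \<phi>1 (0 + y) - (0 - 1/2) * \<phi> (0 + y))"
  proof (rule torus_FTC)
    fix t
    have 1: "((\<lambda>t. \<phi>1 (t + y)) has_real_derivative \<phi>2 (t + y)) (at t)"
      and 2: "((\<lambda>t. \<phi> (t + y)) has_real_derivative \<phi>1 (t + y)) (at t)"
      using \<phi>(1)[of "t + y"] \<phi>(2)[of "t + y"] by (simp_all add: DERIV_shift)
    show "((\<lambda>t. (t\<^sup>2 - t) / 2 * \<phi>1 (t + y) - (t - 1/2) * \<phi> (t + y)) has_real_derivative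
        (t\<^sup>2 - t) / 2 * \<phi>2 (t + y) - \<phi> (t + y)) (at t)"
      by (rule derivative_eq_intros 1 2 refl | simp)+
  next
    show "continuous_on UNIV (\<lambda>t. (t\<^sup>2 - t) / 2 * \<phi>2 (t + y) - \<phi> (t + y))"
      using cs by (intro continuous_intros) auto
  qed
  also have "\<dots> = - \<phi> y"
    using per[unfolded periodic_def, rule_format, of y] by (simp add: add.commute)
  also have "(LINT t|torus. \<phi> (t + y)) = (LINT t|torus. \<phi> t)"
    by (rule torus_shift[OF c(1) per])
  finally show ?thesis by simp
qed

lemma integral_by_parts_second:
  assumes \<phi>: "\<And>x. (\<phi> has_real_derivative \<phi>1 x) (at x)" "\<And>x. (\<phi>1 has_real_derivative \<phi>2 x) (at x)"
    and \<phi>c: "continuous_on UNIV \<phi>2" and \<phi>p: "periodic \<phi>"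
    and u: "\<And>x. (u has_real_derivative u1 x) (at x)" "\<And>x. (u1 has_real_derivative u2 x) (at x)"
    and uc: "continuous_on UNIV u2" and up: "periodic u"
  shows "(LINT x|torus. u x * \<phi>2 x) = (LINT x|torus. u2 x * \<phi> x)"
proof -
  have per: "periodic \<phi>1" "periodic u1"
    using periodic_deriv \<phi> u \<phi>p up by blast+
  have c: "continuous_on UNIV \<phi>" "continuous_on UNIV u"
    using \<phi> u DERIV_imp_continuous_on by blast+
  have "(LINT x|torus. u x * \<phi>2 x - u2 x * \<phi> x) = 0"
  proof (rule torus_integral_deriv_periodic)
    fix x
    have "((\<lambda>x. u x * \<phi>1 x - u1 x * \<phi> x) has_real_derivative
        (u x * \<phi>2 x + u1 x * \<phi>1 x) - (u1 x * \<phi>1 x + u2 x * \<phi> x)) (at x)"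
      using DERIV_mult'[OF u(1)[of x] \<phi>(2)[of x]] DERIV_mult'[OF u(2)[of x] \<phi>(1)[of x]]
      by (rule DERIV_diff)
    then show "((\<lambda>x. u x * \<phi>1 x - u1 x * \<phi> x) has_real_derivative u x * \<phi>2 x - u2 x * \<phi> x) (at x)"
      by (simp add: algebra_simps)
  next
    show "continuous_on UNIV (\<lambda>x. u x * \<phi>2 x - u2 x * \<phi> x)"
      using c \<phi>c uc by (intro continuous_intros)
    show "periodic (\<lambda>x. u x * \<phi>1 x - u1 x * \<phi> x)"
      using per up \<phi>p by (simp add: periodic_def)
  qed
  moreover have "(LINT x|torus. u x * \<phi>2 x - u2 x * \<phi> x)
      = (LINT x|torus. u x * \<phi>2 x) - (LINT x|torus. u2 x * \<phi> x)"
    using c \<phi>c uc by (intro Bochner_Integration.integral_diff integrable_torus_continuous continuous_intros)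
  ultimately show ?thesis by simp
qed

section \<open>A semilinear elliptic equation on the torus\<close>

lemma periodic_attains_max:
  fixes f :: "real \<Rightarrow> real"
  assumes "continuous_on UNIV f" "periodic f"
  obtains x0 where "\<And>x. f x \<le> f x0"
proof -
  obtain x0 where x0: "\<And>y. y \<in> {0..1} \<Longrightarrow> f y \<le> f x0"
    using continuous_attains_sup[of "{0..1}" f] assms(1) continuous_on_subset by (metis atLeastAtMost_iff compact_Icc empty_iff order_refl subset_UNIV zero_le_one)
  have "f x \<le> f x0" for x
    using x0[of "frac x"] frac_lt_1[of x] periodic_frac[OF assms(2), of x] by simp
  then show thesis by (rule that)
qed

lemma periodic_attains_min:
  fixes f :: "real \<Rightarrow> real"
  assumes "continuous_on UNIV f" "periodic f"
  obtains x0 where "\<And>x. f x0 \<le> f x"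
proof -
  have "continuous_on UNIV (\<lambda>x. - f x)" "periodic (\<lambda>x. - f x)"
    using assms by (auto intro!: continuous_intros simp: periodic_def)
  then obtain x0 where "\<And>x. - f x \<le> - f x0"
    using periodic_attains_max by blast
  then show thesis by (intro that[of x0]) simp
qed

lemma second_derivative_at_max:
  fixes f :: "real \<Rightarrow> real"
  assumes f: "\<And>x. (f has_real_derivative f1 x) (at x)" and f1: "(f1 has_real_derivative l) (at x0)"
    and max: "\<And>x. f x \<le> f x0"
  shows "l \<le> 0"
proof (rule ccontr)
  assume "\<not> l \<le> 0"
  moreover have "f1 x0 = 0"
    using DERIV_local_max[OF f[of x0], of 1] max by simp
  ultimately obtain d where d: "d > 0" "\<And>h. 0 < h \<Longrightarrow> h < d \<Longrightarrow> 0 < f1 (x0 + h)"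
    using DERIV_pos_inc_right[OF f1] by auto
  have "f x0 < f (x0 + d / 2)"
  proof (rule DERIV_pos_imp_increasing_open[where f = f and a = x0 and b = "x0 + d / 2"])
    show "x0 < x0 + d / 2" using d by simp
    show "\<exists>y. (f has_real_derivative y) (at x) \<and> 0 < y" if "x0 < x" "x < x0 + d / 2" for x
      using f[of x] d(2)[of "x - x0"] that d(1) by auto
    show "continuous_on {x0..x0 + d / 2} f"
      using f by (rule DERIV_imp_continuous_on)
  qed
  with max[of "x0 + d / 2"] show False by simp
qed

text \<open>The maximum principle: where \<open>u\<close> is largest, \<open>u'' \<le> 0\<close> and hence \<open>\<beta> u \<le> f\<close>.\<close>

lemma elliptic_upper_bound:
  assumes u: "\<And>x. (u has_real_derivative u1 x) (at x)" "\<And>x. (u1 has_real_derivative u2 x) (at x)"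
    and per: "periodic u" and eq: "\<And>x. - \<epsilon> * u2 x + \<beta> * u x = f x"
    and "\<epsilon> > 0" "\<beta> > 0" and bound: "\<And>x. f x \<le> B"
  shows "\<beta> * u x \<le> B"
proof -
  have "continuous_on UNIV u"
    using u(1) by (rule DERIV_imp_continuous_on)
  then obtain x0 where x0: "\<And>x. u x \<le> u x0"
    using periodic_attains_max per by blast
  have "u2 x0 \<le> 0"
    using second_derivative_at_max[OF u x0] .
  then have "\<epsilon> * u2 x0 \<le> 0"
    using \<open>\<epsilon> > 0\<close> by (simp add: mult_nonneg_nonpos)
  then have "\<beta> * u x0 \<le> B"
    using eq[of x0] bound[of x0] by simp
  moreover have "\<beta> * u x \<le> \<beta> * u x0"
    using x0[of x] \<open>\<beta> > 0\<close> by simp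
  ultimately show ?thesis by linarith
qed

lemma elliptic_lower_bound:
  assumes u: "\<And>x. (u has_real_derivative u1 x) (at x)" "\<And>x. (u1 has_real_derivative u2 x) (at x)"
    and per: "periodic u" and eq: "\<And>x. - \<epsilon> * u2 x + \<beta> * u x = f x"
    and "\<epsilon> > 0" "\<beta> > 0" and bound: "\<And>x. B \<le> f x"
  shows "B \<le> \<beta> * u x"
proof -
  have "\<beta> * - u x \<le> - B"
  proof (rule elliptic_upper_bound[where u = "\<lambda>x. - u x" and x = x])
    show "((\<lambda>x. - u x) has_real_derivative - u1 x) (at x)" for x
      using u(1) by (rule DERIV_minus)
    show "((\<lambda>x. - u1 x) has_real_derivative - u2 x) (at x)" for x
      using u(2) by (rule DERIV_minus)
    show "periodic (\<lambda>x. - u x)" using per by (simp add: periodic_def)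
    show "- \<epsilon> * - u2 x + \<beta> * - u x = - f x" for x using eq[of x] by simp
  qed (use assms in auto)
  then show ?thesis by simp
qed

lemma periodic_first_order:
  fixes f :: "real \<Rightarrow> real"
  assumes "\<kappa> \<noteq> 0" and cont: "continuous_on UNIV f" and per: "periodic f"
  obtains v where "\<And>x. (v has_real_derivative f x - \<kappa> * v x) (at x)" "periodic v"
proof -
  have "continuous_on UNIV (\<lambda>x. exp (\<kappa> * x) * f x)"
    using cont by (intro continuous_intros)
  then obtain F where F: "\<And>x. (F has_real_derivative exp (\<kappa> * x) * f x) (at x)"
    using continuous_antiderivative by blast
  define c where "c = (F 0 - exp (- \<kappa>) * F 1) / (exp (- \<kappa>) - 1)"
  define v where "v x = exp (- (\<kappa> * x)) * (c + F x)" for x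
  have v: "(v has_real_derivative f x - \<kappa> * v x) (at x)" for x
  proof -
    have "(v has_real_derivative (exp (- (\<kappa> * x)) * (- \<kappa>)) * (c + F x) + (exp (\<kappa> * x) * f x) * exp (- (\<kappa> * x))) (at x)"
      unfolding v_def by (rule derivative_eq_intros F refl | simp)+
    moreover have "(exp (- (\<kappa> * x)) * (- \<kappa>)) * (c + F x) + (exp (\<kappa> * x) * f x) * exp (- (\<kappa> * x)) = f x - \<kappa> * v x"
      by (simp add: v_def exp_minus field_simps)
    ultimately show ?thesis
      by (simp only:)
  qed
  have "exp (- \<kappa>) - 1 \<noteq> 0" using \<open>\<kappa> \<noteq> 0\<close> by simp
  then have "c * (exp (- \<kappa>) - 1) = F 0 - exp (- \<kappa>) * F 1"
    by (simp add: c_def)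
  then have v01: "v 1 = v 0"
    by (simp add: v_def algebra_simps)
  have "((\<lambda>x. exp (\<kappa> * x) * (v (x + 1) - v x)) has_real_derivative 0) (at x)" for x
  proof -
    have "((\<lambda>x. v (x + 1)) has_real_derivative f (x + 1) - \<kappa> * v (x + 1)) (at x)"
      using v[of "x + 1"] by (simp add: DERIV_shift)
    then have "((\<lambda>x. v (x + 1) - v x) has_real_derivative (f (x + 1) - \<kappa> * v (x + 1)) - (f x - \<kappa> * v x)) (at x)"
      using v[of x] by (rule DERIV_diff)
    moreover have "((\<lambda>x. exp (\<kappa> * x)) has_real_derivative exp (\<kappa> * x) * \<kappa>) (at x)"
      by (auto intro!: derivative_eq_intros)
    ultimately have "((\<lambda>x. exp (\<kappa> * x) * (v (x + 1) - v x)) has_real_derivative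
        exp (\<kappa> * x) * ((f (x + 1) - \<kappa> * v (x + 1)) - (f x - \<kappa> * v x)) + exp (\<kappa> * x) * \<kappa> * (v (x + 1) - v x)) (at x)"
      by (intro DERIV_mult')
    moreover have "f (x + 1) = f x" using per by (simp add: periodic_def)
    ultimately show ?thesis by (simp add: algebra_simps)
  qed
  then have "exp (\<kappa> * x) * (v (x + 1) - v x) = exp (\<kappa> * 0) * (v (0 + 1) - v 0)" for x
    by (intro DERIV_isconst_all[of "\<lambda>x. exp (\<kappa> * x) * (v (x + 1) - v x)"]) auto
  then have "periodic v"
    using v01 by (simp add: periodic_def)
  with v show thesis by (rule that)
qed

text \<open>
  The operator factors as \<open>- u'' + \<kappa>\<^sup>2 u = (- d + \<kappa>) (d + \<kappa>) u\<close>, so it is inverted by solving two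
  first-order equations.
\<close>

lemma elliptic_solution:
  fixes f :: "real \<Rightarrow> real"
  assumes "\<epsilon> > 0" "\<beta> > 0" and cont: "continuous_on UNIV f" and per: "periodic f"
  obtains u u1 u2 where "\<And>x. (u has_real_derivative u1 x) (at x)" "\<And>x. (u1 has_real_derivative u2 x) (at x)"
    "periodic u" "continuous_on UNIV u2" "\<And>x. - \<epsilon> * u2 x + \<beta> * u x = f x"
proof -
  define \<kappa> where "\<kappa> = sqrt (\<beta> / \<epsilon>)"
  have \<kappa>: "\<kappa> \<noteq> 0" "\<kappa> * \<kappa> = \<beta> / \<epsilon>"
    using assms(1,2) by (auto simp: \<kappa>_def real_sqrt_mult_self)
  have "continuous_on UNIV (\<lambda>x. f x / \<epsilon>)" "periodic (\<lambda>x. f x / \<epsilon>)"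
    using cont per \<open>\<epsilon> > 0\<close> by (auto intro!: continuous_intros simp: periodic_def)
  then obtain v where v: "\<And>x. (v has_real_derivative f x / \<epsilon> - \<kappa> * v x) (at x)" "periodic v"
    using periodic_first_order[OF \<kappa>(1)] by blast
  have vc: "continuous_on UNIV v" using v(1) by (rule DERIV_imp_continuous_on)
  have "continuous_on UNIV (\<lambda>x. - v x)" "periodic (\<lambda>x. - v x)" "- \<kappa> \<noteq> 0"
    using vc v(2) \<kappa>(1) by (auto intro!: continuous_intros simp: periodic_def)
  then obtain u where u: "\<And>x. (u has_real_derivative - v x - (- \<kappa>) * u x) (at x)" "periodic u"
    using periodic_first_order by blast
  define u1 u2 where "u1 x = - v x - (- \<kappa>) * u x" and "u2 x = - (f x / \<epsilon> - \<kappa> * v x) - (- \<kappa>) * u1 x" for x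
  have 1: "(u has_real_derivative u1 x) (at x)" for x
    using u(1) by (simp add: u1_def)
  have 2: "(u1 has_real_derivative u2 x) (at x)" for x
    unfolding u1_def[abs_def] u2_def using 1
    by (intro DERIV_diff DERIV_minus v DERIV_cmult) (simp add: u1_def)
  have uc: "continuous_on UNIV u" using u(1) by (rule DERIV_imp_continuous_on)
  have 3: "continuous_on UNIV u2"
    unfolding u2_def u1_def using uc vc cont by (intro continuous_intros) (use \<open>\<epsilon> > 0\<close> in auto)
  have 4: "- \<epsilon> * u2 x + \<beta> * u x = f x" for x
  proof -
    have "u2 x = (\<kappa> * \<kappa>) * u x - f x / \<epsilon>"
      by (simp add: u2_def u1_def algebra_simps)
    then show ?thesis
      unfolding \<kappa>(2) using \<open>\<epsilon> > 0\<close> by (simp add: field_simps)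
  qed
  show thesis
    using 1 2 u(2) 3 4 by (rule that)
qed

lemma exp_diff_bounds:
  fixes z w :: real
  shows "exp z * (w - z) \<le> exp w - exp z" "exp w - exp z \<le> exp w * (w - z)"
proof -
  have "exp z * (1 + (w - z)) \<le> exp z * exp (w - z)"
    by (intro mult_left_mono exp_ge_add_one_self) simp
  then show "exp z * (w - z) \<le> exp w - exp z"
    by (simp add: exp_diff algebra_simps)
  have "exp w * (1 + (z - w)) \<le> exp w * exp (z - w)"
    by (intro mult_left_mono exp_ge_add_one_self) simp
  then show "exp w - exp z \<le> exp w * (w - z)"
    by (simp add: exp_diff algebra_simps)
qed

text \<open>
  The solution is a fixed point of the map \<open>T\<close> that sends \<open>z\<close> to the solution \<open>u\<close> of
  \<open>- \<epsilon> u'' + \<beta> u = \<beta> z - a e\<^sup>z + 1\<close>. The constants \<open>lo\<close> and \<open>hi\<close> are a subsolution and a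
  supersolution: \<open>a e\<^sup>l\<^sup>o \<le> 1 \<le> a e\<^sup>h\<^sup>i\<close>. The number \<open>\<beta>\<close> is the largest possible slope of
  \<open>z \<mapsto> a e\<^sup>z\<close> between them, so the right-hand side is increasing in \<open>z\<close> with slope at most
  \<open>\<beta> - m/M\<close>, where \<open>m\<close> and \<open>M\<close> are the extreme values of \<open>a\<close>. By the maximum
  principle \<open>T\<close> maps the periodic functions between \<open>lo\<close> and \<open>hi\<close> to themselves and contracts the
  supremum distance by the factor \<open>c = 1 - m/(M \<beta>)\<close>.
\<close>

theorem semilinear_solution:
  fixes a :: "real \<Rightarrow> real"
  assumes "\<epsilon> > 0" and cont: "continuous_on UNIV a" and per: "periodic a" and pos: "\<And>x. a x > 0"
  obtains Z Z1 Z2 where "\<And>x. (Z has_real_derivative Z1 x) (at x)" "\<And>x. (Z1 has_real_derivative Z2 x) (at x)"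
    "periodic Z" "continuous_on UNIV Z2" "\<And>x. \<epsilon> * Z2 x = a x * exp (Z x) - 1"
proof -
  obtain x0 where "\<And>x. a x0 \<le> a x" using periodic_attains_min[OF cont per] by blast
  moreover define m where "m = a x0"
  ultimately have m: "0 < m" "\<And>x. m \<le> a x" using pos by auto
  obtain x1 where "\<And>x. a x \<le> a x1" using periodic_attains_max[OF cont per] by blast
  moreover define M where "M = a x1"
  ultimately have M: "0 < M" "\<And>x. a x \<le> M" using pos by auto
  have mM: "m \<le> M" using m(2) M(2) order_trans by blast
  define lo hi \<beta> where "lo = - ln M" and "hi = - ln m" and "\<beta> = M / m"
  have lohi: "lo \<le> hi" using m M mM by (simp add: lo_def hi_def)
  have elo: "exp lo = 1 / M" and ehi: "exp hi = 1 / m"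
    using m M by (simp_all add: lo_def hi_def exp_minus inverse_eq_divide)
  have \<beta>: "\<beta> > 0" using m M by (simp add: \<beta>_def)
  define c where "c = 1 - m / M / \<beta>"
  have c: "0 \<le> c" "c < 1" "\<beta> * c = \<beta> - m / M"
  proof -
    have "m * m \<le> M * M" using mM m(1) by (intro mult_mono) auto
    then show "0 \<le> c" using m(1) M(1) by (simp add: c_def \<beta>_def field_simps)
    show "c < 1" using m(1) M(1) by (simp add: c_def \<beta>_def)
    show "\<beta> * c = \<beta> - m / M" using \<beta> by (simp add: c_def right_diff_distrib)
  qed
  define h where "h x z = \<beta> * z - a x * exp z + 1" for x z
  have h_diff: "0 \<le> h x w - h x z" "h x w - h x z \<le> \<beta> * c * (w - z)"
    if "lo \<le> z" "z \<le> w" "w \<le> hi" for x z w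
  proof -
    have hd: "h x w - h x z = \<beta> * (w - z) - a x * (exp w - exp z)"
      by (simp add: h_def algebra_simps)
    have "a x * (exp w - exp z) \<le> M * (exp hi * (w - z))"
    proof (rule mult_mono)
      have "exp w - exp z \<le> exp w * (w - z)" by (rule exp_diff_bounds)
      also have "\<dots> \<le> exp hi * (w - z)" using that by (intro mult_right_mono) auto
      finally show "exp w - exp z \<le> exp hi * (w - z)" .
    qed (use M that in auto)
    then show "0 \<le> h x w - h x z"
      unfolding hd ehi \<beta>_def by simp
    have "m * (exp lo * (w - z)) \<le> a x * (exp w - exp z)"
    proof (rule mult_mono)
      have "exp lo * (w - z) \<le> exp z * (w - z)" using that by (intro mult_right_mono) auto
      also have "\<dots> \<le> exp w - exp z" by (rule exp_diff_bounds)
      finally show "exp lo * (w - z) \<le> exp w - exp z" .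
    qed (use m that pos in \<open>auto simp: less_imp_le\<close>)
    then show "h x w - h x z \<le> \<beta> * c * (w - z)"
      unfolding hd c elo by (simp add: algebra_simps)
  qed
  have h_lip: "h x w - h x z \<le> \<beta> * c * \<bar>w - z\<bar>"
    if "lo \<le> z" "z \<le> hi" "lo \<le> w" "w \<le> hi" for x z w
  proof (cases "z \<le> w")
    case True
    then show ?thesis using h_diff(2)[of z w x] that by simp
  next
    case False
    then have "h x w - h x z \<le> 0" using h_diff(1)[of w z x] that by simp
    also have "0 \<le> \<beta> * c * \<bar>w - z\<bar>" using \<beta> c(1) by simp
    finally show ?thesis .
  qed
  have h_hi: "h x z \<le> \<beta> * hi" if "lo \<le> z" "z \<le> hi" for x z
  proof -
    have "h x z \<le> h x hi" using h_diff(1)[of z hi x] that by simp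
    moreover have "1 \<le> a x * exp hi" using m(2)[of x] m(1) by (simp add: ehi field_simps)
    ultimately show ?thesis by (simp add: h_def)
  qed
  have h_lo: "\<beta> * lo \<le> h x z" if "lo \<le> z" "z \<le> hi" for x z
  proof -
    have "h x lo \<le> h x z" using h_diff(1)[of lo z x] that by simp
    moreover have "a x * exp lo \<le> 1" using M(2)[of x] M(1) by (simp add: elo field_simps)
    ultimately show ?thesis by (simp add: h_def)
  qed
  define S :: "(real \<Rightarrow>\<^sub>C real) set" where "S = {g :: real \<Rightarrow>\<^sub>C real. \<forall>x. g (x + 1) = g x \<and> lo \<le> g x \<and> g x \<le> hi}"
  have eval: "continuous_on UNIV (\<lambda>g :: real \<Rightarrow>\<^sub>C real. g x)" for x
    unfolding continuous_on_iff
  proof (intro ballI allI impI)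
    fix g :: "real \<Rightarrow>\<^sub>C real" and e :: real assume "e > 0"
    then show "\<exists>d>0. \<forall>g'\<in>UNIV. dist g' g < d \<longrightarrow> dist (g' x) (g x) < e"
      by (intro exI[of _ e]) (meson dist_fun_lt_imp_dist_val_lt)
  qed
  have "closed S"
    unfolding S_def
    by (intro closed_Collect_all closed_Collect_conj closed_Collect_eq closed_Collect_le eval continuous_on_const)
  then have "Topological_Spaces.complete S"
    by (simp add: complete_eq_closed)
  have "const_bcontfun lo \<in> S"
    using lohi by (simp add: S_def const_bcontfun.rep_eq)
  define sol where "sol g u u1 u2 \<longleftrightarrow> (\<forall>x. (u has_real_derivative u1 x) (at x)) \<and>
    (\<forall>x. (u1 has_real_derivative u2 x) (at x)) \<and> periodic u \<and> continuous_on UNIV u2 \<and>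
    (\<forall>x. - \<epsilon> * u2 x + \<beta> * u x = h x (apply_bcontfun g x))" for g and u u1 u2 :: "real \<Rightarrow> real"
  have "\<exists>v\<in>S. \<exists>u1 u2. sol g (apply_bcontfun v) u1 u2" if "g \<in> S" for g
  proof -
    have g: "\<And>x. lo \<le> g x" "\<And>x. g x \<le> hi" "\<And>x. g (x + 1) = g x"
      using that by (auto simp: S_def)
    have "continuous_on UNIV (\<lambda>x. h x (g x))"
      unfolding h_def using cont by (intro continuous_intros continuous_on_apply_bcontfun)
    moreover have "periodic (\<lambda>x. h x (g x))"
      using per g(3) by (simp add: periodic_def h_def)
    ultimately obtain u u1 u2 where u: "\<And>x. (u has_real_derivative u1 x) (at x)" "\<And>x. (u1 has_real_derivative u2 x) (at x)"
      "periodic u" "continuous_on UNIV u2" "\<And>x. - \<epsilon> * u2 x + \<beta> * u x = h x (g x)"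
      using elliptic_solution[OF \<open>\<epsilon> > 0\<close> \<beta>] by blast
    have "\<beta> * u x \<le> \<beta> * hi" for x
      using elliptic_upper_bound[OF u(1-3,5) \<open>\<epsilon> > 0\<close> \<beta> h_hi[OF g(1,2)]] .
    then have hi: "u x \<le> hi" for x using \<beta> by simp
    have "\<beta> * lo \<le> \<beta> * u x" for x
      using elliptic_lower_bound[OF u(1-3,5) \<open>\<epsilon> > 0\<close> \<beta> h_lo[OF g(1,2)]] .
    then have lo: "lo \<le> u x" for x using \<beta> by simp
    have "bounded (range u)"
    proof (rule boundedI)
      fix y assume "y \<in> range u"
      then obtain x where "y = u x" by blast
      then show "norm y \<le> \<bar>lo\<bar> + \<bar>hi\<bar>"
        using lo[of x] hi[of x] by simp
    qed
    moreover have "continuous_on UNIV u" using u(1) by (rule DERIV_imp_continuous_on)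
    ultimately have "u \<in> bcontfun" by (simp add: bcontfun_def)
    then obtain v where v: "u = apply_bcontfun v" by (rule bcontfunE)
    have "v \<in> S" using lo hi u(3) by (simp add: S_def periodic_def v)
    moreover have "sol g (apply_bcontfun v) u1 u2"
      unfolding sol_def v[symmetric] using u by blast
    ultimately show ?thesis by blast
  qed
  then obtain T where T: "\<And>g. g \<in> S \<Longrightarrow> T g \<in> S" "\<And>g. g \<in> S \<Longrightarrow> \<exists>u1 u2. sol g (apply_bcontfun (T g)) u1 u2"
    by metis
  have T_le: "T g x - T k x \<le> c * dist g k" if gk: "g \<in> S" "k \<in> S" for g k x
  proof -
    obtain u1 u2 where u: "sol g (apply_bcontfun (T g)) u1 u2" using T(2)[OF gk(1)] by blast
    obtain v1 v2 where v: "sol k (apply_bcontfun (T k)) v1 v2" using T(2)[OF gk(2)] by blast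
    have "\<beta> * (T g x - T k x) \<le> \<beta> * (c * dist g k)"
    proof (rule elliptic_upper_bound[where u = "\<lambda>x. T g x - T k x" and x = x])
      show "((\<lambda>x. T g x - T k x) has_real_derivative u1 x - v1 x) (at x)" for x
        using u v unfolding sol_def by (intro DERIV_diff) auto
      show "((\<lambda>x. u1 x - v1 x) has_real_derivative u2 x - v2 x) (at x)" for x
        using u v unfolding sol_def by (intro DERIV_diff) auto
      show "periodic (\<lambda>x. T g x - T k x)"
        using u v unfolding sol_def periodic_def by simp
      show "- \<epsilon> * (u2 x - v2 x) + \<beta> * (T g x - T k x) = h x (g x) - h x (k x)" for x
      proof -
        have "- \<epsilon> * u2 x + \<beta> * T g x = h x (g x)" "- \<epsilon> * v2 x + \<beta> * T k x = h x (k x)"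
          using u v unfolding sol_def by auto
        then show ?thesis by (simp add: algebra_simps)
      qed
      show "h x (g x) - h x (k x) \<le> \<beta> * (c * dist g k)" for x
      proof -
        have "h x (g x) - h x (k x) \<le> \<beta> * c * \<bar>g x - k x\<bar>"
          using gk by (intro h_lip) (auto simp: S_def)
        also have "\<dots> \<le> \<beta> * c * dist g k"
          using dist_bounded[of g x k] \<beta> c(1) by (intro mult_left_mono) (auto simp: dist_real_def)
        finally show ?thesis by (simp add: mult.assoc)
      qed
    qed (fact \<open>\<epsilon> > 0\<close> \<beta>)+
    then show ?thesis using \<beta> by simp
  qed
  have "\<exists>!g\<in>S. T g = g"
  proof (rule Banach_fix[OF \<open>Topological_Spaces.complete S\<close> _ c(1,2)])
    show "dist (T g) (T k) \<le> c * dist g k" if "g \<in> S" "k \<in> S" for g k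
    proof (rule dist_bound)
      show "dist (T g x) (T k x) \<le> c * dist g k" for x
        using T_le[OF that, of x] T_le[OF that(2,1), of x] by (simp add: dist_real_def dist_commute abs_le_iff)
    qed
  qed (use T(1) \<open>const_bcontfun lo \<in> S\<close> in auto)
  then obtain g where g: "g \<in> S" "T g = g" by blast
  then obtain u1 u2 where sol: "sol g (apply_bcontfun g) u1 u2" using T(2)[OF g(1)] by auto
  show thesis
  proof (rule that)
    show "\<epsilon> * u2 x = a x * exp (g x) - 1" for x
    proof -
      have "- \<epsilon> * u2 x + \<beta> * g x = h x (g x)" using sol unfolding sol_def by blast
      then show ?thesis by (simp add: h_def)
    qed
  qed (use sol in \<open>auto simp: sol_def\<close>)
qed

section \<open>The mean-field potential\<close>

lemma smooth_derivatives:
  assumes "smooth \<phi>"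
  shows "(\<phi> has_real_derivative deriv \<phi> x) (at x)"
    "(deriv \<phi> has_real_derivative deriv (deriv \<phi>) x) (at x)"
    "continuous_on UNIV (deriv (deriv \<phi>))"
proof -
  have d: "(deriv ^^ n) \<phi> differentiable_on UNIV" for n
    using assms by (simp add: smooth_def)
  show "(\<phi> has_real_derivative deriv \<phi> x) (at x)"
    using d[of 0] by (simp add: DERIV_deriv_iff_real_differentiable differentiable_on_def)
  show "(deriv \<phi> has_real_derivative deriv (deriv \<phi>) x) (at x)"
    using d[of 1] by (simp add: DERIV_deriv_iff_real_differentiable differentiable_on_def)
  show "continuous_on UNIV (deriv (deriv \<phi>))"
    using differentiable_imp_continuous_on[OF d[of 2]] by (simp add: eval_nat_numeral)
qed

lemma deriv_trig:
  "deriv (\<lambda>x. a * cos (c * x) + b * sin (c * x)) = (\<lambda>x::real. (b * c) * cos (c * x) + (- (a * c)) * sin (c * x))"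
  by (rule ext, rule DERIV_imp_deriv) (auto intro!: derivative_eq_intros)

lemma smooth_trig: "smooth (\<lambda>x. a * cos (c * x) + b * sin (c * x))"
proof -
  have "(deriv ^^ n) (\<lambda>x. a * cos (c * x) + b * sin (c * x)) differentiable_on UNIV" for n
  proof (induction n arbitrary: a b)
    case 0
    have "((\<lambda>x. a * cos (c * x) + b * sin (c * x)) has_real_derivative
        - (a * c) * sin (c * x) + (b * c) * cos (c * x)) (at x)" for x
      by (auto intro!: derivative_eq_intros)
    then show ?case
      by (auto simp: differentiable_on_def real_differentiable_def)
  next
    case (Suc n)
    show ?case
      by (simp only: funpow_Suc_right comp_def deriv_trig Suc.IH)
  qed
  then show ?thesis by (simp add: smooth_def)
qed

lemma deriv2_trig:
  "deriv (deriv (\<lambda>x. a * cos (c * x) + b * sin (c * x))) = (\<lambda>x::real. - (c * c) * (a * cos (c * x) + b * sin (c * x)))"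
  unfolding deriv_trig by (rule ext) (simp add: algebra_simps)

lemma periodic_trig: "periodic (\<lambda>x. a * cos (2 * pi * of_int k * x) + b * sin (2 * pi * of_int k * x))"
proof -
  have "cos (2 * pi * of_int k * (x + 1)) = cos (2 * pi * of_int k * x)"
    "sin (2 * pi * of_int k * (x + 1)) = sin (2 * pi * of_int k * x)" for x
    using arg_cong[OF periodic_cis[of k, unfolded periodic_def, rule_format, of x], of Re]
      arg_cong[OF periodic_cis[of k, unfolded periodic_def, rule_format, of x], of Im] by simp_all
  then show ?thesis
    unfolding periodic_def by (simp only: simp_thms)
qed

lemma fourier_coeff_real_parts:
  assumes f: "continuous_on UNIV f"
  shows "Re (fourier_coeff f k) = (LINT x|torus. f x * cos (2 * pi * of_int k * x))"
    and "Im (fourier_coeff f k) = - (LINT x|torus. f x * sin (2 * pi * of_int k * x))"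
proof -
  have int: "integrable torus (\<lambda>x. complex_of_real (f x) * cis (- (2 * pi * of_int k * x)))"
    using f by (intro integrable_torus_continuous continuous_intros)
  show "Re (fourier_coeff f k) = (LINT x|torus. f x * cos (2 * pi * of_int k * x))"
    unfolding fourier_coeff_def integral_Re[OF int, symmetric] by simp
  show "Im (fourier_coeff f k) = - (LINT x|torus. f x * sin (2 * pi * of_int k * x))"
    unfolding fourier_coeff_def integral_Im[OF int, symmetric] by simp
qed

lemma continuous_trig_unique:
  assumes f: "continuous_on UNIV f" "periodic f"
    and zero: "\<And>k a b. (LINT x|torus. f x * (a * cos (2 * pi * of_int k * x) + b * sin (2 * pi * of_int k * x))) = 0"
  shows "f x = 0"
proof -
  have "fcoeff (\<lambda>x. complex_of_real (f x)) k = 0" for k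
    using fourier_coeff_real_parts[OF f(1), of k] zero[of 1 k 0] zero[of 0 k 1]
    by (simp add: fourier_coeff_eq_fcoeff complex_eq_iff)
  moreover have "continuous_on UNIV (\<lambda>x. complex_of_real (f x))" "periodic (\<lambda>x. complex_of_real (f x))"
    using f by (auto intro!: continuous_intros simp: periodic_def)
  ultimately have "complex_of_real (f x) = 0"
    using fcoeff_zero_imp_zero by blast
  then show ?thesis by simp
qed

text \<open>
  The equation is monotone: at a positive maximum of \<open>w = V - W\<close> the identity \<open>\<epsilon> w'' = e\<^sup>V - e\<^sup>W\<close>
  would force \<open>w'' > 0\<close>. The singular measure cancels in the difference, so \<open>w\<close> is regular enough
  for this argument. Exchanging \<open>V\<close> and \<open>W\<close> yields uniqueness.
\<close>

theorem poisson_solution_le: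
  assumes "\<epsilon> > 0" and V: "poisson_solution \<epsilon> \<mu> V" and W: "poisson_solution \<epsilon> \<mu> W"
  shows "V x \<le> W x"
proof -
  define w g where "w x = V x - W x" and "g x = exp (V x) - exp (W x)" for x
  have VW: "continuous_on UNIV V" "continuous_on UNIV W" "periodic V" "periodic W"
    using V W by (auto simp: poisson_solution_def sobolev_def)
  have w: "continuous_on UNIV w" "periodic w" and g: "continuous_on UNIV g" "periodic g"
    unfolding w_def[abs_def] g_def[abs_def] using VW by (auto intro!: continuous_intros simp: periodic_def)
  have weak: "\<epsilon> * (LINT x|torus. w x * deriv (deriv \<phi>) x) = (LINT x|torus. g x * \<phi> x)"
    if \<phi>: "smooth \<phi>" "periodic \<phi>" for \<phi>
  proof -
    have c: "continuous_on UNIV \<phi>" "continuous_on UNIV (deriv (deriv \<phi>))"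
      using smooth_derivatives[OF \<phi>(1)] DERIV_imp_continuous_on by blast+
    have 1: "(LINT x|torus. w x * deriv (deriv \<phi>) x)
        = (LINT x|torus. V x * deriv (deriv \<phi>) x) - (LINT x|torus. W x * deriv (deriv \<phi>) x)"
      unfolding w_def left_diff_distrib using c VW
      by (intro Bochner_Integration.integral_diff integrable_torus_continuous continuous_intros)
    have 2: "(LINT x|torus. g x * \<phi> x)
        = (LINT x|torus. exp (V x) * \<phi> x) - (LINT x|torus. exp (W x) * \<phi> x)"
      unfolding g_def left_diff_distrib using c VW
      by (intro Bochner_Integration.integral_diff integrable_torus_continuous continuous_intros)
    have "- \<epsilon> * (LINT x|torus. U x * deriv (deriv \<phi>) x)
          = (LINT x|\<mu>. \<phi> x) - (LINT x|torus. exp (U x) * \<phi> x)" if "U = V \<or> U = W" for U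
      using V W \<phi> that by (auto simp: poisson_solution_def)
    from this[of V] this[of W] show ?thesis
      unfolding 1 2 right_diff_distrib by simp
  qed
  \<comment> \<open>The classical solution \<open>u\<close> of \<open>- \<epsilon> u'' + u = w - g\<close> has the same weak formulation as \<open>w\<close>,
    which is therefore twice differentiable.\<close>
  have "continuous_on UNIV (\<lambda>x. w x - g x)" "periodic (\<lambda>x. w x - g x)"
    using w g by (auto intro!: continuous_intros simp: periodic_def)
  then obtain u u1 u2 where u: "\<And>x. (u has_real_derivative u1 x) (at x)" "\<And>x. (u1 has_real_derivative u2 x) (at x)"
    "periodic u" "continuous_on UNIV u2" "\<And>x. - \<epsilon> * u2 x + 1 * u x = w x - g x"
    using elliptic_solution[OF \<open>\<epsilon> > 0\<close>, of 1 "\<lambda>x. w x - g x"] by auto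
  have uc: "continuous_on UNIV u" using u(1) by (rule DERIV_imp_continuous_on)
  have "w x - u x = 0" for x
  proof (rule continuous_trig_unique[where f = "\<lambda>x. w x - u x"])
    show "continuous_on UNIV (\<lambda>x. w x - u x)" "periodic (\<lambda>x. w x - u x)"
      using w uc u(3) by (auto intro!: continuous_intros simp: periodic_def)
    fix k :: int and a b :: real
    define c where "c = 2 * pi * of_int k"
    define \<phi> where "\<phi> x = a * cos (c * x) + b * sin (c * x)" for x
    have \<phi>: "smooth \<phi>" "periodic \<phi>"
      unfolding \<phi>_def[abs_def] c_def by (rule smooth_trig, rule periodic_trig)
    have \<phi>2: "deriv (deriv \<phi>) = (\<lambda>x. - (c * c) * \<phi> x)"
      unfolding \<phi>_def[abs_def] by (rule deriv2_trig)
    note d = smooth_derivatives[OF \<phi>(1)]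
    have \<phi>c: "continuous_on UNIV \<phi>" using d(1) by (rule DERIV_imp_continuous_on)
    have i: "integrable torus (\<lambda>x. f x * \<phi> x)" if "continuous_on UNIV f" for f
      using that \<phi>c by (intro integrable_torus_continuous continuous_intros)
    have "(LINT x|torus. u x * deriv (deriv \<phi>) x) = (LINT x|torus. u2 x * \<phi> x)"
      by (rule integral_by_parts_second[OF d \<phi>(2) u(1,2,4,3)])
    moreover have int_\<phi>2: "(LINT x|torus. f x * deriv (deriv \<phi>) x) = - (c * c) * (LINT x|torus. f x * \<phi> x)" for f
    proof -
      have "f x * deriv (deriv \<phi>) x = - (c * c) * (f x * \<phi> x)" for x
        by (simp only: \<phi>2 mult.left_commute)
      then show ?thesis by (simp only: integral_mult_right_zero)
    qed
    ultimately have 1: "- (c * c) * (LINT x|torus. u x * \<phi> x) = (LINT x|torus. u2 x * \<phi> x)"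
      by simp
    have "(LINT x|torus. (- \<epsilon> * u2 x + 1 * u x) * \<phi> x) = (LINT x|torus. (w x - g x) * \<phi> x)"
      by (simp only: u(5))
    moreover have "(LINT x|torus. (- \<epsilon> * u2 x + 1 * u x) * \<phi> x) = - \<epsilon> * (LINT x|torus. u2 x * \<phi> x) + (LINT x|torus. u x * \<phi> x)"
    proof -
      have "(LINT x|torus. (- \<epsilon> * u2 x + 1 * u x) * \<phi> x) = (LINT x|torus. - \<epsilon> * (u2 x * \<phi> x) + u x * \<phi> x)"
        by (simp add: algebra_simps)
      also have "\<dots> = (LINT x|torus. - \<epsilon> * (u2 x * \<phi> x)) + (LINT x|torus. u x * \<phi> x)"
        by (intro Bochner_Integration.integral_add integrable_mult_right i uc u(4))
      finally show ?thesis by (simp only: integral_mult_right_zero)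
    qed
    moreover have "(LINT x|torus. (w x - g x) * \<phi> x) = (LINT x|torus. w x * \<phi> x) - (LINT x|torus. g x * \<phi> x)"
      unfolding left_diff_distrib by (intro Bochner_Integration.integral_diff i w g)
    moreover have "(LINT x|torus. g x * \<phi> x) = - \<epsilon> * (c * c) * (LINT x|torus. w x * \<phi> x)"
      using weak[OF \<phi>] by (simp add: int_\<phi>2)
    ultimately have "(1 + \<epsilon> * (c * c)) * (LINT x|torus. w x * \<phi> x) = (1 + \<epsilon> * (c * c)) * (LINT x|torus. u x * \<phi> x)"
      using 1[symmetric] by (simp add: algebra_simps)
    moreover have "0 < 1 + \<epsilon> * (c * c)"
      using \<open>\<epsilon> > 0\<close> by (intro add_pos_nonneg) auto
    ultimately have "(LINT x|torus. w x * \<phi> x) = (LINT x|torus. u x * \<phi> x)" by simp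
    then have "(LINT x|torus. (w x - u x) * \<phi> x) = 0"
      unfolding left_diff_distrib using i[OF w(1)] i[OF uc] by simp
    then show "(LINT x|torus. (w x - u x) * (a * cos (2 * pi * of_int k * x) + b * sin (2 * pi * of_int k * x))) = 0"
      by (simp add: \<phi>_def c_def)
  qed
  then have wu: "w x = u x" for x by simp
  then have eq: "\<epsilon> * u2 x = g x" for x using u(5)[of x] by simp
  obtain x0 where max: "\<And>x. u x \<le> u x0"
    using periodic_attains_max[OF uc u(3)] by blast
  have "u2 x0 \<le> 0"
    using second_derivative_at_max[OF u(1,2) max] .
  then have "g x0 \<le> 0"
    using eq[of x0] \<open>\<epsilon> > 0\<close> mult_nonneg_nonpos[of \<epsilon> "u2 x0"] by simp
  then have "w x0 \<le> 0"
    by (simp add: g_def w_def)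
  then have "w x \<le> 0"
    using max[of x] wu by simp
  then show ?thesis by (simp add: w_def)
qed

text \<open>
  Testing with \<open>cos (2 \<pi> k x)\<close> and \<open>sin (2 \<pi> k x)\<close> bounds \<open>k\<^sup>2 \<bar>c\<^sub>k\<bar>\<close>, where \<open>c\<^sub>k\<close> are the Fourier
  coefficients of \<open>V\<close>; then \<open>(1 + k\<^sup>2) \<bar>c\<^sub>k\<bar>\<^sup>2\<close> is of order \<open>1/(1 + k\<^sup>2)\<close>.
\<close>

lemma sobolev_one_of_weak:
  assumes V: "continuous_on UNIV V" "periodic V" and "\<epsilon> > 0"
    and weak: "\<And>\<phi>. smooth \<phi> \<Longrightarrow> periodic \<phi> \<Longrightarrow> (\<And>x. \<bar>\<phi> x\<bar> \<le> 1) \<Longrightarrow>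
      \<bar>\<epsilon> * (LINT x|torus. V x * deriv (deriv \<phi>) x)\<bar> \<le> B"
  shows "sobolev 1 V"
proof -
  obtain C where C: "C > 0" "\<And>x. 0 \<le> x \<Longrightarrow> x \<le> 1 \<Longrightarrow> norm (V x) \<le> C"
    using continuous_bounded_unit[OF V(1)] by blast
  have "\<bar>\<epsilon> * (LINT x|torus. V x * deriv (deriv (\<lambda>x. 0 * cos (0 * x) + 0 * sin (0 * x))) x)\<bar> \<le> B"
    using periodic_trig[of 0 0 0] by (intro weak smooth_trig) auto
  then have B: "0 \<le> B" by linarith
  define D where "D = C + 2 * B / \<epsilon>"
  have D: "D \<ge> 0" using B C \<open>\<epsilon> > 0\<close> by (simp add: D_def)
  have bound: "(1 + (of_int k)\<^sup>2) * cmod (fourier_coeff V k) \<le> D" for k :: int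
  proof -
    define c where "c = 2 * pi * of_int k"
    have trig: "\<epsilon> * (c * c) * \<bar>LINT x|torus. V x * (a * cos (c * x) + b * sin (c * x))\<bar> \<le> B"
      if "\<bar>a\<bar> + \<bar>b\<bar> \<le> 1" for a b
    proof -
      have "\<bar>a * cos (c * x) + b * sin (c * x)\<bar> \<le> 1" for x
      proof -
        have "\<bar>a * cos (c * x) + b * sin (c * x)\<bar> \<le> \<bar>a\<bar> * \<bar>cos (c * x)\<bar> + \<bar>b\<bar> * \<bar>sin (c * x)\<bar>"
          using abs_triangle_ineq[of "a * cos (c * x)" "b * sin (c * x)"] by (simp add: abs_mult)
        also have "\<dots> \<le> \<bar>a\<bar> * 1 + \<bar>b\<bar> * 1"
          by (intro add_mono mult_left_mono) auto
        finally show ?thesis using that by simp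
      qed
      then have "\<bar>\<epsilon> * (LINT x|torus. V x * deriv (deriv (\<lambda>x. a * cos (c * x) + b * sin (c * x))) x)\<bar> \<le> B"
        using periodic_trig[of a k b] by (intro weak smooth_trig) (simp_all add: c_def)
      moreover have "(LINT x|torus. V x * deriv (deriv (\<lambda>x. a * cos (c * x) + b * sin (c * x))) x)
          = - (c * c) * (LINT x|torus. V x * (a * cos (c * x) + b * sin (c * x)))"
      proof -
        have "V x * deriv (deriv (\<lambda>x. a * cos (c * x) + b * sin (c * x))) x
           = - (c * c) * (V x * (a * cos (c * x) + b * sin (c * x)))" for x
          unfolding deriv2_trig by (simp only: mult.left_commute)
        then show ?thesis by (simp only: integral_mult_right_zero)
      qed
      ultimately show ?thesis
        using \<open>\<epsilon> > 0\<close> by (simp add: abs_mult mult.assoc)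
    qed
    have "cmod (fourier_coeff V k) \<le> \<bar>LINT x|torus. V x * cos (c * x)\<bar> + \<bar>LINT x|torus. V x * sin (c * x)\<bar>"
      using cmod_le[of "fourier_coeff V k"] fourier_coeff_real_parts[OF V(1), of k] by (simp add: c_def)
    then have "\<epsilon> * (c * c) * cmod (fourier_coeff V k)
       \<le> \<epsilon> * (c * c) * (\<bar>LINT x|torus. V x * cos (c * x)\<bar> + \<bar>LINT x|torus. V x * sin (c * x)\<bar>)"
      using \<open>\<epsilon> > 0\<close> by (intro mult_left_mono) auto
    also have "\<dots> \<le> 2 * B"
      using trig[of 1 0] trig[of 0 1] by (simp add: distrib_left)
    finally have 1: "\<epsilon> * (c * c) * cmod (fourier_coeff V k) \<le> 2 * B" .
    have "1 * 1 \<le> (2 * pi) * (2 * pi)"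
      using pi_ge_two by (intro mult_mono) auto
    then have "1 * (of_int k)\<^sup>2 \<le> ((2 * pi) * (2 * pi)) * (of_int k)\<^sup>2"
      by (intro mult_right_mono) auto
    then have "(of_int k)\<^sup>2 \<le> c * c"
      by (simp add: c_def power2_eq_square algebra_simps)
    then have "\<epsilon> * (of_int k)\<^sup>2 * cmod (fourier_coeff V k) \<le> \<epsilon> * (c * c) * cmod (fourier_coeff V k)"
      using \<open>\<epsilon> > 0\<close> by (intro mult_right_mono mult_left_mono) auto
    with 1 have "\<epsilon> * (of_int k)\<^sup>2 * cmod (fourier_coeff V k) \<le> 2 * B"
      by linarith
    then have "(of_int k)\<^sup>2 * cmod (fourier_coeff V k) \<le> 2 * B / \<epsilon>"
      using \<open>\<epsilon> > 0\<close> by (simp add: pos_le_divide_eq mult_ac)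
    moreover have "cmod (fourier_coeff V k) \<le> C"
      unfolding fourier_coeff_eq_fcoeff
      using C V(1) by (intro norm_fcoeff_le) (auto intro!: continuous_intros)
    ultimately show ?thesis by (simp add: D_def distrib_right)
  qed
  have "(\<lambda>k::int. (1 + (of_int k)\<^sup>2) powr 1 * (cmod (fourier_coeff V k))\<^sup>2) summable_on UNIV"
  proof (subst summable_on_int_iff)
    show "summable (\<lambda>n. (1 + (real_of_int (int_decode n))\<^sup>2) powr 1 * (cmod (fourier_coeff V (int_decode n)))\<^sup>2)"
    proof (rule summable_comparison_test'[OF summable_mult[OF summable_int_decode_inverse_square, of "D\<^sup>2"], of 0])
      fix n
      define A where "A = 1 + (real_of_int (int_decode n))\<^sup>2"
      have A: "A > 0" by (simp add: A_def add_pos_nonneg)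
      have "(A * cmod (fourier_coeff V (int_decode n)))\<^sup>2 \<le> D\<^sup>2"
        using bound[of "int_decode n"] A by (intro power_mono) (auto simp: A_def)
      then have "A * (cmod (fourier_coeff V (int_decode n)))\<^sup>2 \<le> D\<^sup>2 * (1 / A)"
        using A by (simp add: field_simps power2_eq_square)
      then show "norm ((1 + (real_of_int (int_decode n))\<^sup>2) powr 1 * (cmod (fourier_coeff V (int_decode n)))\<^sup>2)
          \<le> D\<^sup>2 * (1 / (1 + (real_of_int (int_decode n))\<^sup>2))"
        using A unfolding A_def[symmetric] by simp
    qed
  qed auto
  with V show ?thesis by (simp add: sobolev_def)
qed

lemma integral_empirical:
  fixes f :: "real \<Rightarrow> real"
  assumes X: "\<And>j. j < N \<Longrightarrow> X j \<in> {0..<1}" and f: "f \<in> borel_measurable torus"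
  shows "(LINT x|empirical N X. f x) = (\<Sum>j<N. f (X j)) / real N"
proof -
  have "X \<in> uniform_count_measure {..<N} \<rightarrow>\<^sub>M torus"
    using X by (auto simp: measurable_def space_uniform_count_measure sets_uniform_count_measure)
  then show ?thesis
    unfolding empirical_def by (simp add: integral_distr f integral_uniform_count_measure)
qed

definition mean_green :: "nat \<Rightarrow> (nat \<Rightarrow> real) \<Rightarrow> real \<Rightarrow> real" where
  "mean_green N X x = (\<Sum>j<N. green (x - X j)) / real N"

lemma continuous_mean_green: "continuous_on UNIV (mean_green N X)"
proof (cases "N = 0")
  case True
  then have "mean_green N X = (\<lambda>x. 0)" by (simp add: mean_green_def[abs_def])
  then show ?thesis by simp
next
  case False
  then show ?thesis
    unfolding mean_green_def[abs_def] by (intro continuous_intros) auto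
qed

lemma periodic_mean_green: "periodic (mean_green N X)"
proof -
  have "green (x + 1 - y) = green (x - y)" for x y
    using green_shift_int[of "x - y" 1] by (simp add: algebra_simps)
  then show ?thesis by (simp add: periodic_def mean_green_def)
qed

lemma mean_green_second_derivative:
  assumes "N > 0"
    and \<phi>: "\<And>x. (\<phi> has_real_derivative \<phi>1 x) (at x)" "\<And>x. (\<phi>1 has_real_derivative \<phi>2 x) (at x)"
      "continuous_on UNIV \<phi>2" "periodic \<phi>"
  shows "(LINT x|torus. mean_green N X x * \<phi>2 x) = (LINT x|torus. \<phi> x) - (\<Sum>j<N. \<phi> (X j)) / real N"
proof -
  have "(LINT x|torus. mean_green N X x * \<phi>2 x) = (LINT x|torus. (\<Sum>j<N. green (x - X j) * \<phi>2 x) / real N)"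
    by (simp add: mean_green_def sum_distrib_right)
  also have "\<dots> = (LINT x|torus. (\<Sum>j<N. green (x - X j) * \<phi>2 x)) / real N"
    by simp
  also have "(LINT x|torus. (\<Sum>j<N. green (x - X j) * \<phi>2 x)) = (\<Sum>j<N. LINT x|torus. green (x - X j) * \<phi>2 x)"
    by (intro Bochner_Integration.integral_sum integrable_torus_continuous continuous_intros \<phi>)
  also have "\<dots> = (\<Sum>j<N. (LINT x|torus. \<phi> x) - \<phi> (X j))"
    by (simp only: green_second_derivative[OF \<phi>])
  also have "\<dots> / real N = (LINT x|torus. \<phi> x) - (\<Sum>j<N. \<phi> (X j)) / real N"
    using \<open>N > 0\<close> by (simp add: sum_subtractf diff_divide_distrib)
  finally show ?thesis .
qed

text \<open>
  The singular part of the solution is explicit: \<open>V = P/\<epsilon> + Z\<close> with \<open>P\<close> the convolution of \<open>green\<close>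
  with the empirical measure, so that \<open>- P'' = \<mu> - 1\<close>. The remainder satisfies the classical equation
  \<open>\<epsilon> Z'' = e\<^sup>P\<^sup>/\<^sup>\<epsilon> e\<^sup>Z - 1\<close>. Integrating it shows that \<open>e\<^sup>V\<close> has mass one, and convolving it with
  \<open>green\<close> expresses \<open>V\<close> through \<open>\<mu>\<close> and \<open>e\<^sup>V\<close> alone, without any derivative of \<open>V\<close>.
\<close>

theorem potential_representation:
  assumes "N > 0" "\<epsilon> > 0" and X: "\<And>j. j < N \<Longrightarrow> X j \<in> {0..<1}"
  defines "V \<equiv> potential \<epsilon> N X"
  shows "continuous_on UNIV V" and "(LINT x|torus. exp (V x)) = 1"
    and "\<exists>c. \<forall>x. \<epsilon> * V x = mean_green N X x - (LINT y|torus. green (x - y) * exp (V y)) + c"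
proof -
  let ?P = "mean_green N X"
  have "continuous_on UNIV (\<lambda>x. exp (?P x / \<epsilon>))" "periodic (\<lambda>x. exp (?P x / \<epsilon>))"
    using \<open>\<epsilon> > 0\<close> continuous_mean_green periodic_mean_green
    by (auto intro!: continuous_intros simp: periodic_def)
  then obtain Z Z1 Z2 where Z: "\<And>x. (Z has_real_derivative Z1 x) (at x)" "\<And>x. (Z1 has_real_derivative Z2 x) (at x)"
    "periodic Z" "continuous_on UNIV Z2" and Zeq: "\<And>x. \<epsilon> * Z2 x = exp (?P x / \<epsilon>) * exp (Z x) - 1"
    using semilinear_solution[OF \<open>\<epsilon> > 0\<close>, of "\<lambda>x. exp (?P x / \<epsilon>)"] by auto
  define W where "W x = ?P x / \<epsilon> + Z x" for x
  have Zc: "continuous_on UNIV Z" and Z1p: "periodic Z1" and Z1c: "continuous_on UNIV Z1"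
    using Z DERIV_imp_continuous_on periodic_deriv by blast+
  have Wc: "continuous_on UNIV W" and Wp: "periodic W"
    unfolding W_def[abs_def] using \<open>\<epsilon> > 0\<close> continuous_mean_green periodic_mean_green Zc Z(3)
    by (auto intro!: continuous_intros simp: periodic_def)
  have Z2: "\<epsilon> * Z2 x = exp (W x) - 1" for x
    by (simp add: Zeq W_def exp_add)
  have "(LINT x|torus. exp (W x) - 1) = (LINT x|torus. \<epsilon> * Z2 x)"
    by (simp only: Z2)
  also have "\<dots> = 0"
    using torus_integral_deriv_periodic[OF Z(2,4) Z1p] by simp
  finally have mass: "(LINT x|torus. exp (W x)) = 1"
    using Wc by (subst (asm) Bochner_Integration.integral_diff)
      (auto intro!: integrable_torus_continuous continuous_intros)
  have weak: "- \<epsilon> * (LINT x|torus. W x * deriv (deriv \<phi>) x)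
      = (LINT x|empirical N X. \<phi> x) - (LINT x|torus. exp (W x) * \<phi> x)"
    if \<phi>: "smooth \<phi>" "periodic \<phi>" for \<phi>
  proof -
    note d = smooth_derivatives[OF \<phi>(1)]
    have c: "continuous_on UNIV \<phi>" using d(1) by (rule DERIV_imp_continuous_on)
    have emp: "(LINT x|empirical N X. \<phi> x) = (\<Sum>j<N. \<phi> (X j)) / real N"
      using X c by (intro integral_empirical) (auto intro: continuous_measurable_torus)
    have "\<epsilon> * (LINT x|torus. W x * deriv (deriv \<phi>) x)
        = (LINT x|torus. \<epsilon> * (W x * deriv (deriv \<phi>) x))" by simp
    also have "\<dots> = (LINT x|torus. ?P x * deriv (deriv \<phi>) x + \<epsilon> * (Z x * deriv (deriv \<phi>) x))"
      using \<open>\<epsilon> > 0\<close> by (intro Bochner_Integration.integral_cong) (simp_all add: W_def field_simps)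
    also have "\<dots> = (LINT x|torus. ?P x * deriv (deriv \<phi>) x) + (LINT x|torus. \<epsilon> * (Z x * deriv (deriv \<phi>) x))"
      using d(3) Zc continuous_mean_green
      by (intro Bochner_Integration.integral_add integrable_torus_continuous continuous_intros)
    also have "(LINT x|torus. ?P x * deriv (deriv \<phi>) x) = (LINT x|torus. \<phi> x) - (\<Sum>j<N. \<phi> (X j)) / real N"
      by (rule mean_green_second_derivative[OF \<open>N > 0\<close> d \<phi>(2)])
    also have "(LINT x|torus. \<epsilon> * (Z x * deriv (deriv \<phi>) x)) = \<epsilon> * (LINT x|torus. Z2 x * \<phi> x)"
      using integral_by_parts_second[OF d \<phi>(2) Z(1,2,4,3)] by simp
    also have "\<epsilon> * (LINT x|torus. Z2 x * \<phi> x) = (LINT x|torus. (\<epsilon> * Z2 x) * \<phi> x)"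
      by (simp add: mult.assoc)
    also have "\<dots> = (LINT x|torus. exp (W x) * \<phi> x - \<phi> x)"
      by (simp add: Z2 left_diff_distrib)
    also have "\<dots> = (LINT x|torus. exp (W x) * \<phi> x) - (LINT x|torus. \<phi> x)"
      using Wc c by (intro Bochner_Integration.integral_diff integrable_torus_continuous continuous_intros)
    finally show ?thesis using emp by simp
  qed
  have "sobolev 1 W"
  proof (rule sobolev_one_of_weak[OF Wc Wp \<open>\<epsilon> > 0\<close>])
    fix \<phi> :: "real \<Rightarrow> real" assume \<phi>: "smooth \<phi>" "periodic \<phi>" "\<And>x. \<bar>\<phi> x\<bar> \<le> 1"
    have c: "continuous_on UNIV \<phi>"
      using smooth_derivatives(1)[OF \<phi>(1)] by (rule DERIV_imp_continuous_on)
    have emp: "(LINT x|empirical N X. \<phi> x) = (\<Sum>j<N. \<phi> (X j)) / real N"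
      using X c by (intro integral_empirical) (auto intro: continuous_measurable_torus)
    have "\<bar>\<Sum>j<N. \<phi> (X j)\<bar> \<le> (\<Sum>j<N. 1)"
      using \<phi>(3) by (intro sum_abs[THEN order_trans] sum_mono)
    then have 1: "\<bar>LINT x|empirical N X. \<phi> x\<bar> \<le> 1"
      using \<open>N > 0\<close> by (simp add: emp)
    have "norm (LINT x|torus. exp (W x) * \<phi> x) \<le> (LINT x|torus. exp (W x))"
    proof (rule Bochner_Integration.integral_norm_bound_integral)
      show "norm (exp (W x) * \<phi> x) \<le> exp (W x)" for x
        using \<phi>(3)[of x] by (simp add: abs_mult)
      show "integrable torus (\<lambda>x. exp (W x) * \<phi> x)"
        using Wc c by (intro integrable_torus_continuous continuous_intros)
      show "integrable torus (\<lambda>x. exp (W x))"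
        using Wc by (intro integrable_torus_continuous continuous_intros)
    qed
    then have 2: "\<bar>LINT x|torus. exp (W x) * \<phi> x\<bar> \<le> 1"
      by (simp add: mass)
    show "\<bar>\<epsilon> * (LINT x|torus. W x * deriv (deriv \<phi>) x)\<bar> \<le> 2"
      using weak[OF \<phi>(1,2)] 1 2 by simp
  qed
  with weak have W: "poisson_solution \<epsilon> (empirical N X) W"
    by (simp add: poisson_solution_def)
  have "V = W"
    unfolding V_def potential_def
  proof (rule the_equality[where a = W])
    show "U = W" if "poisson_solution \<epsilon> (empirical N X) U" for U
      using poisson_solution_le[OF \<open>\<epsilon> > 0\<close> that W] poisson_solution_le[OF \<open>\<epsilon> > 0\<close> W that]
      by (intro ext antisym)
  qed (rule W)
  have rep: "\<epsilon> * W x = ?P x - (LINT y|torus. green (x - y) * exp (W y))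
      + ((LINT y|torus. green y) + \<epsilon> * (LINT y|torus. Z y))" for x
  proof -
    have "\<epsilon> * ((LINT y|torus. Z y) - Z x) = \<epsilon> * (LINT y|torus. green (y - x) * Z2 y)"
      by (simp only: green_second_derivative[OF Z(1,2,4,3)])
    also have "\<dots> = (LINT y|torus. green (y - x) * (\<epsilon> * Z2 y))"
      by (simp add: mult.left_commute)
    also have "\<dots> = (LINT y|torus. green (x - y) * exp (W y) - green (x - y))"
      by (simp add: Z2 right_diff_distrib green_commute[of x])
    also have "\<dots> = (LINT y|torus. green (x - y) * exp (W y)) - (LINT y|torus. green (x - y))"
      using Wc by (intro Bochner_Integration.integral_diff integrable_torus_continuous continuous_intros)
    also have "(LINT y|torus. green (x - y)) = (LINT y|torus. green y)"
      by (rule torus_reflect[OF continuous_green periodic_green])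
    finally show ?thesis
      using \<open>\<epsilon> > 0\<close> by (simp add: W_def right_diff_distrib distrib_left)
  qed
  show "continuous_on UNIV V" "(LINT x|torus. exp (V x)) = 1"
    "\<exists>c. \<forall>x. \<epsilon> * V x = ?P x - (LINT y|torus. green (x - y) * exp (V y)) + c"
    unfolding \<open>V = W\<close> using Wc mass rep by blast+
qed

section \<open>The interaction energy as a square\<close>

definition torus_prob :: "real measure \<Rightarrow> bool" where
  "torus_prob M \<longleftrightarrow> prob_space M \<and> sets M = sets torus"

lemma torus_prob_space: "torus_prob M \<Longrightarrow> space M = {0..<1}"
  using sets_eq_imp_space_eq[of M torus] by (simp add: torus_prob_def)

lemma torus_prob_measurable:
  fixes f :: "real \<Rightarrow> real"
  assumes "torus_prob M" "f \<in> borel_measurable borel"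
  shows "f \<in> borel_measurable M"
proof -
  have "borel_measurable M = (borel_measurable torus :: (real \<Rightarrow> real) set)"
    by (rule measurable_cong_sets) (use assms(1) in \<open>simp_all add: torus_prob_def\<close>)
  with measurable_torus_borel[OF assms(2)] show ?thesis
    by (simp only:)
qed

lemma torus_prob_integrable:
  fixes f :: "real \<Rightarrow> real"
  assumes M: "torus_prob M" and f: "f \<in> borel_measurable borel" "\<And>x. 0 \<le> x \<Longrightarrow> x < 1 \<Longrightarrow> \<bar>f x\<bar> \<le> B"
  shows "integrable M f"
proof -
  interpret M: prob_space M using M by (simp add: torus_prob_def)
  show ?thesis
    by (rule M.integrable_const_bound[of _ B])
      (use f M in \<open>auto simp: torus_prob_space intro: torus_prob_measurable AE_I2\<close>)
qed

lemma torus_prob_density: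
  assumes f: "continuous_on UNIV f" "\<And>x. 0 \<le> f x" "(LINT x|torus. f x) = 1"
  shows "torus_prob (density torus (\<lambda>x. ennreal (f x)))"
  unfolding torus_prob_def
proof (intro conjI prob_spaceI)
  have [measurable]: "f \<in> borel_measurable torus"
    using f(1) by (rule continuous_measurable_torus)
  have "emeasure (density torus (\<lambda>x. ennreal (f x))) (space torus) = (\<integral>\<^sup>+x. ennreal (f x) \<partial>torus)"
    by (subst emeasure_density) (auto intro!: nn_integral_cong simp del: space_torus)
  also have "\<dots> = ennreal (LINT x|torus. f x)"
    using f by (intro nn_integral_eq_integral integrable_torus_continuous) auto
  finally show "emeasure (density torus (\<lambda>x. ennreal (f x))) (space (density torus (\<lambda>x. ennreal (f x)))) = 1"
    using f(3) by simp
qed simp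

lemma integral_density_torus:
  fixes g :: "real \<Rightarrow> real"
  assumes f: "continuous_on UNIV f" "\<And>x. 0 \<le> f x" and g: "g \<in> borel_measurable torus"
  shows "(LINT x|density torus (\<lambda>x. ennreal (f x)). g x) = (LINT x|torus. f x * g x)"
  using integral_density[OF g continuous_measurable_torus[OF f(1)]] f(2) by simp

lemma torus_prob_empirical:
  assumes "N > 0" and X: "\<And>j. j < N \<Longrightarrow> X j \<in> {0..<1}"
  shows "torus_prob (empirical N X)"
  unfolding torus_prob_def
proof
  have "X \<in> uniform_count_measure {..<N} \<rightarrow>\<^sub>M torus"
    using X by (auto simp: measurable_def space_uniform_count_measure sets_uniform_count_measure)
  moreover have "prob_space (uniform_count_measure {..<N})"
    using \<open>N > 0\<close> by (intro prob_space_uniform_count_measure) auto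
  ultimately show "prob_space (empirical N X)"
    unfolding empirical_def by (intro prob_space.prob_space_distr)
qed (simp add: empirical_def)

text \<open>
  As a function of \<open>t\<close>, this is the distribution function of the unit mass at \<open>x\<close>, normalised to mean
  zero on \<open>[0,1]\<close>.
\<close>

definition step_kernel :: "real \<Rightarrow> real \<Rightarrow> real" where
  "step_kernel x t = (if x \<le> t then 1 else 0) - (1 - x)"

lemma step_kernel_measurable [measurable (raw)]:
  assumes [measurable]: "f \<in> borel_measurable M" "g \<in> borel_measurable M"
  shows "(\<lambda>z. step_kernel (f z) (g z)) \<in> borel_measurable M"
  unfolding step_kernel_def by measurable

lemma step_kernel_bound: "0 \<le> x \<Longrightarrow> x < 1 \<Longrightarrow> \<bar>step_kernel x t\<bar> \<le> 1"
  by (auto simp: step_kernel_def)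

lemma integral_torus_step:
  assumes "0 \<le> x" "x < 1"
  shows "(LINT t|torus. (if x \<le> t then 1 else 0 :: real)) = 1 - x"
proof -
  have "(LINT t|torus. (if x \<le> t then 1 else 0 :: real)) = (LINT t|lborel. indicator {x..<1} t)"
  proof -
    have "indicator {0..<1} t *\<^sub>R (if x \<le> t then 1 else 0) = (indicator {x..<1} t :: real)" for t
      using assms by (auto simp: indicator_def)
    then show ?thesis
      unfolding torus_def by (subst integral_restrict_space) simp_all
  qed
  also have "\<dots> = 1 - x"
    using assms by simp
  finally show ?thesis .
qed

text \<open>
  Both \<open>green (x - y)\<close> and the integral are \<open>- max x y - x y\<close> up to terms that depend on \<open>x\<close> alone or on
  \<open>y\<close> alone. Such terms cancel in the energy of a difference of two probability measures, so this is why the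
  interaction energy is a square.
\<close>

lemma green_eq_step_kernel:
  assumes x: "0 \<le> x" "x < 1" and y: "0 \<le> y" "y < 1"
  shows "green (x - y) = (LINT t|torus. step_kernel x t * step_kernel y t) + (x\<^sup>2 - x) / 2 + (y\<^sup>2 - y) / 2"
proof -
  define e where "e x t = (if x \<le> t then 1 else 0 :: real)" for x t :: real
  have [measurable]: "e x \<in> borel_measurable torus" for x
    unfolding e_def by (rule measurable_torus_borel) measurable
  have int: "integrable torus (e x)" for x
    by (rule integrable_torus_bounded[of _ 1]) (auto simp: e_def)
  have ie: "(LINT t|torus. e x t) = 1 - x" if "0 \<le> x" "x < 1" for x
    using integral_torus_step[OF that] by (simp add: e_def)
  have "step_kernel x t * step_kernel y t
     = e (max x y) t - (1 - y) * e x t - (1 - x) * e y t + (1 - x) * (1 - y)" for t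
    by (auto simp: step_kernel_def e_def algebra_simps max_def)
  then have "(LINT t|torus. step_kernel x t * step_kernel y t)
     = (LINT t|torus. e (max x y) t - (1 - y) * e x t - (1 - x) * e y t + (1 - x) * (1 - y))"
    by simp
  also have "\<dots> = (1 - max x y) - (1 - y) * (1 - x) - (1 - x) * (1 - y) + (1 - x) * (1 - y)"
    using int ie[of x] ie[of y] ie[of "max x y"] x y by simp
  also have "\<dots> = (1 - max x y) - (1 - x) * (1 - y)" by simp
  finally have int: "(LINT t|torus. step_kernel x t * step_kernel y t) = (1 - max x y) - (1 - x) * (1 - y)" .
  have "green (x - y) = ((x - y)\<^sup>2 - \<bar>x - y\<bar>) / 2"
    using x y by (intro green_eq) auto
  then show ?thesis
    unfolding int by (cases "x \<le> y") (simp_all add: max_def power2_eq_square field_simps)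
qed

definition step_mean :: "real measure \<Rightarrow> real \<Rightarrow> real" where
  "step_mean M t = (LINT x|M. step_kernel x t)"

definition pair_energy :: "real measure \<Rightarrow> real measure \<Rightarrow> real" where
  "pair_energy M M' = (LINT z|(M \<Otimes>\<^sub>M M'). green (fst z - snd z))"

lemma borel_measurable_green [measurable]: "green \<in> borel_measurable borel"
  by (intro borel_measurable_continuous_onI continuous_green)

lemma measurable_step_kernel1: "(\<lambda>x. step_kernel x t) \<in> borel_measurable borel"
  by measurable

lemma step_mean_bound:
  assumes M: "torus_prob M"
  shows "\<bar>step_mean M t\<bar> \<le> 1"
proof -
  interpret M: prob_space M using M by (simp add: torus_prob_def)
  have "norm (LINT x|M. step_kernel x t) \<le> (LINT x|M. 1)"
    by (rule Bochner_Integration.integral_norm_bound_integral)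
      (use M step_kernel_bound in \<open>auto simp: torus_prob_space intro!: torus_prob_integrable[OF M measurable_step_kernel1]\<close>)
  then show ?thesis by (simp add: step_mean_def M.prob_space)
qed

lemma step_mean_measurable:
  assumes M: "torus_prob M"
  shows "step_mean M \<in> borel_measurable borel"
proof -
  interpret M: prob_space M using M by (simp add: torus_prob_def)
  have idM: "(\<lambda>x. x) \<in> borel_measurable M"
    using M by (rule torus_prob_measurable) simp
  have "(\<lambda>z. step_kernel (snd z) (fst z)) \<in> borel_measurable (borel \<Otimes>\<^sub>M M)"
    by (rule step_kernel_measurable[OF measurable_compose[OF measurable_snd idM] measurable_fst])
  then have "case_prod (\<lambda>t x. step_kernel x t) \<in> borel_measurable (borel \<Otimes>\<^sub>M M)"
    by (simp add: split_beta')
  then have "(\<lambda>t. LINT x|M. step_kernel x t) \<in> borel_measurable borel"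
    by (rule M.borel_measurable_lebesgue_integral)
  then show ?thesis by (simp add: step_mean_def[abs_def])
qed

lemma pair_measurable:
  assumes "torus_prob M" "torus_prob M'"
  shows "fst \<in> borel_measurable (M \<Otimes>\<^sub>M M')" "snd \<in> borel_measurable (M \<Otimes>\<^sub>M M')"
  using measurable_compose[OF measurable_fst torus_prob_measurable[OF assms(1), of "\<lambda>x. x"], of M']
    measurable_compose[OF measurable_snd torus_prob_measurable[OF assms(2), of "\<lambda>x. x"], of M]
  by simp_all

lemma pair_integrable:
  fixes f :: "real \<times> real \<Rightarrow> real"
  assumes M: "torus_prob M" and M': "torus_prob M'" and f: "f \<in> borel_measurable (M \<Otimes>\<^sub>M M')"
    and B: "\<And>x y. 0 \<le> x \<Longrightarrow> x < 1 \<Longrightarrow> 0 \<le> y \<Longrightarrow> y < 1 \<Longrightarrow> \<bar>f (x, y)\<bar> \<le> B"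
  shows "integrable (M \<Otimes>\<^sub>M M') f"
proof -
  interpret M: prob_space M using M by (simp add: torus_prob_def)
  interpret M': prob_space M' using M' by (simp add: torus_prob_def)
  interpret P: pair_prob_space M M' ..
  show ?thesis
    by (rule P.integrable_const_bound[of _ B])
      (use f B in \<open>auto simp: space_pair_measure torus_prob_space[OF M] torus_prob_space[OF M'] intro!: AE_I2\<close>)
qed

lemma pair_energy_iterated:
  assumes M: "torus_prob M" and M': "torus_prob M'"
  shows "pair_energy M M' = (LINT x|M. LINT y|M'. green (x - y))"
proof -
  interpret M: prob_space M using M by (simp add: torus_prob_def)
  interpret M': prob_space M' using M' by (simp add: torus_prob_def)
  interpret P: pair_prob_space M M' ..
  have "integrable (M \<Otimes>\<^sub>M M') (\<lambda>z. green (fst z - snd z))"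
  proof (rule pair_integrable[OF M M'])
    show "(\<lambda>z. green (fst z - snd z)) \<in> borel_measurable (M \<Otimes>\<^sub>M M')"
      by (rule measurable_compose[OF borel_measurable_diff[OF pair_measurable[OF M M']] borel_measurable_green])
    show "\<bar>green (fst (x, y) - snd (x, y))\<bar> \<le> 1" for x y
      using green_bounds[of "x - y"] by simp
  qed
  from P.integral_fst'[OF this] show ?thesis
    by (simp add: pair_energy_def)
qed

theorem pair_energy_eq:
  assumes M: "torus_prob M" and M': "torus_prob M'"
  shows "pair_energy M M' = (LINT t|torus. step_mean M t * step_mean M' t)
    + (LINT x|M. (x\<^sup>2 - x) / 2) + (LINT x|M'. (x\<^sup>2 - x) / 2)"
proof -
  interpret M: prob_space M using M by (simp add: torus_prob_def)
  interpret M': prob_space M' using M' by (simp add: torus_prob_def)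
  interpret P: pair_prob_space M M' ..
  interpret PT: pair_prob_space "M \<Otimes>\<^sub>M M'" torus ..
  have sp: "space (M \<Otimes>\<^sub>M M') = {0..<1} \<times> {0..<1}"
    by (simp add: space_pair_measure torus_prob_space M M')
  define q where "q x = (x\<^sup>2 - x) / 2" for x :: real
  have qm: "q \<in> borel_measurable borel" unfolding q_def by measurable
  have qb: "\<bar>q x\<bar> \<le> 1" if "0 \<le> x" "x < 1" for x
  proof -
    have "0 \<le> x * x" "x * x \<le> 1" using that mult_mono[of x 1 x 1] by auto
    then have "- 1 \<le> (x * x - x) / 2" "(x * x - x) / 2 \<le> 1"
      using that by (simp_all, linarith+)
    then show ?thesis by (simp add: q_def power2_eq_square abs_le_iff)
  qed
  have "integrable (M \<Otimes>\<^sub>M M') (\<lambda>z. q (fst z))"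
  proof (rule pair_integrable[OF M M'])
    show "(\<lambda>z. q (fst z)) \<in> borel_measurable (M \<Otimes>\<^sub>M M')"
      by (rule measurable_compose[OF pair_measurable(1)[OF M M'] qm])
    show "\<bar>q (fst (x, y))\<bar> \<le> 1" if "0 \<le> x" "x < 1" for x y
      using qb[OF that] by simp
  qed
  moreover have "integrable (M \<Otimes>\<^sub>M M') (\<lambda>z. q (snd z))"
  proof (rule pair_integrable[OF M M'])
    show "(\<lambda>z. q (snd z)) \<in> borel_measurable (M \<Otimes>\<^sub>M M')"
      by (rule measurable_compose[OF pair_measurable(2)[OF M M'] qm])
    show "\<bar>q (snd (x, y))\<bar> \<le> 1" if "0 \<le> y" "y < 1" for x y
      using qb[OF that] by simp
  qed
  ultimately have qi: "integrable (M \<Otimes>\<^sub>M M') (\<lambda>z. q (fst z))" "integrable (M \<Otimes>\<^sub>M M') (\<lambda>z. q (snd z))"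
    by blast+
  have q1: "(LINT z|(M \<Otimes>\<^sub>M M'). q (fst z)) = (LINT x|M. q x)"
    using P.integral_fst'[OF qi(1)] by (simp add: M'.prob_space)
  have q2: "(LINT z|(M \<Otimes>\<^sub>M M'). q (snd z)) = (LINT x|M'. q x)"
    using P.integral_fst'[OF qi(2)] by (simp add: M.prob_space)
  define F where "F z t = step_kernel (fst z) t * step_kernel (snd z) t" for z t
  have idm: "(\<lambda>t. t) \<in> borel_measurable torus"
    by (rule measurable_torus_borel) simp
  have 1: "snd \<in> borel_measurable ((M \<Otimes>\<^sub>M M') \<Otimes>\<^sub>M torus)"
    using measurable_compose[OF measurable_snd idm] by simp
  have 2: "(\<lambda>w. fst (fst w)) \<in> borel_measurable ((M \<Otimes>\<^sub>M M') \<Otimes>\<^sub>M torus)"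
    "(\<lambda>w. snd (fst w)) \<in> borel_measurable ((M \<Otimes>\<^sub>M M') \<Otimes>\<^sub>M torus)"
    by (rule measurable_compose[OF measurable_fst pair_measurable(1)[OF M M']])
      (rule measurable_compose[OF measurable_fst pair_measurable(2)[OF M M']])
  have Fb: "\<bar>F z t\<bar> \<le> 1" if "z \<in> {0..<1} \<times> {0..<1}" for z t
    using that step_kernel_bound[of "fst z" t] step_kernel_bound[of "snd z" t]
      mult_mono[of "\<bar>step_kernel (fst z) t\<bar>" 1 "\<bar>step_kernel (snd z) t\<bar>" 1]
    by (auto simp: F_def abs_mult)
  have "(\<lambda>w. F (fst w) (snd w)) \<in> borel_measurable ((M \<Otimes>\<^sub>M M') \<Otimes>\<^sub>M torus)"
    unfolding F_def by (intro borel_measurable_times step_kernel_measurable 1 2)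
  then have Fi: "integrable ((M \<Otimes>\<^sub>M M') \<Otimes>\<^sub>M torus) (case_prod F)"
    by (intro PT.integrable_const_bound[of _ 1])
      (use Fb in \<open>auto simp: split_beta' space_pair_measure torus_prob_space M M' intro!: AE_I2\<close>)
  have Ft: "(LINT z|(M \<Otimes>\<^sub>M M'). F z t) = step_mean M t * step_mean M' t" for t
  proof -
    have "integrable (M \<Otimes>\<^sub>M M') (\<lambda>z. F z t)"
    proof (rule pair_integrable[OF M M'])
      show "(\<lambda>z. F z t) \<in> borel_measurable (M \<Otimes>\<^sub>M M')"
        unfolding F_def
        by (intro borel_measurable_times step_kernel_measurable pair_measurable[OF M M'] borel_measurable_const)
      show "\<bar>F (x, y) t\<bar> \<le> 1" if "0 \<le> x" "x < 1" "0 \<le> y" "y < 1" for x y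
        using that by (intro Fb) auto
    qed
    from P.integral_fst'[OF this] show ?thesis
      by (simp add: F_def step_mean_def)
  qed
  have "pair_energy M M' = (LINT z|(M \<Otimes>\<^sub>M M'). (LINT t|torus. F z t) + q (fst z) + q (snd z))"
    unfolding pair_energy_def
    by (rule Bochner_Integration.integral_cong) (auto simp: sp F_def q_def green_eq_step_kernel)
  also have "\<dots> = (LINT z|(M \<Otimes>\<^sub>M M'). (LINT t|torus. F z t)) + (LINT x|M. q x) + (LINT x|M'. q x)"
  proof -
    have "integrable (M \<Otimes>\<^sub>M M') (\<lambda>z. LINT t|torus. F z t)"
      using PT.integrable_fst[OF Fi] by simp
    then show ?thesis using qi by (simp add: q1 q2)
  qed
  also have "(LINT z|(M \<Otimes>\<^sub>M M'). (LINT t|torus. F z t)) = (LINT t|torus. (LINT z|(M \<Otimes>\<^sub>M M'). F z t))"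
    using PT.Fubini_integral[OF Fi] by simp
  finally show ?thesis by (simp add: Ft q_def)
qed

lemma diff_square_integral_eq_pair_energy:
  "diff_square_integral M M' (\<lambda>x y. green (x - y))
     = pair_energy M M - pair_energy M M' - pair_energy M' M + pair_energy M' M'"
  by (simp add: diff_square_integral_def pair_energy_def split_beta')

lemma step_mean_integrable:
  assumes "torus_prob M" "torus_prob M'"
  shows "integrable torus (\<lambda>t. step_mean M t * step_mean M' t)"
proof (rule integrable_torus_bounded[of _ 1])
  show "(\<lambda>t. step_mean M t * step_mean M' t) \<in> borel_measurable torus"
    by (intro measurable_torus_borel borel_measurable_times step_mean_measurable assms)
  show "norm (step_mean M t * step_mean M' t) \<le> 1" for t
    using mult_mono[OF step_mean_bound[OF assms(1), of t] step_mean_bound[OF assms(2), of t]]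
    by (simp add: abs_mult)
qed

text \<open>
  The terms that depend on one measure only cancel between the four summands.
\<close>

theorem diff_square_integral_green:
  assumes M: "torus_prob M" and M': "torus_prob M'"
  shows "diff_square_integral M M' (\<lambda>x y. green (x - y)) = (LINT t|torus. (step_mean M t - step_mean M' t)\<^sup>2)"
proof -
  have "(LINT t|torus. (step_mean M t - step_mean M' t)\<^sup>2)
      = (LINT t|torus. step_mean M t * step_mean M t - step_mean M t * step_mean M' t
          - step_mean M' t * step_mean M t + step_mean M' t * step_mean M' t)"
    by (simp add: power2_eq_square algebra_simps)
  also have "\<dots> = (LINT t|torus. step_mean M t * step_mean M t) - (LINT t|torus. step_mean M t * step_mean M' t)
          - (LINT t|torus. step_mean M' t * step_mean M t) + (LINT t|torus. step_mean M' t * step_mean M' t)"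
    using step_mean_integrable[OF M M] step_mean_integrable[OF M M'] step_mean_integrable[OF M' M]
      step_mean_integrable[OF M' M'] by (simp only: Bochner_Integration.integral_add Bochner_Integration.integral_diff
        Bochner_Integration.integrable_diff)
  finally show ?thesis
    unfolding diff_square_integral_eq_pair_energy by (simp add: pair_energy_eq M M')
qed

section \<open>The energy estimate for a fixed configuration\<close>

definition green_potential :: "(real \<Rightarrow> real) \<Rightarrow> real \<Rightarrow> real" where
  "green_potential g x = (LINT y|torus. green (x - y) * g y)"

lemma green_potential_measurable:
  assumes g: "continuous_on UNIV g"
  shows "green_potential g \<in> borel_measurable borel"
proof -
  have idm: "(\<lambda>t. t) \<in> borel_measurable torus"
    by (rule measurable_torus_borel) simp
  have "(\<lambda>z. green (fst z - snd z) * g (snd z)) \<in> borel_measurable (borel \<Otimes>\<^sub>M torus)"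
    by (intro borel_measurable_times measurable_compose[OF _ borel_measurable_green] borel_measurable_diff
        measurable_fst measurable_compose[OF measurable_snd idm]
        measurable_compose[OF measurable_snd continuous_measurable_torus[OF g]])
  then have "case_prod (\<lambda>x y. green (x - y) * g y) \<in> borel_measurable (borel \<Otimes>\<^sub>M torus)"
    by (simp add: split_beta')
  then show ?thesis
    unfolding green_potential_def[abs_def] by (rule torus.borel_measurable_lebesgue_integral)
qed

lemma integral_mult_green_potential:
  assumes f: "continuous_on UNIV f" "\<And>x. 0 \<le> f x" "(LINT x|torus. f x) = 1"
    and g: "continuous_on UNIV g" "\<And>x. 0 \<le> g x" "(LINT x|torus. g x) = 1"
  shows "integrable torus (\<lambda>x. f x * green_potential g x)"
    and "(LINT x|torus. f x * green_potential g x)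
      = pair_energy (density torus (\<lambda>x. ennreal (f x))) (density torus (\<lambda>x. ennreal (g x)))"
proof -
  have cg: "continuous_on UNIV (\<lambda>y. green (x - y))" for x
    by (intro continuous_intros)
  have inner: "(LINT y|density torus (\<lambda>x. ennreal (g x)). green (x - y)) = green_potential g x" for x
    using integral_density_torus[OF g(1,2) continuous_measurable_torus[OF cg]]
    by (simp add: green_potential_def mult.commute)
  show "(LINT x|torus. f x * green_potential g x)
      = pair_energy (density torus (\<lambda>x. ennreal (f x))) (density torus (\<lambda>x. ennreal (g x)))"
    unfolding pair_energy_iterated[OF torus_prob_density[OF f] torus_prob_density[OF g]] inner
    using integral_density_torus[OF f(1,2) measurable_torus_borel[OF green_potential_measurable[OF g(1)]]] by simp
  have bound: "\<bar>green_potential g x\<bar> \<le> 1" for x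
  proof -
    have "norm (green_potential g x) \<le> (LINT y|torus. g y)"
      unfolding green_potential_def
    proof (rule Bochner_Integration.integral_norm_bound_integral)
      show "integrable torus (\<lambda>y. green (x - y) * g y)" "integrable torus g"
        using g(1) by (intro integrable_torus_continuous continuous_intros; simp)+
      show "norm (green (x - y) * g y) \<le> g y" for y
        using green_bounds[of "x - y"] g(2)[of y] mult_right_mono[of "\<bar>green (x - y)\<bar>" 1 "g y"]
        by (simp add: abs_mult)
    qed
    then show ?thesis by (simp add: g(3))
  qed
  then show "integrable torus (\<lambda>x. f x * green_potential g x)"
    by (intro integrable_torus_mult_bounded[OF f(1) measurable_torus_borel[OF green_potential_measurable[OF g(1)]]])
qed

lemma integral_mult_mean_green:
  assumes f: "continuous_on UNIV f" "\<And>x. 0 \<le> f x" "(LINT x|torus. f x) = 1"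
    and "N > 0" and X: "\<And>j. j < N \<Longrightarrow> X j \<in> {0..<1}"
  shows "(LINT x|torus. f x * mean_green N X x)
      = pair_energy (density torus (\<lambda>x. ennreal (f x))) (empirical N X)"
proof -
  have "continuous_on UNIV (\<lambda>y. green (x - y))" for x
    by (intro continuous_intros)
  then have inner: "(LINT y|empirical N X. green (x - y)) = mean_green N X x" for x
    unfolding mean_green_def using X by (intro integral_empirical continuous_measurable_torus)
  have "torus_prob (empirical N X)"
    using assms(4) X by (rule torus_prob_empirical)
  from pair_energy_iterated[OF torus_prob_density[OF f] this]
  have "pair_energy (density torus (\<lambda>x. ennreal (f x))) (empirical N X)
      = (LINT x|density torus (\<lambda>x. ennreal (f x)). mean_green N X x)"
    by (simp only: inner)
  then show ?thesis
    using integral_density_torus[OF f(1,2) continuous_measurable_torus[OF continuous_mean_green[of N X]]] by simp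
qed

lemma step_mean_density:
  assumes f: "continuous_on UNIV f" "\<And>x. 0 \<le> f x"
  shows "step_mean (density torus (\<lambda>x. ennreal (f x))) t = (LINT x|torus. f x * step_kernel x t)"
  unfolding step_mean_def
  by (rule integral_density_torus[OF f measurable_torus_borel[OF measurable_step_kernel1]])

lemma integrable_mult_step_kernel:
  "continuous_on UNIV f \<Longrightarrow> integrable torus (\<lambda>x. f x * step_kernel x t)"
  by (rule integrable_torus_mult_bounded[OF _ measurable_torus_borel[OF measurable_step_kernel1] step_kernel_bound])

definition step_distance :: "real measure \<Rightarrow> real measure \<Rightarrow> real" where
  "step_distance M M' = (LINT t|torus. (step_mean M t - step_mean M' t)\<^sup>2)"

lemma entropy_integrand_bounds:
  fixes v v0 :: real
  shows "0 \<le> exp v * (v - v0) - exp v + exp v0"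
    and "exp v * (v - v0) - exp v + exp v0 \<le> (exp v - exp v0) * (v - v0)"
  using exp_diff_bounds(2)[where w = v and z = v0] exp_diff_bounds(1)[where z = v0 and w = v]
  by (simp_all add: left_diff_distrib)

text \<open>
  All measures enter through their normalised distribution functions \<open>a, b, p, s\<close> of \<open>m, \<mu>, \<rho>\<^sub>0, \<rho>\<close>, which
  turns the energies into \<open>L\<^sup>2\<close> products. With \<open>\<eta> = a - p\<close> and \<open>\<sigma> = b - s\<close>, completing the square in
  \<open>\<epsilon> J = \<langle>\<eta>, \<sigma> - \<eta>\<rangle>\<close> bounds it by \<open>\<langle>\<sigma>, \<sigma>\<rangle>/4\<close>. For the interaction energy,
  \<open>b - a = (\<sigma> - \<eta>) + (s - p)\<close>, where \<open>\<bar>s - p\<bar> \<le> \<epsilon> B\<close> because \<open>\<rho> - \<rho>\<^sub>0 = - \<epsilon> V\<^sub>0''\<close>, and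
  \<open>(\<sigma> - \<eta>)\<^sup>2 \<le> \<sigma>\<^sup>2 - 2 \<eta> (\<sigma> - \<eta>)\<close>, whose last term integrates to \<open>- 2 \<epsilon> J \<le> 0\<close>.
\<close>

theorem energy_bounds:
  fixes \<rho>\<^sub>0 V\<^sub>0 V1 V2 :: "real \<Rightarrow> real"
  assumes "N > 0" "\<epsilon> > 0" and X: "\<And>j. j < N \<Longrightarrow> X j \<in> {0..<1}"
    and V0: "\<And>x. (V\<^sub>0 has_real_derivative V1 x) (at x)" "\<And>x. (V1 has_real_derivative V2 x) (at x)"
      "continuous_on UNIV V2" "periodic V\<^sub>0"
    and mass0: "(LINT x|torus. exp (V\<^sub>0 x)) = 1"
    and r_pos: "\<And>x. 0 < exp (V\<^sub>0 x) - \<epsilon> * V2 x"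
    and B: "\<And>x. 0 \<le> x \<Longrightarrow> x < 1 \<Longrightarrow> \<bar>V2 x\<bar> \<le> B"
  defines "m \<equiv> mb_density \<epsilon> N X" and "\<mu> \<equiv> empirical N X"
    and "\<rho> \<equiv> density torus (\<lambda>x. ennreal (exp (V\<^sub>0 x) - \<epsilon> * V2 x))"
  shows "0 \<le> diff_square_integral \<mu> (density torus (\<lambda>x. ennreal (m x))) (\<lambda>x y. green (x - y))"
    and "diff_square_integral \<mu> (density torus (\<lambda>x. ennreal (m x))) (\<lambda>x y. green (x - y))
      \<le> 2 * step_distance \<mu> \<rho> + 2 * (\<epsilon> * B)\<^sup>2"
    and "0 \<le> (LINT x|torus. m x * ln (m x / exp (V\<^sub>0 x)) - m x + exp (V\<^sub>0 x))"
    and "(LINT x|torus. m x * ln (m x / exp (V\<^sub>0 x)) - m x + exp (V\<^sub>0 x)) \<le> step_distance \<mu> \<rho> / (4 * \<epsilon>)"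
proof -
  define V where "V = potential \<epsilon> N X"
  define r0 r where "r0 x = exp (V\<^sub>0 x)" and "r x = exp (V\<^sub>0 x) - \<epsilon> * V2 x" for x
  have mV: "m = (\<lambda>x. exp (V x))"
    by (simp add: m_def mb_density_def[abs_def] V_def)
  note rep = potential_representation[where N = N and X = X, OF assms(1,2) X, folded V_def]
  have V: "continuous_on UNIV V" and mass: "(LINT x|torus. exp (V x)) = 1" using rep by auto
  obtain c where c: "\<And>x. \<epsilon> * V x = mean_green N X x - (LINT y|torus. green (x - y) * exp (V y)) + c"
    using rep(3) by blast
  have cV0: "continuous_on UNIV V\<^sub>0" and V1p: "periodic V1"
    using V0 DERIV_imp_continuous_on periodic_deriv by blast+
  have m: "continuous_on UNIV m" "\<And>x. 0 \<le> m x" "(LINT x|torus. m x) = 1"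
    unfolding mV using V mass by (auto intro!: continuous_intros)
  have r0: "continuous_on UNIV r0" "\<And>x. 0 \<le> r0 x" "(LINT x|torus. r0 x) = 1"
    unfolding r0_def[abs_def] using cV0 mass0 by (auto intro!: continuous_intros)
  have r: "continuous_on UNIV r" "\<And>x. 0 \<le> r x" "(LINT x|torus. r x) = 1"
  proof -
    show "continuous_on UNIV r" unfolding r_def[abs_def] using cV0 V0(3) by (intro continuous_intros)
    show "0 \<le> r x" for x using r_pos[of x] by (simp add: r_def)
    have "(LINT x|torus. r x) = (LINT x|torus. exp (V\<^sub>0 x)) - (LINT x|torus. \<epsilon> * V2 x)"
      unfolding r_def using cV0 V0(3)
      by (intro Bochner_Integration.integral_diff integrable_torus_continuous continuous_intros)
    then show "(LINT x|torus. r x) = 1"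
      using torus_integral_deriv_periodic[OF V0(2,3) V1p] mass0 by simp
  qed
  let ?D = "\<lambda>f. density torus (\<lambda>x. ennreal (f x))"
  have \<rho>: "\<rho> = ?D r" by (simp add: \<rho>_def r_def)
  note tm = torus_prob_density[OF m] and tr0 = torus_prob_density[OF r0] and tr = torus_prob_density[OF r]
    and t\<mu> = torus_prob_empirical[where N = N and X = X, OF assms(1) X, folded \<mu>_def]
  define a b p s where "a = step_mean (?D m)" and "b = step_mean \<mu>" and "p = step_mean (?D r0)" and "s = step_mean (?D r)"
  have int: "integrable torus (\<lambda>t. step_mean M t * step_mean M' t)" if "M \<in> {?D m, \<mu>, ?D r0, ?D r}" "M' \<in> {?D m, \<mu>, ?D r0, ?D r}" for M M'
    using that tm tr0 tr t\<mu> by (intro step_mean_integrable) auto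
  have abps: "integrable torus (\<lambda>t. f t * g t)" if "f \<in> {a, b, p, s}" "g \<in> {a, b, p, s}" for f g
    using that int unfolding a_def b_def p_def s_def by auto
  have V0_rep: "\<epsilon> * V\<^sub>0 x = green_potential r x - green_potential r0 x + \<epsilon> * (LINT y|torus. V\<^sub>0 y)" for x
  proof -
    have "green_potential r x - green_potential r0 x = (LINT y|torus. green (x - y) * r y - green (x - y) * r0 y)"
      unfolding green_potential_def using r(1) r0(1)
      by (intro Bochner_Integration.integral_diff[symmetric] integrable_torus_continuous continuous_intros)
    also have "\<dots> = (LINT y|torus. - \<epsilon> * (green (y - x) * V2 y))"
      by (intro Bochner_Integration.integral_cong) (simp_all add: r_def r0_def green_commute[of x] algebra_simps)
    also have "\<dots> = - \<epsilon> * ((LINT y|torus. V\<^sub>0 y) - V\<^sub>0 x)"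
      by (simp only: integral_mult_right_zero green_second_derivative[OF V0])
    finally show ?thesis by (simp add: algebra_simps)
  qed
  define J where "J = (LINT x|torus. (m x - r0 x) * (V x - V\<^sub>0 x))"
  \<comment> \<open>Since \<open>\<epsilon> V = green * (\<mu> - m) + c\<close> and \<open>\<epsilon> V\<^sub>0 = green * (\<rho> - r0) + c'\<close>, the integral \<open>\<epsilon> J\<close> is the
    pairing of \<open>m - r0\<close> with \<open>(\<mu> - \<rho>) - (m - r0)\<close>.\<close>
  have J: "\<epsilon> * J = (LINT t|torus. (a t - p t) * ((b t - s t) - (a t - p t)))"
  proof -
    define k where "k = c - \<epsilon> * (LINT y|torus. V\<^sub>0 y)"
    have diff: "\<epsilon> * (V x - V\<^sub>0 x) = mean_green N X x - green_potential m x - green_potential r x + green_potential r0 x + k" for x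
      using c[of x] V0_rep[of x] by (simp add: k_def green_potential_def mV right_diff_distrib)
    have i: "integrable torus (\<lambda>x. f x * mean_green N X x)" "integrable torus f" if "continuous_on UNIV f" for f
      using that continuous_mean_green by (intro integrable_torus_continuous continuous_intros; simp)+
    note im = integral_mult_green_potential[OF m] and ir = integral_mult_green_potential[OF r0]
    have "\<epsilon> * J = (LINT x|torus. (m x - r0 x) * (\<epsilon> * (V x - V\<^sub>0 x)))"
      unfolding J_def by (simp add: mult.left_commute)
    also have "\<dots> = (LINT x|torus. m x * mean_green N X x - m x * green_potential m x - m x * green_potential r x
        + m x * green_potential r0 x + k * m x - r0 x * mean_green N X x + r0 x * green_potential m x
        + r0 x * green_potential r x - r0 x * green_potential r0 x - k * r0 x)"
      by (intro Bochner_Integration.integral_cong refl) (simp only: diff, simp add: algebra_simps)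
    also have "\<dots> = pair_energy (?D m) \<mu> - pair_energy (?D m) (?D m) - pair_energy (?D m) (?D r)
        + pair_energy (?D m) (?D r0) + k - pair_energy (?D r0) \<mu> + pair_energy (?D r0) (?D m)
        + pair_energy (?D r0) (?D r) - pair_energy (?D r0) (?D r0) - k"
      using i[OF m(1)] i[OF r0(1)] im(1)[OF m] im(1)[OF r] im(1)[OF r0] ir(1)[OF m] ir(1)[OF r] ir(1)[OF r0]
        im(2)[OF m] im(2)[OF r] im(2)[OF r0] ir(2)[OF m] ir(2)[OF r] ir(2)[OF r0]
        integral_mult_mean_green[where N = N and X = X, OF m assms(1) X] integral_mult_mean_green[where N = N and X = X, OF r0 assms(1) X] m(3) r0(3)
      by (simp add: \<mu>_def)
    also have "\<dots> = (LINT t|torus. a t * b t) - (LINT t|torus. a t * a t) - (LINT t|torus. a t * s t)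
        + (LINT t|torus. a t * p t) - (LINT t|torus. p t * b t) + (LINT t|torus. p t * a t)
        + (LINT t|torus. p t * s t) - (LINT t|torus. p t * p t)"
      by (simp add: pair_energy_eq tm tr tr0 t\<mu> a_def b_def p_def s_def)
    also have "\<dots> = (LINT t|torus. a t * b t - a t * a t - a t * s t + a t * p t - p t * b t + p t * a t
        + p t * s t - p t * p t)"
      using abps by (simp add: mult.commute)
    also have "\<dots> = (LINT t|torus. (a t - p t) * ((b t - s t) - (a t - p t)))"
      by (simp add: algebra_simps)
    finally show ?thesis .
  qed
  have S: "step_distance \<mu> \<rho> = (LINT t|torus. (b t - s t)\<^sup>2)"
    by (simp add: step_distance_def b_def s_def \<rho>)
  have sq: "integrable torus (\<lambda>t. (f t - g t)\<^sup>2)" if "f \<in> {a, b, p, s}" "g \<in> {a, b, p, s}" for f g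
  proof -
    have "(f t - g t)\<^sup>2 = f t * f t - f t * g t - g t * f t + g t * g t" for t
      by (simp add: power2_eq_square algebra_simps)
    then show ?thesis
      using abps[OF that(1) that(1)] abps[OF that(1) that(2)] abps[OF that(2) that(1)] abps[OF that(2) that(2)]
      by simp
  qed
  have iS: "integrable torus (\<lambda>t. (b t - s t)\<^sup>2)"
    by (rule sq) simp_all
  have iJ: "integrable torus (\<lambda>t. (a t - p t) * ((b t - s t) - (a t - p t)))"
  proof -
    have "(a t - p t) * ((b t - s t) - (a t - p t)) = a t * b t - a t * a t - a t * s t + a t * p t
        - p t * b t + p t * a t + p t * s t - p t * p t" for t
      by (simp add: algebra_simps)
    then show ?thesis using abps by simp
  qed
  have "J \<ge> 0"
    unfolding J_def
  proof (intro Bochner_Integration.integral_nonneg)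
    fix x
    show "0 \<le> (m x - r0 x) * (V x - V\<^sub>0 x)"
      using entropy_integrand_bounds[of "V x" "V\<^sub>0 x"] by (simp add: mV r0_def)
  qed
  have JS: "\<epsilon> * J \<le> step_distance \<mu> \<rho> / 4"
  proof -
    have "\<epsilon> * J \<le> (LINT t|torus. (b t - s t)\<^sup>2 / 4)"
      unfolding J
    proof (rule integral_mono[OF iJ])
      show "integrable torus (\<lambda>t. (b t - s t)\<^sup>2 / 4)" using iS by simp
      fix t
      have "0 \<le> ((b t - s t) - 2 * (a t - p t))\<^sup>2" by simp
      then show "(a t - p t) * ((b t - s t) - (a t - p t)) \<le> (b t - s t)\<^sup>2 / 4"
        by (simp add: power2_eq_square algebra_simps)
    qed
    then show ?thesis by (simp add: S)
  qed
  have m_int: "m x * ln (m x / exp (V\<^sub>0 x)) - m x + exp (V\<^sub>0 x) = exp (V x) * (V x - V\<^sub>0 x) - exp (V x) + exp (V\<^sub>0 x)" for x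
    by (simp add: mV exp_diff[symmetric])
  show "0 \<le> (LINT x|torus. m x * ln (m x / exp (V\<^sub>0 x)) - m x + exp (V\<^sub>0 x))"
    unfolding m_int by (intro Bochner_Integration.integral_nonneg entropy_integrand_bounds)
  have "(LINT x|torus. m x * ln (m x / exp (V\<^sub>0 x)) - m x + exp (V\<^sub>0 x)) \<le> J"
    unfolding m_int J_def
  proof (rule integral_mono)
    show "integrable torus (\<lambda>x. exp (V x) * (V x - V\<^sub>0 x) - exp (V x) + exp (V\<^sub>0 x))"
      using V cV0 by (intro integrable_torus_continuous continuous_intros)
    show "integrable torus (\<lambda>x. (m x - r0 x) * (V x - V\<^sub>0 x))"
      using V cV0 m(1) r0(1) by (intro integrable_torus_continuous continuous_intros)
    show "exp (V x) * (V x - V\<^sub>0 x) - exp (V x) + exp (V\<^sub>0 x) \<le> (m x - r0 x) * (V x - V\<^sub>0 x)" for x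
      using entropy_integrand_bounds(2)[of "V x" "V\<^sub>0 x"] by (simp add: mV r0_def)
  qed
  also have "J \<le> step_distance \<mu> \<rho> / (4 * \<epsilon>)"
    using JS \<open>\<epsilon> > 0\<close> by (simp add: field_simps)
  finally show "(LINT x|torus. m x * ln (m x / exp (V\<^sub>0 x)) - m x + exp (V\<^sub>0 x)) \<le> step_distance \<mu> \<rho> / (4 * \<epsilon>)" .
  have D: "diff_square_integral \<mu> (?D m) (\<lambda>x y. green (x - y)) = (LINT t|torus. (b t - a t)\<^sup>2)"
    by (simp add: diff_square_integral_green t\<mu> tm a_def b_def)
  show "0 \<le> diff_square_integral \<mu> (?D m) (\<lambda>x y. green (x - y))"
    unfolding D by (intro Bochner_Integration.integral_nonneg) simp
  have sp: "\<bar>s t - p t\<bar> \<le> \<epsilon> * B" for t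
  proof -
    have i: "integrable torus (\<lambda>x. f x * step_kernel x t)" if "continuous_on UNIV f" for f
      using that by (rule integrable_mult_step_kernel)
    have "s t - p t = (LINT x|torus. r x * step_kernel x t) - (LINT x|torus. r0 x * step_kernel x t)"
      by (simp add: s_def p_def step_mean_density[OF r(1,2)] step_mean_density[OF r0(1,2)])
    also have "\<dots> = (LINT x|torus. r x * step_kernel x t - r0 x * step_kernel x t)"
      using i[OF r(1)] i[OF r0(1)] by simp
    also have "\<dots> = (LINT x|torus. - \<epsilon> * (V2 x * step_kernel x t))"
      by (intro Bochner_Integration.integral_cong) (simp_all add: r_def r0_def algebra_simps)
    also have "norm \<dots> \<le> (LINT x|torus. \<epsilon> * B)"
    proof (rule Bochner_Integration.integral_norm_bound_integral)
      show "integrable torus (\<lambda>x. - \<epsilon> * (V2 x * step_kernel x t))"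
        using i[OF V0(3)] by simp
      fix x assume "x \<in> space torus"
      then have x: "0 \<le> x" "x < 1" by auto
      have "0 \<le> B" using B[OF x] by simp
      then have "\<bar>V2 x\<bar> * \<bar>step_kernel x t\<bar> \<le> B * 1"
        using B[OF x] step_kernel_bound[OF x, of t] by (intro mult_mono) auto
      then show "norm (- \<epsilon> * (V2 x * step_kernel x t)) \<le> \<epsilon> * B"
        using \<open>\<epsilon> > 0\<close> by (simp add: abs_mult)
    qed simp
    finally show ?thesis by simp
  qed
  have "(LINT t|torus. (b t - a t)\<^sup>2)
      \<le> (LINT t|torus. 2 * (b t - s t)\<^sup>2 - 4 * ((a t - p t) * ((b t - s t) - (a t - p t))) + 2 * (\<epsilon> * B)\<^sup>2)"
  proof (rule integral_mono)
    show "integrable torus (\<lambda>t. (b t - a t)\<^sup>2)"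
      by (rule sq) simp_all
    show "integrable torus (\<lambda>t. 2 * (b t - s t)\<^sup>2 - 4 * ((a t - p t) * ((b t - s t) - (a t - p t))) + 2 * (\<epsilon> * B)\<^sup>2)"
      using iS iJ by simp
    fix t
    define \<sigma> \<eta> \<nu> where "\<sigma> = b t - s t" and "\<eta> = a t - p t" and "\<nu> = s t - p t"
    have "\<nu>\<^sup>2 \<le> (\<epsilon> * B)\<^sup>2"
      using power_mono[OF sp[of t], of 2] by (simp add: \<nu>_def)
    moreover have "b t - a t = (\<sigma> - \<eta>) + \<nu>" by (simp add: \<sigma>_def \<eta>_def \<nu>_def)
    moreover have "((\<sigma> - \<eta>) + \<nu>)\<^sup>2 \<le> 2 * (\<sigma> - \<eta>)\<^sup>2 + 2 * \<nu>\<^sup>2"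
      using zero_le_power2[of "\<sigma> - \<eta> - \<nu>"] by (simp add: power2_eq_square algebra_simps)
    moreover have "(\<sigma> - \<eta>)\<^sup>2 \<le> \<sigma>\<^sup>2 - 2 * (\<eta> * (\<sigma> - \<eta>))"
      by (simp add: power2_eq_square algebra_simps)
    ultimately show "(b t - a t)\<^sup>2 \<le> 2 * (b t - s t)\<^sup>2 - 4 * ((a t - p t) * ((b t - s t) - (a t - p t))) + 2 * (\<epsilon> * B)\<^sup>2"
      unfolding \<sigma>_def[symmetric] \<eta>_def[symmetric] by simp
  qed
  also have "\<dots> = 2 * step_distance \<mu> \<rho> - 4 * (\<epsilon> * J) + 2 * (\<epsilon> * B)\<^sup>2"
    using iS iJ by (simp add: S J)
  also have "\<dots> \<le> 2 * step_distance \<mu> \<rho> + 2 * (\<epsilon> * B)\<^sup>2"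
    using \<open>J \<ge> 0\<close> \<open>\<epsilon> > 0\<close> by simp
  finally show "diff_square_integral \<mu> (?D m) (\<lambda>x y. green (x - y))
      \<le> 2 * step_distance \<mu> \<rho> + 2 * (\<epsilon> * B)\<^sup>2"
    unfolding D .
qed

section \<open>Averages over independent particles\<close>

interpretation torus_product: product_sigma_finite "\<lambda>_::nat. torus"
  by unfold_locales

lemma prob_space_torus_pow: "prob_space (torus_pow N)"
  unfolding torus_pow_def by (rule prob_space_PiM) (rule prob_space_torus)

lemma space_torus_pow: "X \<in> space (torus_pow N) \<Longrightarrow> j < N \<Longrightarrow> X j \<in> {0..<1}"
  by (auto simp: torus_pow_def space_PiM PiE_def Pi_def)

lemma measurable_torus_pow_component:
  "j < N \<Longrightarrow> f \<in> borel_measurable torus \<Longrightarrow> (\<lambda>X. f (X j)) \<in> borel_measurable (torus_pow N)"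
  unfolding torus_pow_def by (rule measurable_compose[OF measurable_component_singleton]) auto

lemma
  fixes f :: "nat \<Rightarrow> real \<Rightarrow> 'a::{real_normed_field, banach, second_countable_topology}"
  assumes "\<And>j. j < N \<Longrightarrow> integrable torus (f j)"
  shows integrable_torus_pow_prod: "integrable (torus_pow N) (\<lambda>X. \<Prod>j<N. f j (X j))"
    and integral_torus_pow_prod: "(LINT X|torus_pow N. (\<Prod>j<N. f j (X j))) = (\<Prod>j<N. LINT x|torus. f j x)"
  unfolding torus_pow_def using assms
  by (intro torus_product.product_integrable_prod torus_product.product_integral_prod; simp)+

lemma prod_update_factor:
  fixes c d :: "nat \<Rightarrow> 'a::comm_monoid_mult"
  assumes "j < N"
  shows "(\<Prod>k<N. c k * (if k = j then d k else 1)) = d j * (\<Prod>k<N. c k)"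
  using assms by (simp add: prod.distrib mult.commute)

text \<open>The variance of a sum of independent centred variables is the sum of the variances: all products
  of distinct factors average to zero.\<close>

lemma integral_square_sum_independent:
  fixes h r :: "real \<Rightarrow> real"
  assumes r: "continuous_on UNIV r" "(LINT x|torus. r x) = 1"
    and h: "h \<in> borel_measurable torus" "\<And>x. 0 \<le> x \<Longrightarrow> x < 1 \<Longrightarrow> \<bar>h x\<bar> \<le> C"
    and centred: "(LINT x|torus. r x * h x) = 0"
  shows "(LINT X|torus_pow N. (\<Sum>j<N. h (X j))\<^sup>2 * (\<Prod>k<N. r (X k))) = real N * (LINT x|torus. r x * (h x)\<^sup>2)"
proof -
  define w where "w n x = r x * h x ^ n" for n :: nat and x
  have w: "integrable torus (w n)" for n
    unfolding w_def
  proof (rule integrable_torus_mult_bounded[OF r(1)])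
    show "(\<lambda>x. h x ^ n) \<in> borel_measurable torus"
      using h(1) by (rule borel_measurable_power)
    show "\<bar>h x ^ n\<bar> \<le> C ^ n" if "0 \<le> x" "x < 1" for x
      unfolding power_abs using h(2)[OF that] by (intro power_mono) auto
  qed
  \<comment> \<open>The exponent of \<open>h (X k)\<close> in the product of \<open>h (X i)\<close> and \<open>h (X j)\<close>.\<close>
  define e where "e i j k = (if k = i then 1 else 0) + (if k = j then 1 else 0 :: nat)" for i j k :: nat
  have pairing: "h (X i) * h (X j) * (\<Prod>k<N. r (X k)) = (\<Prod>k<N. w (e i j k) (X k))" if "i < N" "j < N" for i j X
  proof -
    have "w (e i j k) (X k) = (r (X k) * (if k = i then h (X k) else 1)) * (if k = j then h (X k) else 1)" for k
      by (simp add: w_def e_def)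
    then show ?thesis
      using prod_update_factor[OF that(2), of "\<lambda>k. r (X k) * (if k = i then h (X k) else 1)" "\<lambda>k. h (X k)"]
        prod_update_factor[OF that(1), of "\<lambda>k. r (X k)" "\<lambda>k. h (X k)"]
      by (simp add: mult_ac)
  qed
  have int: "integrable (torus_pow N) (\<lambda>X. h (X i) * h (X j) * (\<Prod>k<N. r (X k)))" if "i < N" "j < N" for i j
    unfolding pairing[OF that] by (intro integrable_torus_pow_prod w)
  have val: "(LINT X|torus_pow N. h (X i) * h (X j) * (\<Prod>k<N. r (X k)))
      = (if i = j then LINT x|torus. r x * (h x)\<^sup>2 else 0)" if ij: "i < N" "j < N" for i j
  proof -
    have "(LINT X|torus_pow N. h (X i) * h (X j) * (\<Prod>k<N. r (X k))) = (\<Prod>k<N. LINT x|torus. w (e i j k) x)"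
      unfolding pairing[OF ij] by (intro integral_torus_pow_prod w)
    also have "\<dots> = (if i = j then LINT x|torus. r x * (h x)\<^sup>2 else 0)"
    proof (cases "i = j")
      case True
      then have "(LINT x|torus. w (e i j k) x) = (if k = j then LINT x|torus. r x * (h x)\<^sup>2 else 1)" for k
        by (simp add: e_def w_def r(2) power2_eq_square)
      then show ?thesis using True ij by simp
    next
      case False
      then have "(LINT x|torus. w (e i j i) x) = 0"
        by (simp add: e_def w_def centred)
      then have "(\<Prod>k<N. LINT x|torus. w (e i j k) x) = 0"
        using ij by (intro prod_zero) auto
      then show ?thesis using False by simp
    qed
    finally show ?thesis .
  qed
  have "(\<Sum>j<N. h (X j))\<^sup>2 * (\<Prod>k<N. r (X k)) = (\<Sum>i<N. \<Sum>j<N. h (X i) * h (X j) * (\<Prod>k<N. r (X k)))" for X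
    by (simp only: power2_eq_square sum_product) (simp only: sum_distrib_right)
  then have "(LINT X|torus_pow N. (\<Sum>j<N. h (X j))\<^sup>2 * (\<Prod>k<N. r (X k)))
      = (LINT X|torus_pow N. (\<Sum>i<N. \<Sum>j<N. h (X i) * h (X j) * (\<Prod>k<N. r (X k))))"
    by (simp only:)
  also have "\<dots> = (\<Sum>i<N. LINT X|torus_pow N. (\<Sum>j<N. h (X i) * h (X j) * (\<Prod>k<N. r (X k))))"
    by (intro Bochner_Integration.integral_sum Bochner_Integration.integrable_sum int) simp_all
  also have "\<dots> = (\<Sum>i<N. \<Sum>j<N. LINT X|torus_pow N. h (X i) * h (X j) * (\<Prod>k<N. r (X k)))"
    by (intro sum.cong refl Bochner_Integration.integral_sum int) simp_all
  also have "\<dots> = (\<Sum>i<N. \<Sum>j<N. if i = j then LINT x|torus. r x * (h x)\<^sup>2 else 0)"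
    by (intro sum.cong refl val) auto
  also have "\<dots> = real N * (LINT x|torus. r x * (h x)\<^sup>2)"
    by simp
  finally show ?thesis .
qed

text \<open>
  For each \<open>t\<close> the difference of the two distribution functions is an average of \<open>N\<close> independent centred
  variables bounded by \<open>2\<close>, so its mean square is at most \<open>4/N\<close>.
\<close>

theorem expected_step_distance:
  fixes r :: "real \<Rightarrow> real"
  assumes "N > 0" and r: "continuous_on UNIV r" "\<And>x. 0 \<le> r x" "(LINT x|torus. r x) = 1"
  defines "\<rho> \<equiv> density torus (\<lambda>x. ennreal (r x))"
  shows "integrable (torus_pow N) (\<lambda>X. step_distance (empirical N X) \<rho> * (\<Prod>k<N. r (X k)))"
    and "(LINT X|torus_pow N. step_distance (empirical N X) \<rho> * (\<Prod>k<N. r (X k))) \<le> 4 / real N"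
proof -
  interpret P: prob_space "torus_pow N" by (rule prob_space_torus_pow)
  interpret PT: pair_prob_space "torus_pow N" torus ..
  have \<rho>: "torus_prob \<rho>" unfolding \<rho>_def by (rule torus_prob_density[OF r])
  obtain B where B: "B > 0" "\<And>x. 0 \<le> x \<Longrightarrow> x \<le> 1 \<Longrightarrow> norm (r x) \<le> B"
    using continuous_bounded_unit[OF r(1)] by blast
  define g where "g x t = step_kernel x t - step_mean \<rho> t" for x t
  have gb: "\<bar>g x t\<bar> \<le> 2" if "0 \<le> x" "x < 1" for x t
    using step_kernel_bound[OF that, of t] step_mean_bound[OF \<rho>, of t] by (simp add: g_def abs_le_iff)
  have gm: "(\<lambda>x. g x t) \<in> borel_measurable torus" for t
    unfolding g_def by (intro borel_measurable_diff borel_measurable_const measurable_torus_borel measurable_step_kernel1)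
  define F where "F X t = ((\<Sum>j<N. g (X j) t) / real N)\<^sup>2 * (\<Prod>k<N. r (X k))" for X t
  have sd: "step_distance (empirical N X) \<rho> * (\<Prod>k<N. r (X k)) = (LINT t|torus. F X t)"
    if "X \<in> space (torus_pow N)" for X
  proof -
    have "step_mean (empirical N X) t - step_mean \<rho> t = (\<Sum>j<N. g (X j) t) / real N" for t
    proof -
      have "step_mean (empirical N X) t = (\<Sum>j<N. step_kernel (X j) t) / real N"
        unfolding step_mean_def
        using space_torus_pow[OF that] by (intro integral_empirical measurable_torus_borel measurable_step_kernel1)
      then show ?thesis
        using \<open>N > 0\<close> by (simp add: g_def sum_subtractf diff_divide_distrib)
    qed
    then show ?thesis
      by (simp add: step_distance_def F_def)
  qed
  have idm: "(\<lambda>t. t) \<in> borel_measurable torus"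
    by (rule measurable_torus_borel) simp
  have Fm: "(\<lambda>z. F (fst z) (snd z)) \<in> borel_measurable (torus_pow N \<Otimes>\<^sub>M torus)"
  proof -
    have 1: "(\<lambda>z. f (fst z j)) \<in> borel_measurable (torus_pow N \<Otimes>\<^sub>M torus)"
      if "j < N" "f \<in> borel_measurable torus" for f :: "real \<Rightarrow> real" and j
      using measurable_compose[OF measurable_fst measurable_torus_pow_component[OF that]] .
    have 2: "(\<lambda>z. snd z) \<in> borel_measurable (torus_pow N \<Otimes>\<^sub>M torus)"
      using measurable_compose[OF measurable_snd idm] .
    have 3: "(\<lambda>z. g (fst z j) (snd z)) \<in> borel_measurable (torus_pow N \<Otimes>\<^sub>M torus)" if "j < N" for j
      unfolding g_def
      by (intro borel_measurable_diff step_kernel_measurable 1[OF that idm] 2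
          measurable_compose[OF 2 step_mean_measurable[OF \<rho>]])
    have "(\<lambda>z. \<Sum>j<N. g (fst z j) (snd z)) \<in> borel_measurable (torus_pow N \<Otimes>\<^sub>M torus)"
      using 3 by (intro borel_measurable_sum) auto
    moreover have "(\<lambda>z. \<Prod>k<N. r (fst z k)) \<in> borel_measurable (torus_pow N \<Otimes>\<^sub>M torus)"
      using 1[OF _ continuous_measurable_torus[OF r(1)]] by (intro borel_measurable_prod) auto
    ultimately show ?thesis
      unfolding F_def by (intro borel_measurable_times borel_measurable_power borel_measurable_divide borel_measurable_const)
  qed
  have Fb: "norm (F X t) \<le> 2\<^sup>2 * B ^ N" if X: "X \<in> space (torus_pow N)" for X t
  proof -
    have "\<bar>\<Sum>j<N. g (X j) t\<bar> \<le> (\<Sum>j<N. 2)"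
      using gb space_torus_pow[OF X] by (intro sum_abs[THEN order_trans] sum_mono) auto
    then have "\<bar>(\<Sum>j<N. g (X j) t) / real N\<bar> \<le> 2"
      using \<open>N > 0\<close> by (simp add: field_simps)
    moreover have "norm (\<Prod>k<N. r (X k)) \<le> (\<Prod>k<N. B)"
      unfolding prod_norm[symmetric] using B space_torus_pow[OF X] by (intro prod_mono) (auto simp: less_imp_le)
    ultimately show ?thesis
      unfolding F_def norm_mult norm_power by (intro mult_mono power_mono) auto
  qed
  have Fi: "integrable (torus_pow N \<Otimes>\<^sub>M torus) (case_prod F)"
    unfolding split_beta'
    using Fm Fb by (intro PT.integrable_const_bound[of _ "2\<^sup>2 * B ^ N"] AE_I2) (auto simp: space_pair_measure)
  have "integrable (torus_pow N) (\<lambda>X. LINT t|torus. F X t)"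
    using PT.integrable_fst[OF Fi] by simp
  then show "integrable (torus_pow N) (\<lambda>X. step_distance (empirical N X) \<rho> * (\<Prod>k<N. r (X k)))"
    using sd by (subst Bochner_Integration.integrable_cong[OF refl]) auto
  have Ft: "(LINT X|torus_pow N. F X t) \<le> 4 / real N" for t
  proof -
    have rg: "integrable torus (\<lambda>x. r x * step_kernel x t)"
      using r(1) by (rule integrable_mult_step_kernel)
    have "(LINT x|torus. r x * g x t) = (LINT x|torus. r x * step_kernel x t - r x * step_mean \<rho> t)"
      by (simp add: g_def right_diff_distrib)
    also have "\<dots> = step_mean \<rho> t - 1 * step_mean \<rho> t"
      using rg r by (simp add: \<rho>_def step_mean_density integrable_torus_continuous)
    finally have centred: "(LINT x|torus. r x * g x t) = 0" by simp
    have "(LINT x|torus. r x * (g x t)\<^sup>2) \<le> (LINT x|torus. r x * 4)"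
    proof (rule integral_mono)
      show "integrable torus (\<lambda>x. r x * 4)" using r(1) by (intro integrable_torus_continuous continuous_intros)
      show le: "r x * (g x t)\<^sup>2 \<le> r x * 4" if "x \<in> space torus" for x
        using power_mono[OF gb[of x t], of 2] that r(2)[of x] by (intro mult_left_mono) auto
      show "integrable torus (\<lambda>x. r x * (g x t)\<^sup>2)"
      proof (rule Bochner_Integration.integrable_bound)
        show "integrable torus (\<lambda>x. r x * 4)" using r(1) by (intro integrable_torus_continuous continuous_intros)
        show "(\<lambda>x. r x * (g x t)\<^sup>2) \<in> borel_measurable torus"
          by (intro borel_measurable_times borel_measurable_power gm continuous_measurable_torus r(1))
        show "AE x in torus. norm (r x * (g x t)\<^sup>2) \<le> norm (r x * 4)"
          using le r(2) by (intro AE_I2) (auto simp: abs_mult)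
      qed
    qed
    also have "\<dots> = 4" using r by simp
    finally have "(LINT x|torus. r x * (g x t)\<^sup>2) \<le> 4" .
    moreover have "(LINT X|torus_pow N. F X t) = (real N * (LINT x|torus. r x * (g x t)\<^sup>2)) / (real N)\<^sup>2"
    proof -
      have "F X t = ((\<Sum>j<N. g (X j) t)\<^sup>2 * (\<Prod>k<N. r (X k))) / (real N)\<^sup>2" for X
        by (simp add: F_def power_divide)
      then show ?thesis
        using integral_square_sum_independent[OF r(1,3) gm gb centred, of N] by simp
    qed
    ultimately show ?thesis
      using \<open>N > 0\<close> by (simp add: power2_eq_square divide_right_mono)
  qed
  have "(LINT X|torus_pow N. step_distance (empirical N X) \<rho> * (\<Prod>k<N. r (X k))) = (LINT X|torus_pow N. (LINT t|torus. F X t))"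
    by (rule Bochner_Integration.integral_cong) (auto simp: sd)
  also have "\<dots> = (LINT t|torus. (LINT X|torus_pow N. F X t))"
    using PT.Fubini_integral[OF Fi] by simp
  also have "\<dots> \<le> (LINT t|torus. 4 / real N)"
    using Ft PT.integrable_snd[OF Fi] by (intro integral_mono) auto
  finally show "(LINT X|torus_pow N. step_distance (empirical N X) \<rho> * (\<Prod>k<N. r (X k))) \<le> 4 / real N"
    by simp
qed

text \<open>
  Here \<open>T\<close> stands for the interaction energy or for the entropy as a function of the configuration.
\<close>

corollary average_bound:
  fixes r :: "real \<Rightarrow> real" and T :: "(nat \<Rightarrow> real) \<Rightarrow> real"
  assumes "N > 0" and r: "continuous_on UNIV r" "\<And>x. 0 \<le> r x" "(LINT x|torus. r x) = 1"
    and "A \<ge> 0" "D \<ge> 0" and T: "\<And>X. X \<in> space (torus_pow N) \<Longrightarrow>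
      \<bar>T X\<bar> \<le> A * step_distance (empirical N X) (density torus (\<lambda>x. ennreal (r x))) + D"
  shows "\<bar>LINT X|torus_pow N. T X * (\<Prod>k<N. r (X k))\<bar> \<le> 4 * A / real N + D"
proof (cases "integrable (torus_pow N) (\<lambda>X. T X * (\<Prod>k<N. r (X k)))")
  case True
  let ?S = "\<lambda>X. step_distance (empirical N X) (density torus (\<lambda>x. ennreal (r x))) * (\<Prod>k<N. r (X k))"
  let ?p = "\<lambda>X. \<Prod>k<N. r (X k)"
  note S = expected_step_distance[OF \<open>N > 0\<close> r]
  have p: "integrable (torus_pow N) ?p" "(LINT X|torus_pow N. ?p X) = 1"
    using integrable_torus_pow_prod[of N "\<lambda>_. r"] integral_torus_pow_prod[of N "\<lambda>_. r"] r
    by (auto simp: integrable_torus_continuous)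
  have "norm (LINT X|torus_pow N. T X * ?p X) \<le> (LINT X|torus_pow N. A * ?S X + D * ?p X)"
  proof (rule order_trans[OF integral_norm_bound integral_mono])
    show "integrable (torus_pow N) (\<lambda>X. norm (T X * ?p X))"
      using True by (rule integrable_norm)
    show "integrable (torus_pow N) (\<lambda>X. A * ?S X + D * ?p X)"
      using S p by simp
    fix X assume "X \<in> space (torus_pow N)"
    then have "\<bar>T X\<bar> * ?p X \<le> (A * step_distance (empirical N X) (density torus (\<lambda>x. ennreal (r x))) + D) * ?p X"
      using T r(2) by (intro mult_right_mono prod_nonneg) auto
    moreover have "0 \<le> ?p X" using r(2) by (intro prod_nonneg) auto
    ultimately show "norm (T X * ?p X) \<le> A * ?S X + D * ?p X"
      by (simp add: abs_mult algebra_simps)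
  qed
  also have "\<dots> = A * (LINT X|torus_pow N. ?S X) + D"
    using S(1) p by simp
  also have "\<dots> \<le> A * (4 / real N) + D"
    using S(2) \<open>A \<ge> 0\<close> by (intro add_mono mult_left_mono) auto
  finally show ?thesis by (simp add: mult.commute)
next
  \<comment> \<open>The integral of a function that is not integrable is \<open>0\<close> by convention.\<close>
  case False
  then have "(LINT X|torus_pow N. T X * (\<Prod>k<N. r (X k))) = 0"
    by (rule not_integrable_integral_eq)
  then show ?thesis
    using \<open>A \<ge> 0\<close> \<open>D \<ge> 0\<close> by simp
qed

section \<open>The kinetic energy\<close>

lemma fcoeff_eq: "(LINT x|torus. cnj (cis (2 * pi * of_int k * x)) * f x) = fcoeff f k"
  by (simp add: fcoeff_def cis_cnj mult.commute)

lemma cnj_fcoeff_eq: "(LINT x|torus. cnj (f x) * cis (2 * pi * of_int k * x)) = cnj (fcoeff f k)"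
proof -
  have "cnj (f x * cis (- (2 * pi * of_int k * x))) = cnj (f x) * cis (2 * pi * of_int k * x)" for x
    by (simp add: cis_cnj)
  then show ?thesis
    unfolding fcoeff_def using Bochner_Integration.integral_cnj[of torus "\<lambda>x. f x * cis (- (2 * pi * of_int k * x))"]
    by (simp only:)
qed

lemma kernel_op_fourier_mode:
  assumes "continuous_on UNIV \<psi>"
  shows "kernel_op N (tensor_pow N (ketbra \<psi>)) (fourier_mode N k)
    = (\<lambda>X. (\<Prod>i<N. cnj (fcoeff \<psi> (k i))) * (\<Prod>i<N. \<psi> (X i)))"
proof
  fix X
  have "tensor_pow N (ketbra \<psi>) X Y * fourier_mode N k Y
     = (\<Prod>i<N. \<psi> (X i)) * (\<Prod>i<N. cnj (\<psi> (Y i)) * cis (2 * pi * of_int (k i) * Y i))" for Y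
    by (simp add: tensor_pow_def ketbra_def fourier_mode_def prod.distrib mult.assoc)
  then have "kernel_op N (tensor_pow N (ketbra \<psi>)) (fourier_mode N k) X
    = (\<Prod>i<N. \<psi> (X i)) * (LINT Y|torus_pow N. (\<Prod>i<N. cnj (\<psi> (Y i)) * cis (2 * pi * of_int (k i) * Y i)))"
    by (simp only: kernel_op_def integral_mult_right_zero)
  also have "(LINT Y|torus_pow N. (\<Prod>i<N. cnj (\<psi> (Y i)) * cis (2 * pi * of_int (k i) * Y i)))
    = (\<Prod>i<N. LINT y|torus. cnj (\<psi> y) * cis (2 * pi * of_int (k i) * y))"
    using assms by (intro integral_torus_pow_prod integrable_torus_continuous continuous_intros)
  finally show "kernel_op N (tensor_pow N (ketbra \<psi>)) (fourier_mode N k) X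
    = (\<Prod>i<N. cnj (fcoeff \<psi> (k i))) * (\<Prod>i<N. \<psi> (X i))"
    by (simp only: cnj_fcoeff_eq mult.commute[of "\<Prod>i<N. \<psi> (X i)"])
qed

lemma inner_prod_fourier_mode:
  assumes "\<And>i. i < N \<Longrightarrow> continuous_on UNIV (f i)"
  shows "inner_prod N (fourier_mode N k) (\<lambda>X. c * (\<Prod>i<N. f i (X i))) = c * (\<Prod>i<N. fcoeff (f i) (k i))"
proof -
  have "cnj (fourier_mode N k X) * (c * (\<Prod>i<N. f i (X i)))
    = c * (\<Prod>i<N. cnj (cis (2 * pi * of_int (k i) * X i)) * f i (X i))" for X
    by (simp add: fourier_mode_def prod.distrib mult.left_commute)
  then have "inner_prod N (fourier_mode N k) (\<lambda>X. c * (\<Prod>i<N. f i (X i)))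
    = c * (LINT X|torus_pow N. (\<Prod>i<N. cnj (cis (2 * pi * of_int (k i) * X i)) * f i (X i)))"
    by (simp only: inner_prod_def integral_mult_right_zero)
  also have "(LINT X|torus_pow N. (\<Prod>i<N. cnj (cis (2 * pi * of_int (k i) * X i)) * f i (X i)))
    = (\<Prod>i<N. LINT x|torus. cnj (cis (2 * pi * of_int (k i) * x)) * f i x)"
    using assms by (intro integral_torus_pow_prod integrable_torus_continuous continuous_intros) auto
  finally show ?thesis by (simp only: fcoeff_eq)
qed

lemma momentum_prod:
  assumes "j < N" and f: "\<And>x. (f j has_vector_derivative d x) (at x)"
  shows "momentum h u j (\<lambda>X. c * (\<Prod>i<N. f i (X i)))
    = (\<lambda>X. c * (\<Prod>i<N. (f(j := \<lambda>x. \<i> * complex_of_real h * d x + complex_of_real (u x) * f j x)) i (X i)))"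
proof
  fix X :: "nat \<Rightarrow> real"
  define R where "R = (\<Prod>i\<in>{..<N} - {j}. f i (X i))"
  have split: "(\<Prod>i<N. g i) = g j * (\<Prod>i\<in>{..<N} - {j}. g i)" for g :: "nat \<Rightarrow> complex"
    using \<open>j < N\<close> by (intro prod.remove) auto
  have 1: "c * (\<Prod>i<N. f i ((X(j := t)) i)) = c * R * f j t" for t
    unfolding split R_def by (simp add: mult_ac)
  have "((\<lambda>t. c * R * f j t) has_vector_derivative c * R * d (X j)) (at (X j))"
    by (intro has_vector_derivative_mult_right f)
  then have m1: "vector_derivative (\<lambda>t. c * (\<Prod>i<N. f i ((X(j := t)) i))) (at (X j)) = c * R * d (X j)"
    unfolding 1 by (rule vector_derivative_at)
  have m2: "c * (\<Prod>i<N. f i (X i)) = c * R * f j (X j)"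
    unfolding split R_def by (simp add: mult_ac)
  have m3: "c * (\<Prod>i<N. (f(j := \<lambda>x. \<i> * complex_of_real h * d x + complex_of_real (u x) * f j x)) i (X i))
     = c * R * (\<i> * complex_of_real h * d (X j) + complex_of_real (u (X j)) * f j (X j))"
    unfolding split R_def by (simp add: mult_ac)
  show "momentum h u j (\<lambda>X. c * (\<Prod>i<N. f i (X i))) X
    = c * (\<Prod>i<N. (f(j := \<lambda>x. \<i> * complex_of_real h * d x + complex_of_real (u x) * f j x)) i (X i))"
    unfolding momentum_def m1 m2 m3 by (simp add: algebra_simps)
qed

lemma phase_derivative:
  assumes U: "\<And>x. (U has_real_derivative u x) (at x)" and b: "(b has_vector_derivative b') (at x)"
  shows "((\<lambda>x. b x * exp (\<i> * complex_of_real (U x / h)))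
    has_vector_derivative (b' + b x * (\<i> * complex_of_real (u x / h))) * exp (\<i> * complex_of_real (U x / h))) (at x)"
proof -
  have "((\<lambda>x. cis (U x / h)) has_vector_derivative (u x / h) *\<^sub>R (\<i> * cis (U x / h))) (at x)"
  proof -
    have "((\<lambda>x. U x / h) has_real_derivative u x / h) (at x)"
      using U by (rule DERIV_cdivide)
    moreover have "(cis has_vector_derivative \<i> * cis (U x / h)) (at (U x / h))"
      using has_vector_derivative_cis_mult[of 1 "U x / h" UNIV] by simp
    ultimately show ?thesis
      using vector_diff_chain_at[of "\<lambda>x. U x / h" "u x / h" x cis]
      by (simp add: o_def has_real_derivative_iff_has_vector_derivative)
  qed
  from has_vector_derivative_mult[OF b this]
  show ?thesis
    by (simp add: cis_conv_exp scaleR_conv_of_real algebra_simps)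
qed

text \<open>
  For a wave \<open>\<psi> = a e\<^sup>i\<^sup>U\<^sup>/\<^sup>h\<close> the gradient of the phase cancels \<open>u = U'\<close>, so that
  \<open>(i h d + u)\<^sup>2 \<psi> = - h\<^sup>2 a'' e\<^sup>i\<^sup>U\<^sup>/\<^sup>h\<close> and only the derivatives of the amplitude contribute. The trace
  factorises over the particles and is evaluated by Parseval's identity in each of them.
\<close>

theorem trace_momentum_square:
  fixes a a1 a2 U u u1 :: "real \<Rightarrow> real"
  assumes "j < N" "h > 0"
    and a: "\<And>x. (a has_real_derivative a1 x) (at x)" "\<And>x. (a1 has_real_derivative a2 x) (at x)"
      "continuous_on UNIV a2" "periodic a"
    and U: "\<And>x. (U has_real_derivative u x) (at x)" "\<And>x. (u has_real_derivative u1 x) (at x)"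
      "continuous_on UNIV u1" "periodic U"
    and mass: "(LINT x|torus. (a x)\<^sup>2) = 1"
  defines "\<psi> \<equiv> (\<lambda>x. complex_of_real (a x) * exp (\<i> * complex_of_real (U x / h)))"
  shows "op_trace N (momentum h u j \<circ> momentum h u j \<circ> kernel_op N (tensor_pow N (ketbra \<psi>)))
    = complex_of_real (- h\<^sup>2 * (LINT x|torus. a2 x * a x))"
proof -
  define e where "e x = exp (\<i> * complex_of_real (U x / h))" for x
  have ca: "continuous_on UNIV a" "continuous_on UNIV a1" "continuous_on UNIV U" "continuous_on UNIV u"
    using a U DERIV_imp_continuous_on by blast+
  have per: "periodic a1" "periodic u"
    using a U periodic_deriv by blast+
  have \<psi>e: "\<psi> x = complex_of_real (a x) * e x" for x
    by (simp only: \<psi>_def e_def)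
  have ce: "continuous_on UNIV e"
    unfolding e_def using ca \<open>h > 0\<close> by (intro continuous_intros) auto
  have e1: "cnj (e x) * e x = 1" for x
  proof -
    have "e x = cis (U x / h)" by (simp only: e_def cis_conv_exp)
    then show ?thesis by (simp add: cis_cnj cis_mult)
  qed
  have da: "((\<lambda>x. complex_of_real (a x)) has_vector_derivative complex_of_real (a1 x)) (at x)"
    and da1: "((\<lambda>x. complex_of_real (a1 x)) has_vector_derivative complex_of_real (a2 x)) (at x)"
    for x
    using a U by (auto intro!: has_vector_derivative_of_real simp: has_real_derivative_iff_has_vector_derivative)
  define b1 b2 where "b1 x = complex_of_real (a1 x) + complex_of_real (a x) * (\<i> * complex_of_real (u x / h))"
    and "b2 x = complex_of_real (a2 x) + (complex_of_real (a x) * (\<i> * complex_of_real (u1 x / h))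
        + complex_of_real (a1 x) * (\<i> * complex_of_real (u x / h)))" for x
  have \<psi>1: "(\<psi> has_vector_derivative b1 x * e x) (at x)" for x
    unfolding \<psi>_def b1_def e_def by (rule phase_derivative[OF U(1) da])
  have db1: "(b1 has_vector_derivative b2 x) (at x)" for x
  proof -
    have "((\<lambda>x. \<i> * complex_of_real (u x / h)) has_vector_derivative \<i> * complex_of_real (u1 x / h)) (at x)"
    proof (rule has_vector_derivative_mult_right)
      have "((\<lambda>x. u x / h) has_real_derivative u1 x / h) (at x)"
        using U(2) by (rule DERIV_cdivide)
      then show "((\<lambda>x. complex_of_real (u x / h)) has_vector_derivative complex_of_real (u1 x / h)) (at x)"
        by (intro has_vector_derivative_of_real) (simp add: has_real_derivative_iff_has_vector_derivative)
    qed
    then show ?thesis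
      unfolding b1_def b2_def by (intro has_vector_derivative_add da1 has_vector_derivative_mult[OF da])
  qed
  have \<psi>2: "((\<lambda>x. b1 x * e x) has_vector_derivative (b2 x + b1 x * (\<i> * complex_of_real (u x / h))) * e x) (at x)" for x
    unfolding e_def by (rule phase_derivative[OF U(1) db1])
  have cb: "continuous_on UNIV b1" "continuous_on UNIV b2"
    unfolding b1_def b2_def using ca a(3) U(3) \<open>h > 0\<close> by (intro continuous_intros; auto)+
  have c2: "continuous_on UNIV (\<lambda>x. (b2 x + b1 x * (\<i> * complex_of_real (u x / h))) * e x)"
    using cb ca ce \<open>h > 0\<close> by (intro continuous_intros) auto
  have pe: "periodic e"
    using U(4) by (simp add: periodic_def e_def)
  have p1: "periodic \<psi>" "periodic (\<lambda>x. b1 x * e x)"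
    using a(4) U(4) per pe by (auto simp: periodic_def \<psi>_def b1_def)
  have c\<psi>: "continuous_on UNIV \<psi>"
    unfolding \<psi>_def e_def[symmetric] using ca ce by (intro continuous_intros)
  define G where "G x = complex_of_real (- h\<^sup>2 * a2 x) * e x" for x
  have cG: "continuous_on UNIV G"
    unfolding G_def using a(3) ce by (intro continuous_intros)
  define f where "f i = (if i = j then G else \<psi>)" for i
  have cf: "continuous_on UNIV (f i)" for i
    using cG c\<psi> by (simp add: f_def)
  have cancel: "\<i> * complex_of_real h * ((b' + b * (\<i> * complex_of_real (u x / h))) * e x) + complex_of_real (u x) * (b * e x)
     = \<i> * complex_of_real h * b' * e x" for b b' x
    using \<open>h > 0\<close> by (simp add: field_simps)
  have mom: "momentum h u j (momentum h u j (\<lambda>X. c * (\<Prod>i<N. \<psi> (X i)))) = (\<lambda>X. c * (\<Prod>i<N. f i (X i)))" for c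
  proof -
    define f1 where "f1 = (\<lambda>i. \<psi>)(j := \<lambda>x. (\<i> * complex_of_real h * complex_of_real (a1 x)) * e x)"
    have "momentum h u j (\<lambda>X. c * (\<Prod>i<N. (\<lambda>i. \<psi>) i (X i))) = (\<lambda>X. c * (\<Prod>i<N. f1 i (X i)))"
    proof (subst momentum_prod[OF \<open>j < N\<close> \<psi>1])
      have "(\<lambda>x. \<i> * complex_of_real h * (b1 x * e x) + complex_of_real (u x) * \<psi> x)
         = (\<lambda>x. (\<i> * complex_of_real h * complex_of_real (a1 x)) * e x)"
        unfolding b1_def \<psi>_def e_def[symmetric] cancel ..
      then show "(\<lambda>X. c * (\<Prod>i<N. ((\<lambda>i. \<psi>)(j := \<lambda>x. \<i> * complex_of_real h * (b1 x * e x) + complex_of_real (u x) * \<psi> x)) i (X i)))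
         = (\<lambda>X. c * (\<Prod>i<N. f1 i (X i)))"
        by (simp only: f1_def)
    qed
    moreover have "momentum h u j (\<lambda>X. c * (\<Prod>i<N. f1 i (X i))) = (\<lambda>X. c * (\<Prod>i<N. f i (X i)))"
    proof (subst momentum_prod[OF \<open>j < N\<close>])
      show "(f1 j has_vector_derivative ((\<i> * complex_of_real h * complex_of_real (a2 x))
          + (\<i> * complex_of_real h * complex_of_real (a1 x)) * (\<i> * complex_of_real (u x / h))) * e x) (at x)" for x
        unfolding f1_def e_def
        using phase_derivative[OF U(1) has_vector_derivative_mult_right[OF da1], where h = h]
        by (simp only: fun_upd_same)
      have "(\<lambda>x. \<i> * complex_of_real h * (((\<i> * complex_of_real h * complex_of_real (a2 x))
          + (\<i> * complex_of_real h * complex_of_real (a1 x)) * (\<i> * complex_of_real (u x / h))) * e x)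
          + complex_of_real (u x) * f1 j x) = G"
      proof -
        have "\<i> * H * (\<i> * H * A) = - (H * H * A)" for H A
          using arg_cong[OF i_squared, of "\<lambda>z. z * (H * H * A)"] by (simp add: mult_ac)
        then show ?thesis
          unfolding f1_def fun_upd_same cancel by (simp add: G_def fun_eq_iff power2_eq_square)
      qed
      moreover have "f1(j := G) = f"
        by (auto simp: f1_def f_def)
      ultimately show "(\<lambda>X. c * (\<Prod>i<N. (f1(j := \<lambda>x. \<i> * complex_of_real h * (((\<i> * complex_of_real h * complex_of_real (a2 x))
          + (\<i> * complex_of_real h * complex_of_real (a1 x)) * (\<i> * complex_of_real (u x / h))) * e x)
          + complex_of_real (u x) * f1 j x)) i (X i))) = (\<lambda>X. c * (\<Prod>i<N. f i (X i)))"
        by (simp only:)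
    qed
    ultimately show ?thesis by simp
  qed
  have "inner_prod N (fourier_mode N k) ((momentum h u j \<circ> momentum h u j \<circ> kernel_op N (tensor_pow N (ketbra \<psi>))) (fourier_mode N k))
     = (\<Prod>i<N. fcoeff (f i) (k i) * cnj (fcoeff \<psi> (k i)))" for k
    unfolding comp_def kernel_op_fourier_mode[OF c\<psi>] mom
    by (subst inner_prod_fourier_mode[OF cf]) (simp add: prod.distrib mult.commute)
  then have "op_trace N (momentum h u j \<circ> momentum h u j \<circ> kernel_op N (tensor_pow N (ketbra \<psi>)))
     = (\<Sum>\<^sub>\<infinity>k\<in>({..<N} \<rightarrow>\<^sub>E (UNIV :: int set)). \<Prod>i<N. fcoeff (f i) (k i) * cnj (fcoeff \<psi> (k i)))"
    by (simp only: op_trace_def)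
  also have "\<dots> = (\<Prod>i<N. \<Sum>\<^sub>\<infinity>k. fcoeff (f i) k * cnj (fcoeff \<psi> k))"
    by (rule infsum_prod_PiE_abs) (use parseval_C2(1)[OF cf \<psi>1 \<psi>2 c2 p1] in auto)
  also have "\<dots> = (\<Prod>i<N. LINT x|torus. f i x * cnj (\<psi> x))"
    using infsumI[OF parseval_C2(2)[OF cf \<psi>1 \<psi>2 c2 p1]] by simp
  also have "\<dots> = (\<Prod>i<N. if i = j then complex_of_real (- h\<^sup>2 * (LINT x|torus. a2 x * a x)) else 1)"
  proof (rule prod.cong[OF refl])
    fix i
    have "(LINT x|torus. G x * cnj (\<psi> x)) = (LINT x|torus. complex_of_real (- h\<^sup>2 * (a2 x * a x)))"
    proof (rule Bochner_Integration.integral_cong[OF refl])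
      fix x
      have "G x * cnj (\<psi> x) = complex_of_real (- h\<^sup>2 * (a2 x * a x)) * (cnj (e x) * e x)"
        by (simp add: G_def \<psi>e)
      then show "G x * cnj (\<psi> x) = complex_of_real (- h\<^sup>2 * (a2 x * a x))"
        by (simp only: e1 mult_1_right)
    qed
    moreover have "(LINT x|torus. \<psi> x * cnj (\<psi> x)) = (LINT x|torus. complex_of_real ((a x)\<^sup>2))"
    proof (rule Bochner_Integration.integral_cong[OF refl])
      fix x
      have "\<psi> x * cnj (\<psi> x) = complex_of_real ((a x)\<^sup>2) * (cnj (e x) * e x)"
        by (simp add: \<psi>e power2_eq_square)
      then show "\<psi> x * cnj (\<psi> x) = complex_of_real ((a x)\<^sup>2)"
        by (simp only: e1 mult_1_right)
    qed
    ultimately show "(LINT x|torus. f i x * cnj (\<psi> x))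
        = (if i = j then complex_of_real (- h\<^sup>2 * (LINT x|torus. a2 x * a x)) else 1)"
      by (simp only: f_def integral_complex_of_real integral_mult_right_zero mass split: if_split) simp
  qed
  also have "\<dots> = complex_of_real (- h\<^sup>2 * (LINT x|torus. a2 x * a x))"
    using \<open>j < N\<close> by simp
  finally show ?thesis .
qed

lemma sqrt_second_derivative:
  fixes r r1 r2 :: "real \<Rightarrow> real"
  assumes r: "\<And>x. (r has_real_derivative r1 x) (at x)" "\<And>x. (r1 has_real_derivative r2 x) (at x)"
    and cont: "continuous_on UNIV r2" and pos: "\<And>x. r x > 0"
  obtains a1 a2 where "\<And>x. ((\<lambda>x. sqrt (r x)) has_real_derivative a1 x) (at x)"
    "\<And>x. (a1 has_real_derivative a2 x) (at x)" "continuous_on UNIV a2"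
    "\<And>x. a2 x * sqrt (r x) = r2 x / 2 - (r1 x)\<^sup>2 / (4 * r x)"
proof -
  define a where "a x = sqrt (r x)" for x
  have a: "a x > 0" "a x * a x = r x" for x
    using pos[of x] by (simp_all add: a_def)
  define a1 a2 where "a1 x = r1 x / (2 * a x)" and "a2 x = (r2 x - 2 * (a1 x * a1 x)) / (2 * a x)" for x
  have d1: "(a has_real_derivative a1 x) (at x)" for x
    unfolding a_def[abs_def] a1_def
    using DERIV_chain2[OF DERIV_real_sqrt[OF pos] r(1)] by (simp add: a_def field_simps)
  have d2: "(a1 has_real_derivative a2 x) (at x)" for x
  proof -
    have "((\<lambda>x. r1 x / (2 * a x)) has_real_derivative (r2 x * (2 * a x) - r1 x * (2 * a1 x)) / ((2 * a x) * (2 * a x))) (at x)"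
      using a(1)[of x] by (intro DERIV_divide r DERIV_cmult d1) simp
    moreover have "(r2 x * (2 * a x) - r1 x * (2 * a1 x)) / ((2 * a x) * (2 * a x)) = a2 x"
    proof -
      have r1: "r1 x = 2 * a x * a1 x" using a(1)[of x] by (simp add: a1_def)
      show ?thesis
        unfolding r1 a2_def using a(1)[of x] by (simp add: field_simps)
    qed
    ultimately show ?thesis unfolding a1_def[abs_def] by simp
  qed
  have c: "continuous_on UNIV a" "continuous_on UNIV a1"
    using d1 d2 DERIV_imp_continuous_on by blast+
  show thesis
  proof (rule that)
    show "((\<lambda>x. sqrt (r x)) has_real_derivative a1 x) (at x)" for x
      using d1 by (simp add: a_def[abs_def])
    show "(a1 has_real_derivative a2 x) (at x)" for x by (rule d2)
    have "2 * a x \<noteq> 0" for x using a(1)[of x] by simp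
    then show "continuous_on UNIV a2"
      unfolding a2_def[abs_def] using cont c by (intro continuous_intros) auto
    show "a2 x * sqrt (r x) = r2 x / 2 - (r1 x)\<^sup>2 / (4 * r x)" for x
    proof -
      have r1: "r1 x = 2 * a x * a1 x" using a(1)[of x] by (simp add: a1_def)
      have "a2 x * a x = (r2 x - 2 * (a1 x * a1 x)) / 2" using a(1)[of x] by (simp add: a2_def)
      moreover have "(r1 x)\<^sup>2 / (4 * r x) = a1 x * a1 x"
        unfolding a(2)[symmetric] r1 using a(1)[of x] by (simp add: power2_eq_square)
      ultimately show ?thesis by (simp add: a_def diff_divide_distrib)
    qed
  qed
qed

section \<open>Convergence of the modulated energy\<close>

text \<open>
  With \<open>q g = g/f\<close> one has \<open>(q g)' = q g' - q g q f'\<close>, which keeps all derivatives of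
  \<open>ln f\<close> polynomial in \<open>q\<close> of the derivatives of \<open>f\<close>.
\<close>

lemma ln_derivatives:
  fixes f f1 f2 f3 f4 :: "real \<Rightarrow> real"
  assumes f: "\<And>x. (f has_real_derivative f1 x) (at x)" "\<And>x. (f1 has_real_derivative f2 x) (at x)"
      "\<And>x. (f2 has_real_derivative f3 x) (at x)" "\<And>x. (f3 has_real_derivative f4 x) (at x)"
    and cont: "continuous_on UNIV f4" and pos: "\<And>x. f x > 0"
  obtains V1 V2 V3 V4 where "\<And>x. ((\<lambda>x. ln (f x)) has_real_derivative V1 x) (at x)"
    "\<And>x. (V1 has_real_derivative V2 x) (at x)" "\<And>x. (V2 has_real_derivative V3 x) (at x)"
    "\<And>x. (V3 has_real_derivative V4 x) (at x)" "continuous_on UNIV V4"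
proof -
  define q where "q g x = g x / f x" for g :: "real \<Rightarrow> real" and x
  have dq: "(q g has_real_derivative q g' x - q g x * q f1 x) (at x)"
    if "(g has_real_derivative g' x) (at x)" for g g' x
  proof -
    have "((\<lambda>x. g x / f x) has_real_derivative (g' x * f x - g x * f1 x) / (f x * f x)) (at x)"
      using pos[of x] by (intro DERIV_divide that f) simp
    moreover have "(g' x * f x - g x * f1 x) / (f x * f x) = q g' x - q g x * q f1 x"
      using pos[of x] by (simp add: q_def field_simps)
    ultimately show ?thesis by (simp add: q_def[abs_def])
  qed
  note d = dq[of f1 f2, OF f(2)] dq[of f2 f3, OF f(3)] dq[of f3 f4, OF f(4)]
  define V1 V2 V3 V4 where "V1 = q f1" and "V2 x = q f2 x - V1 x * V1 x"
    and "V3 x = (q f3 x - q f2 x * V1 x) - (V1 x * V2 x + V2 x * V1 x)"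
    and "V4 x = ((q f4 x - q f3 x * V1 x) - (q f2 x * V2 x + (q f3 x - q f2 x * V1 x) * V1 x))
        - ((V1 x * V3 x + V2 x * V2 x) + (V2 x * V2 x + V3 x * V1 x))" for x
  have 0: "((\<lambda>x. ln (f x)) has_real_derivative V1 x) (at x)" for x
    using DERIV_chain2[OF DERIV_ln[OF pos] f(1)] by (simp add: V1_def q_def field_simps)
  have 1: "(V1 has_real_derivative V2 x) (at x)" for x
    using d(1)[of x] by (simp add: V1_def V2_def)
  have 2: "(V2 has_real_derivative V3 x) (at x)" for x
    unfolding V2_def[abs_def] V3_def
    using DERIV_diff[OF d(2)[of x] DERIV_mult'[OF 1[of x] 1[of x]]] by (simp add: V1_def V2_def)
  have 3: "(V3 has_real_derivative V4 x) (at x)" for x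
  proof -
    have "((\<lambda>x. (q f3 x - q f2 x * V1 x) - (V1 x * V2 x + V2 x * V1 x)) has_real_derivative V4 x) (at x)"
      unfolding V4_def
      using d(2)[of x] d(3)[of x] 1[of x] 2[of x]
      by (intro DERIV_diff DERIV_add DERIV_mult') (simp_all add: V1_def)
    then show ?thesis by (simp add: V3_def[abs_def])
  qed
  have cf: "continuous_on UNIV f" "continuous_on UNIV f2" "continuous_on UNIV f3"
    using f DERIV_imp_continuous_on by blast+
  have cV: "continuous_on UNIV V1" "continuous_on UNIV V2" "continuous_on UNIV V3"
    using 1 2 3 DERIV_imp_continuous_on by blast+
  have "f x \<noteq> 0" for x using pos[of x] by simp
  then have "continuous_on UNIV (q g)" if "continuous_on UNIV g" for g
    unfolding q_def[abs_def] using that cf by (intro continuous_intros) auto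
  then have "continuous_on UNIV V4"
    unfolding V4_def[abs_def] using cf cont cV by (intro continuous_intros)
  with 0 1 2 3 show thesis by (rule that)
qed

lemma init_kernel_density:
  assumes "\<And>x. 0 \<le> init_density V\<^sub>0 \<epsilon> x"
  shows "kernel_density (init_kernel V\<^sub>0 U\<^sub>0 \<epsilon> h N) X = (\<Prod>j<N. init_density V\<^sub>0 \<epsilon> (X j))"
proof -
  have "(cmod (init_wave V\<^sub>0 U\<^sub>0 \<epsilon> h x))\<^sup>2 = init_density V\<^sub>0 \<epsilon> x" for x
    using assms[of x] by (simp add: init_wave_def norm_mult norm_exp_i_times[of "U\<^sub>0 x / h", simplified])
  then show ?thesis
    by (simp only: init_kernel_def kernel_density_tensor_pow_ketbra)
qed

text \<open>
  Below \<open>\<epsilon>\<^sub>0\<close> the initial density \<open>r = \<rho>\<^sub>0 - \<epsilon> V\<^sub>0''\<close> stays above half the minimum \<open>m\<close> of \<open>\<rho>\<^sub>0\<close>. This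
  bounds \<open>a a'' = r''/2 - r'\<^sup>2/(4 r)\<close> for the amplitude \<open>a\<close> by a constant \<open>M\<close> independent of \<open>\<epsilon>\<close>. The other two
  parts are averages of quantities controlled by the fluctuation of the empirical measure.
\<close>

theorem modulated_energy_bound:
  fixes \<rho>\<^sub>0 f1 f2 f3 f4 u\<^sub>0 u1 U\<^sub>0 :: "real \<Rightarrow> real"
  assumes f: "\<And>x. (\<rho>\<^sub>0 has_real_derivative f1 x) (at x)" "\<And>x. (f1 has_real_derivative f2 x) (at x)"
      "\<And>x. (f2 has_real_derivative f3 x) (at x)" "\<And>x. (f3 has_real_derivative f4 x) (at x)"
      "continuous_on UNIV f4"
    and \<rho>\<^sub>0: "periodic \<rho>\<^sub>0" "\<And>x. \<rho>\<^sub>0 x > 0" "(LINT x|torus. \<rho>\<^sub>0 x) = 1"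
    and U\<^sub>0: "\<And>x. (U\<^sub>0 has_real_derivative u\<^sub>0 x) (at x)" "\<And>x. (u\<^sub>0 has_real_derivative u1 x) (at x)"
      "continuous_on UNIV u1" "periodic U\<^sub>0"
  obtains K \<epsilon>\<^sub>0 where "\<epsilon>\<^sub>0 > 0" and "\<And>\<epsilon> h N. 0 < \<epsilon> \<Longrightarrow> \<epsilon> \<le> \<epsilon>\<^sub>0 \<Longrightarrow> 0 < h \<Longrightarrow> 0 < N \<Longrightarrow>
      \<bar>modulated_energy \<rho>\<^sub>0 u\<^sub>0 \<epsilon> h N (init_kernel (\<lambda>x. ln (\<rho>\<^sub>0 x)) U\<^sub>0 \<epsilon> h N)\<bar>
        \<le> K * (h\<^sup>2 + 1 / (\<epsilon> * real N) + \<epsilon>)"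
proof -
  define V\<^sub>0 where "V\<^sub>0 x = ln (\<rho>\<^sub>0 x)" for x
  obtain V1 V2 V3 V4 where V: "\<And>x. (V\<^sub>0 has_real_derivative V1 x) (at x)"
    "\<And>x. (V1 has_real_derivative V2 x) (at x)" "\<And>x. (V2 has_real_derivative V3 x) (at x)"
    "\<And>x. (V3 has_real_derivative V4 x) (at x)" and V4: "continuous_on UNIV V4"
    using ln_derivatives[OF f \<rho>\<^sub>0(2)] unfolding V\<^sub>0_def[abs_def] by blast
  have expV: "exp (V\<^sub>0 x) = \<rho>\<^sub>0 x" for x using \<rho>\<^sub>0(2)[of x] by (simp add: V\<^sub>0_def)
  have perV: "periodic V\<^sub>0" using \<rho>\<^sub>0(1) by (simp add: periodic_def V\<^sub>0_def)
  have perV2: "periodic V2" using V perV periodic_deriv by blast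
  have cont: "continuous_on UNIV \<rho>\<^sub>0" "continuous_on UNIV f1" "continuous_on UNIV f2" "continuous_on UNIV V2" "continuous_on UNIV V3"
    using f V DERIV_imp_continuous_on by blast+
  have d2: "deriv (deriv V\<^sub>0) = V2"
  proof -
    have "deriv V\<^sub>0 = V1" by (rule ext) (rule DERIV_imp_deriv[OF V(1)])
    moreover have "deriv V1 = V2" by (rule ext) (rule DERIV_imp_deriv[OF V(2)])
    ultimately show ?thesis by (simp only:)
  qed
  obtain x0 where x0: "\<And>x. \<rho>\<^sub>0 x0 \<le> \<rho>\<^sub>0 x" using periodic_attains_min[OF cont(1) \<rho>\<^sub>0(1)] by blast
  define m where "m = \<rho>\<^sub>0 x0"
  have m: "m > 0" "\<And>x. m \<le> \<rho>\<^sub>0 x" using x0 \<rho>\<^sub>0(2) by (auto simp: m_def)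
  obtain B where B: "B > 0" "\<And>x. 0 \<le> x \<Longrightarrow> x \<le> 1 \<Longrightarrow> norm (V2 x) \<le> B"
    using continuous_bounded_unit[OF cont(4)] by blast
  have BV: "\<bar>V2 x\<bar> \<le> B" for x
  proof -
    have "norm (V2 (frac x)) \<le> B"
      using frac_lt_1[of x] by (intro B(2)) auto
    then show ?thesis by (simp only: periodic_frac[OF perV2] real_norm_def)
  qed
  obtain C1 where C1: "C1 > 0" "\<And>x. 0 \<le> x \<Longrightarrow> x \<le> 1 \<Longrightarrow> norm (f1 x) \<le> C1"
    using continuous_bounded_unit[OF cont(2)] by blast
  obtain C2 where C2: "C2 > 0" "\<And>x. 0 \<le> x \<Longrightarrow> x \<le> 1 \<Longrightarrow> norm (f2 x) \<le> C2"
    using continuous_bounded_unit[OF cont(3)] by blast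
  obtain D1 where D1: "D1 > 0" "\<And>x. 0 \<le> x \<Longrightarrow> x \<le> 1 \<Longrightarrow> norm (V3 x) \<le> D1"
    using continuous_bounded_unit[OF cont(5)] by blast
  obtain D2 where D2: "D2 > 0" "\<And>x. 0 \<le> x \<Longrightarrow> x \<le> 1 \<Longrightarrow> norm (V4 x) \<le> D2"
    using continuous_bounded_unit[OF V4] by blast
  define \<epsilon>\<^sub>0 where "\<epsilon>\<^sub>0 = min 1 (m / (2 * B))"
  define M where "M = (C2 + D2) / 2 + (C1 + D1)\<^sup>2 / (4 * (m / 2))"
  define K where "K = M / 2 + 5 + B\<^sup>2"
  have M: "M \<ge> 0" using C1 C2 D1 D2 m(1) by (simp add: M_def)
  show thesis
  proof (rule that[of \<epsilon>\<^sub>0 K])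
    show "\<epsilon>\<^sub>0 > 0" using m B by (simp add: \<epsilon>\<^sub>0_def)
    fix \<epsilon> h :: real and N :: nat
    let ?D = "\<lambda>X. diff_square_integral (empirical N X) (density torus (\<lambda>x. ennreal (mb_density \<epsilon> N X x))) (\<lambda>x y. green (x - y))"
    let ?T = "\<lambda>j. op_trace N (momentum h u\<^sub>0 j \<circ> momentum h u\<^sub>0 j \<circ> kernel_op N (init_kernel V\<^sub>0 U\<^sub>0 \<epsilon> h N))"
    assume \<epsilon>: "0 < \<epsilon>" "\<epsilon> \<le> \<epsilon>\<^sub>0" and h: "0 < h" and N: "0 < N"
    have \<epsilon>1: "\<epsilon> \<le> 1" and \<epsilon>B: "\<epsilon> * B \<le> m / 2"
      using \<epsilon> B(1) by (simp_all add: \<epsilon>\<^sub>0_def field_simps)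
    define r where "r x = exp (V\<^sub>0 x) - \<epsilon> * V2 x" for x
    have r_low: "m / 2 \<le> r x" for x
    proof -
      have "\<epsilon> * V2 x \<le> \<epsilon> * B" using BV[of x] \<epsilon>(1) by (intro mult_left_mono) auto
      then show ?thesis using m(2)[of x] \<epsilon>B by (simp add: r_def expV)
    qed
    then have r_pos: "0 < r x" for x using m(1) less_le_trans[of 0 "m / 2" "r x"] by simp
    have init: "init_density V\<^sub>0 \<epsilon> = r"
      by (rule ext) (simp add: init_density_def r_def d2)
    define r1 r2 where "r1 x = f1 x - \<epsilon> * V3 x" and "r2 x = f2 x - \<epsilon> * V4 x" for x
    have dr: "(r has_real_derivative r1 x) (at x)" "(r1 has_real_derivative r2 x) (at x)" for x
      unfolding r_def[abs_def] r1_def[abs_def] r2_def expV by (intro DERIV_diff DERIV_cmult f V)+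
    have r2c: "continuous_on UNIV r2" unfolding r2_def[abs_def] using cont V4 by (intro continuous_intros)
    have rc: "continuous_on UNIV r" using dr(1) by (rule DERIV_imp_continuous_on)
    have rper: "periodic r" using perV perV2 by (simp add: periodic_def r_def)
    have mass: "(LINT x|torus. r x) = 1"
    proof -
      have "periodic V1" using V perV periodic_deriv by blast
      then have "(LINT x|torus. \<epsilon> * V2 x) = 0"
        using torus_integral_deriv_periodic[OF V(2) cont(4)] by simp
      moreover have "(LINT x|torus. r x) = (LINT x|torus. \<rho>\<^sub>0 x) - (LINT x|torus. \<epsilon> * V2 x)"
        unfolding r_def expV using cont
        by (intro Bochner_Integration.integral_diff integrable_torus_continuous continuous_intros)
      ultimately show ?thesis using \<rho>\<^sub>0(3) by simp
    qed
    note rprob = rc less_imp_le[OF r_pos] mass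
    \<comment> \<open>The kinetic part is of order \<open>h\<^sup>2\<close>.\<close>
    obtain a1 a2 where a: "\<And>x. ((\<lambda>x. sqrt (r x)) has_real_derivative a1 x) (at x)"
      "\<And>x. (a1 has_real_derivative a2 x) (at x)" "continuous_on UNIV a2"
      "\<And>x. a2 x * sqrt (r x) = r2 x / 2 - (r1 x)\<^sup>2 / (4 * r x)"
      using sqrt_second_derivative[OF dr r2c r_pos] by blast
    define A where "A = (LINT x|torus. a2 x * sqrt (r x))"
    have kin: "?T j
        = complex_of_real (- h\<^sup>2 * A)" if "j < N" for j
    proof -
      have w: "init_wave V\<^sub>0 U\<^sub>0 \<epsilon> h = (\<lambda>x. complex_of_real (sqrt (r x)) * exp (\<i> * complex_of_real (U\<^sub>0 x / h)))"
        by (simp only: init_wave_def[abs_def] init)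
      have "periodic (\<lambda>x. sqrt (r x))" using rper by (simp add: periodic_def)
      moreover have "(LINT x|torus. (sqrt (r x))\<^sup>2) = 1"
        using mass less_imp_le[OF r_pos] by simp
      ultimately show ?thesis
        unfolding init_kernel_def w A_def by (intro trace_momentum_square[OF that h a(1,2,3) _ U\<^sub>0])
    qed
    have A: "\<bar>A\<bar> \<le> M"
    proof -
      have "norm A \<le> (LINT x|torus. M)"
        unfolding A_def
      proof (rule Bochner_Integration.integral_norm_bound_integral)
        show "integrable torus (\<lambda>x. a2 x * sqrt (r x))"
          using a(3) rc by (intro integrable_torus_continuous continuous_intros)
        fix x assume "x \<in> space torus"
        then have x: "0 \<le> x" "x \<le> 1" by auto
        have "\<epsilon> * \<bar>V3 x\<bar> \<le> 1 * D1" "\<epsilon> * \<bar>V4 x\<bar> \<le> 1 * D2"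
          using \<epsilon>(1) \<epsilon>1 D1(2)[OF x] D2(2)[OF x] by (intro mult_mono; simp)+
        moreover have "\<bar>r1 x\<bar> \<le> \<bar>f1 x\<bar> + \<epsilon> * \<bar>V3 x\<bar>" "\<bar>r2 x\<bar> \<le> \<bar>f2 x\<bar> + \<epsilon> * \<bar>V4 x\<bar>"
          using abs_triangle_ineq4[of "f1 x" "\<epsilon> * V3 x"] abs_triangle_ineq4[of "f2 x" "\<epsilon> * V4 x"] \<epsilon>(1)
          by (simp_all add: r1_def r2_def abs_mult)
        ultimately have b: "\<bar>r1 x\<bar> \<le> C1 + D1" "\<bar>r2 x\<bar> \<le> C2 + D2"
          using C1(2)[OF x] C2(2)[OF x] by simp_all
        have "(r1 x)\<^sup>2 \<le> (C1 + D1)\<^sup>2" using power_mono[OF b(1), of 2] by simp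
        then have "(r1 x)\<^sup>2 / (4 * r x) \<le> (C1 + D1)\<^sup>2 / (4 * (m / 2))"
          using r_low[of x] m(1) by (intro frac_le) auto
        moreover have "0 \<le> (r1 x)\<^sup>2 / (4 * r x)" using less_imp_le[OF r_pos[of x]] by simp
        moreover have "r2 x \<le> C2 + D2" "- (C2 + D2) \<le> r2 x"
          using b(2) by (simp_all add: abs_le_iff)
        moreover have "\<bar>y / 2 - q\<bar> \<le> z / 2 + Q" if "q \<le> Q" "0 \<le> q" "y \<le> z" "- z \<le> y" for q Q y z :: real
          using that by (simp add: abs_le_iff)
        ultimately show "norm (a2 x * sqrt (r x)) \<le> M"
          unfolding a(4) M_def real_norm_def by blast
      qed simp
      then show ?thesis by simp
    qed
    have t1: "\<bar>1 / (2 * real N) * (\<Sum>j<N. Re (?T j))\<bar>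
        \<le> M / 2 * h\<^sup>2"
    proof -
      have "Re (?T j) = - h\<^sup>2 * A"
        if "j < N" for j
        unfolding kin[OF that] by (rule Re_complex_of_real)
      then have "(\<Sum>j<N. Re (?T j))
          = (\<Sum>j<N. - h\<^sup>2 * A)"
        by (intro sum.cong refl) blast
      also have "\<dots> = - (real N * (h\<^sup>2 * A))" by simp
      finally have "\<bar>1 / (2 * real N) * (\<Sum>j<N. Re (?T j))\<bar>
          = h\<^sup>2 * \<bar>A\<bar> / 2"
        using N by (simp only:) (simp add: abs_mult)
      also have "\<dots> \<le> h\<^sup>2 * M / 2" using A by (intro divide_right_mono mult_left_mono) auto
      finally show ?thesis by (simp add: mult.commute)
    qed
    \<comment> \<open>The potential part and the entropy are controlled by the fluctuations of the empirical measure.\<close>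
    have dens: "kernel_density (init_kernel V\<^sub>0 U\<^sub>0 \<epsilon> h N) X = (\<Prod>k<N. r (X k))" for X
      using init_kernel_density[of V\<^sub>0 \<epsilon>] less_imp_le[OF r_pos] by (simp add: init)
    have massV: "(LINT x|torus. exp (V\<^sub>0 x)) = 1" by (simp add: expV \<rho>\<^sub>0(3))
    have eb: "0 \<le> ?D X"
      "?D X
        \<le> 2 * step_distance (empirical N X) (density torus (\<lambda>x. ennreal (r x))) + 2 * (\<epsilon> * B)\<^sup>2"
      "0 \<le> (LINT x|torus. mb_density \<epsilon> N X x * ln (mb_density \<epsilon> N X x / exp (V\<^sub>0 x)) - mb_density \<epsilon> N X x + exp (V\<^sub>0 x))"
      "(LINT x|torus. mb_density \<epsilon> N X x * ln (mb_density \<epsilon> N X x / exp (V\<^sub>0 x)) - mb_density \<epsilon> N X x + exp (V\<^sub>0 x))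
        \<le> step_distance (empirical N X) (density torus (\<lambda>x. ennreal (r x))) / (4 * \<epsilon>)"
      if "X \<in> space (torus_pow N)" for X
      unfolding r_def
      by (rule energy_bounds[OF N \<epsilon>(1) _ V(1,2) cont(4) perV massV r_pos[unfolded r_def] BV];
        rule space_torus_pow[OF that]; assumption)+
    have t2: "\<bar>LINT X|torus_pow N. ?D X * (\<Prod>k<N. r (X k))\<bar>
        \<le> 4 * 2 / real N + 2 * (\<epsilon> * B)\<^sup>2"
    proof (rule average_bound[OF N rprob])
      fix X assume "X \<in> space (torus_pow N)"
      from eb(1,2)[OF this]
      show "\<bar>?D X\<bar>
        \<le> 2 * step_distance (empirical N X) (density torus (\<lambda>x. ennreal (r x))) + 2 * (\<epsilon> * B)\<^sup>2"
        by simp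
    qed simp_all
    have t3: "\<bar>LINT X|torus_pow N. (LINT x|torus. mb_density \<epsilon> N X x * ln (mb_density \<epsilon> N X x / \<rho>\<^sub>0 x)
          - mb_density \<epsilon> N X x + \<rho>\<^sub>0 x) * (\<Prod>k<N. r (X k))\<bar> \<le> 4 * (1 / (4 * \<epsilon>)) / real N + 0"
    proof (rule average_bound[OF N rprob])
      show "0 \<le> 1 / (4 * \<epsilon>)" using \<epsilon>(1) by simp
      fix X assume "X \<in> space (torus_pow N)"
      from eb(3,4)[OF this]
      show "\<bar>LINT x|torus. mb_density \<epsilon> N X x * ln (mb_density \<epsilon> N X x / \<rho>\<^sub>0 x) - mb_density \<epsilon> N X x + \<rho>\<^sub>0 x\<bar>
        \<le> 1 / (4 * \<epsilon>) * step_distance (empirical N X) (density torus (\<lambda>x. ennreal (r x))) + 0"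
        by (simp add: expV)
    qed simp
    have t2': "\<bar>1 / (2 * \<epsilon>) * (LINT X|torus_pow N. ?D X * (\<Prod>k<N. r (X k)))\<bar>
        \<le> 4 * (1 / (\<epsilon> * real N)) + B\<^sup>2 * \<epsilon>"
    proof -
      have "1 / (2 * \<epsilon>) * \<bar>LINT X|torus_pow N. ?D X * (\<Prod>k<N. r (X k))\<bar>
        \<le> 1 / (2 * \<epsilon>) * (4 * 2 / real N + 2 * (\<epsilon> * B)\<^sup>2)"
        using t2 \<epsilon>(1) by (intro mult_left_mono) auto
      also have "\<dots> = 4 * (1 / (\<epsilon> * real N)) + B\<^sup>2 * \<epsilon>"
        using \<epsilon>(1) N by (simp add: field_simps power2_eq_square)
      finally show ?thesis using \<epsilon>(1) by (simp add: abs_mult)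
    qed
    have "\<bar>modulated_energy \<rho>\<^sub>0 u\<^sub>0 \<epsilon> h N (init_kernel V\<^sub>0 U\<^sub>0 \<epsilon> h N)\<bar>
      \<le> M / 2 * h\<^sup>2 + (4 * (1 / (\<epsilon> * real N)) + B\<^sup>2 * \<epsilon>) + (4 * (1 / (4 * \<epsilon>)) / real N + 0)"
      unfolding modulated_energy_def dens
      by (rule order_trans[OF abs_triangle_ineq add_mono[OF order_trans[OF abs_triangle_ineq add_mono[OF t1 t2']] t3]])
    also have "\<dots> = M / 2 * h\<^sup>2 + 5 * (1 / (\<epsilon> * real N)) + B\<^sup>2 * \<epsilon>"
      using \<epsilon>(1) N by (simp add: field_simps)
    also have "\<dots> \<le> K * h\<^sup>2 + K * (1 / (\<epsilon> * real N)) + K * \<epsilon>"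
      using M \<epsilon>(1) N by (intro add_mono mult_right_mono) (auto simp: K_def)
    finally show "\<bar>modulated_energy \<rho>\<^sub>0 u\<^sub>0 \<epsilon> h N (init_kernel (\<lambda>x. ln (\<rho>\<^sub>0 x)) U\<^sub>0 \<epsilon> h N)\<bar>
        \<le> K * (h\<^sup>2 + 1 / (\<epsilon> * real N) + \<epsilon>)"
      by (simp only: V\<^sub>0_def[abs_def] distrib_left)
  qed
qed

text \<open>
  On \<open>P\<close> all three summands of \<open>\<epsilon> N + h + 1/N\<close> are positive, so each of them tends to zero with the sum;
  in particular \<open>N\<close> tends to infinity along the filter.
\<close>

lemma small_parameter_limits:
  fixes \<epsilon> :: "nat \<Rightarrow> real" and P :: "(real \<times> nat) set"
  assumes pos: "\<And>N. N > 0 \<Longrightarrow> \<epsilon> N > 0" and lim: "(\<lambda>N. 1 / ((\<epsilon> N)\<^sup>2 * real N powr 2)) \<longlonglongrightarrow> 0"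
    and P: "P \<subseteq> {(h, N). h > 0 \<and> N > 0}"
  defines "G \<equiv> inf (filtercomap (\<lambda>(h, N). \<epsilon> N + h + 1 / real N) (nhds 0)) (principal P)"
  shows "((\<lambda>(h, N). h) \<longlongrightarrow> 0) G" "((\<lambda>(h, N). \<epsilon> N) \<longlongrightarrow> 0) G" "((\<lambda>(h, N). 1 / (\<epsilon> N * real N)) \<longlongrightarrow> 0) G"
proof -
  let ?g = "\<lambda>(h, N). \<epsilon> N + h + 1 / real N"
  have evP: "eventually (\<lambda>z. z \<in> P) G"
    unfolding G_def by (rule filter_leD[OF inf_le2]) (simp add: eventually_principal)
  have g: "(?g \<longlongrightarrow> 0) G"
    unfolding G_def by (rule tendsto_mono[OF inf_le1]) (rule filterlim_filtercomap)
  have between: "(f \<longlongrightarrow> 0) G" if "\<And>z. z \<in> P \<Longrightarrow> 0 \<le> f z \<and> f z \<le> ?g z" for f :: "real \<times> nat \<Rightarrow> real"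
  proof (rule tendsto_sandwich[OF _ _ tendsto_const g])
    show "eventually (\<lambda>z. 0 \<le> f z) G" "eventually (\<lambda>z. f z \<le> ?g z) G"
      using that by (auto intro: eventually_mono[OF evP])
  qed
  have Pz: "h > 0" "N > 0" "\<epsilon> N > 0" if "(h, N) \<in> P" for h N
    using that P pos by auto
  show "((\<lambda>(h, N). h) \<longlongrightarrow> 0) G" "((\<lambda>(h, N). \<epsilon> N) \<longlongrightarrow> 0) G"
    using Pz by (auto intro!: between simp: add_nonneg_nonneg less_imp_le)
  have inv: "((\<lambda>(h, N). 1 / real N) \<longlongrightarrow> 0) G"
    using Pz by (auto intro!: between simp: add_nonneg_nonneg less_imp_le)
  have "filterlim snd sequentially G"
    unfolding filterlim_at_top
  proof
    fix Z :: nat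
    have "eventually (\<lambda>(h, N). 1 / real N < 1 / real (Suc Z)) G"
      using order_tendstoD(2)[OF inv, of "1 / real (Suc Z)"] by (simp add: case_prod_beta')
    with evP show "eventually (\<lambda>z. Z \<le> snd z) G"
    proof eventually_elim
      case (elim z)
      obtain h N where z: "z = (h, N)" by (cases z)
      have "N > 0" "1 / real N < 1 / real (Suc Z)" using elim Pz by (auto simp: z)
      then have "real (Suc Z) < real N" by (simp add: field_simps)
      then show ?case by (simp add: z)
    qed
  qed
  moreover have "(\<lambda>N. 1 / (\<epsilon> N * real N)) \<longlonglongrightarrow> 0"
  proof -
    have "(\<lambda>N. sqrt (1 / ((\<epsilon> N)\<^sup>2 * real N powr 2))) \<longlonglongrightarrow> sqrt 0"
      using lim by (rule tendsto_real_sqrt)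
    moreover have "eventually (\<lambda>N. sqrt (1 / ((\<epsilon> N)\<^sup>2 * real N powr 2)) = 1 / (\<epsilon> N * real N)) sequentially"
    proof (rule eventually_mono[OF eventually_gt_at_top[of 0]])
      fix N :: nat assume "0 < N"
      then have "0 \<le> \<epsilon> N * real N" using pos[of N] by simp
      moreover have "(\<epsilon> N)\<^sup>2 * real N powr 2 = (\<epsilon> N * real N)\<^sup>2"
        using \<open>0 < N\<close> by (simp add: power_mult_distrib)
      ultimately show "sqrt (1 / ((\<epsilon> N)\<^sup>2 * real N powr 2)) = 1 / (\<epsilon> N * real N)"
        by (simp add: real_sqrt_divide)
    qed
    ultimately have "(\<lambda>N. 1 / (\<epsilon> N * real N)) \<longlonglongrightarrow> sqrt 0"
      by (rule Lim_transform_eventually)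
    then show ?thesis by simp
  qed
  ultimately have "((\<lambda>z. 1 / (\<epsilon> (snd z) * real (snd z))) \<longlongrightarrow> 0) G"
    by (rule filterlim_compose[rotated])
  then show "((\<lambda>(h, N). 1 / (\<epsilon> N * real N)) \<longlongrightarrow> 0) G"
    by (simp add: case_prod_beta')
qed

theorem lemma4p2:
  "\<exists>s\<^sub>0>1. \<forall>s\<ge>s\<^sub>0. \<forall>(\<rho>\<^sub>0 :: real \<Rightarrow> real) (u\<^sub>0 :: real \<Rightarrow> real) (U\<^sub>0 :: real \<Rightarrow> real) (V\<^sub>0 :: real \<Rightarrow> real).
     sobolev s \<rho>\<^sub>0 \<longrightarrow> prob_density \<rho>\<^sub>0 \<longrightarrow> (\<forall>x. \<rho>\<^sub>0 x > 0) \<longrightarrow>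
     sobolev s u\<^sub>0 \<longrightarrow> periodic U\<^sub>0 \<longrightarrow> (\<forall>x. (U\<^sub>0 has_real_derivative u\<^sub>0 x) (at x)) \<longrightarrow>
     V\<^sub>0 = (\<lambda>x. ln (\<rho>\<^sub>0 x)) \<longrightarrow>
     (\<exists>\<Lambda>>0. \<forall>\<epsilon> :: nat \<Rightarrow> real.
        (\<forall>N>0. \<epsilon> N > 0) \<longrightarrow>
        ((\<lambda>N. 1 / ((\<epsilon> N)\<^sup>2 * real N powr \<Lambda>)) \<longlonglongrightarrow> 0) \<longrightarrow>
        ((\<lambda>(h, N). modulated_energy \<rho>\<^sub>0 u\<^sub>0 (\<epsilon> N) h N (init_kernel V\<^sub>0 U\<^sub>0 (\<epsilon> N) h N)) \<longlongrightarrow> 0)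
          (inf (filtercomap (\<lambda>(h, N). \<epsilon> N + h + 1 / real N) (nhds 0))
               (principal {(h, N). h > 0 \<and> N > 0 \<and> (\<forall>x. init_density V\<^sub>0 (\<epsilon> N) x > 0)})))"
proof (rule exI[of _ 5], intro conjI allI impI)
  fix s :: real and \<rho>\<^sub>0 u\<^sub>0 U\<^sub>0 V\<^sub>0 :: "real \<Rightarrow> real"
  assume s: "5 \<le> s" and \<rho>\<^sub>0: "sobolev s \<rho>\<^sub>0" "prob_density \<rho>\<^sub>0" "\<forall>x. \<rho>\<^sub>0 x > 0"
    and u\<^sub>0: "sobolev s u\<^sub>0" and U\<^sub>0: "periodic U\<^sub>0" "\<forall>x. (U\<^sub>0 has_real_derivative u\<^sub>0 x) (at x)"
    and V\<^sub>0: "V\<^sub>0 = (\<lambda>x. ln (\<rho>\<^sub>0 x))"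
  obtain f1 f2 f3 f4 where f: "\<And>x. (\<rho>\<^sub>0 has_real_derivative f1 x) (at x)"
    "\<And>x. (f1 has_real_derivative f2 x) (at x)" "\<And>x. (f2 has_real_derivative f3 x) (at x)"
    "\<And>x. (f3 has_real_derivative f4 x) (at x)" "continuous_on UNIV f4"
    by (rule sobolev_imp_C4[OF \<rho>\<^sub>0(1) s]) (rule that)
  obtain u1 u2 u3 u4 where u: "\<And>x. (u\<^sub>0 has_real_derivative u1 x) (at x)" "\<And>x. (u1 has_real_derivative u2 x) (at x)"
    "\<And>x. (u2 has_real_derivative u3 x) (at x)" "\<And>x. (u3 has_real_derivative u4 x) (at x)" "continuous_on UNIV u4"
    by (rule sobolev_imp_C4[OF u\<^sub>0 s]) (rule that)
  have u1: "continuous_on UNIV u1" using u(2) by (rule DERIV_imp_continuous_on)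
  have \<rho>\<^sub>0': "periodic \<rho>\<^sub>0" "\<And>x. \<rho>\<^sub>0 x > 0" "(LINT x|torus. \<rho>\<^sub>0 x) = 1"
    using \<rho>\<^sub>0(2,3) by (auto simp: prob_density_def)
  obtain K \<epsilon>\<^sub>0 where "\<epsilon>\<^sub>0 > 0" and bound: "\<And>\<epsilon> h N. 0 < \<epsilon> \<Longrightarrow> \<epsilon> \<le> \<epsilon>\<^sub>0 \<Longrightarrow> 0 < h \<Longrightarrow> 0 < N \<Longrightarrow>
      \<bar>modulated_energy \<rho>\<^sub>0 u\<^sub>0 \<epsilon> h N (init_kernel (\<lambda>x. ln (\<rho>\<^sub>0 x)) U\<^sub>0 \<epsilon> h N)\<bar>
        \<le> K * (h\<^sup>2 + 1 / (\<epsilon> * real N) + \<epsilon>)"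
    by (rule modulated_energy_bound[OF f \<rho>\<^sub>0' U\<^sub>0(2)[rule_format] u(1) u1 U\<^sub>0(1)]) (rule that)
  note K = bound[folded V\<^sub>0]
  show "\<exists>\<Lambda>>0. \<forall>\<epsilon> :: nat \<Rightarrow> real.
        (\<forall>N>0. \<epsilon> N > 0) \<longrightarrow>
        ((\<lambda>N. 1 / ((\<epsilon> N)\<^sup>2 * real N powr \<Lambda>)) \<longlonglongrightarrow> 0) \<longrightarrow>
        ((\<lambda>(h, N). modulated_energy \<rho>\<^sub>0 u\<^sub>0 (\<epsilon> N) h N (init_kernel V\<^sub>0 U\<^sub>0 (\<epsilon> N) h N)) \<longlongrightarrow> 0)
          (inf (filtercomap (\<lambda>(h, N). \<epsilon> N + h + 1 / real N) (nhds 0))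
               (principal {(h, N). h > 0 \<and> N > 0 \<and> (\<forall>x. init_density V\<^sub>0 (\<epsilon> N) x > 0)}))"
  proof (rule exI[of _ 2], intro conjI allI impI)
    fix \<epsilon> :: "nat \<Rightarrow> real"
    assume pos: "\<forall>N>0. \<epsilon> N > 0" and lim: "(\<lambda>N. 1 / ((\<epsilon> N)\<^sup>2 * real N powr 2)) \<longlonglongrightarrow> 0"
    define P :: "(real \<times> nat) set" where "P = {(h, N). h > 0 \<and> N > 0 \<and> (\<forall>x. init_density V\<^sub>0 (\<epsilon> N) x > 0)}"
    define G where "G = inf (filtercomap (\<lambda>(h, N). \<epsilon> N + h + 1 / real N) (nhds 0)) (principal P)"
    have "P \<subseteq> {(h, N). h > 0 \<and> N > 0}" by (auto simp: P_def)
    note limits = small_parameter_limits[of \<epsilon> P, OF pos[rule_format] lim this, folded G_def, unfolded case_prod_beta']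
    have "((\<lambda>z. K * ((fst z)\<^sup>2 + 1 / (\<epsilon> (snd z) * real (snd z)) + \<epsilon> (snd z))) \<longlongrightarrow> K * (0\<^sup>2 + 0 + 0)) G"
      by (intro tendsto_intros limits)
    then have K0: "((\<lambda>z. K * ((fst z)\<^sup>2 + 1 / (\<epsilon> (snd z) * real (snd z)) + \<epsilon> (snd z))) \<longlongrightarrow> 0) G"
      by simp
    have "eventually (\<lambda>z. z \<in> P) G"
      unfolding G_def by (rule filter_leD[OF inf_le2]) (simp add: eventually_principal)
    moreover have "eventually (\<lambda>z. \<epsilon> (snd z) < \<epsilon>\<^sub>0) G"
      using order_tendstoD(2)[OF limits(2) \<open>\<epsilon>\<^sub>0 > 0\<close>] .
    ultimately have "eventually (\<lambda>z. norm (modulated_energy \<rho>\<^sub>0 u\<^sub>0 (\<epsilon> (snd z)) (fst z) (snd z)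
        (init_kernel V\<^sub>0 U\<^sub>0 (\<epsilon> (snd z)) (fst z) (snd z)))
        \<le> K * ((fst z)\<^sup>2 + 1 / (\<epsilon> (snd z) * real (snd z)) + \<epsilon> (snd z))) G"
    proof eventually_elim
      case (elim z)
      then have "fst z > 0" "snd z > 0" by (auto simp: P_def)
      then show ?case
        using K[of "\<epsilon> (snd z)" "fst z" "snd z"] elim(2) pos by simp
    qed
    from Lim_null_comparison[OF this K0]
    show "((\<lambda>(h, N). modulated_energy \<rho>\<^sub>0 u\<^sub>0 (\<epsilon> N) h N (init_kernel V\<^sub>0 U\<^sub>0 (\<epsilon> N) h N)) \<longlongrightarrow> 0)
          (inf (filtercomap (\<lambda>(h, N). \<epsilon> N + h + 1 / real N) (nhds 0))
               (principal {(h, N). h > 0 \<and> N > 0 \<and> (\<forall>x. init_density V\<^sub>0 (\<epsilon> N) x > 0)}))"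
      unfolding G_def P_def by (simp add: case_prod_beta')
  qed simp
qed simp

end
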